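(* Let $\xi:C([0,T];\mathbb R^d)\to\mathbb R$ be continuous (for the supremum norm) and bounded. Then the function $v:\boldsymbol\Lambda\to\mathbb R$ given by $$v(t,\boldsymbol x)=\mathbb E\big[\xi(\boldsymbol W^{t,\boldsymbol x})\big],\qquad(t,\boldsymbol x)\in\boldsymbol\Lambda,$$ is continuous (with respect to $d_\infty$) and bounded. Moreover, $v$ is a (path-dependent) viscosity solution of the path-dependent heat equation $$\begin{cases}\partial_t^Hu(t,\boldsymbol x)+\frac12\mathrm{tr}\big[\partial^V_{\boldsymbol x\boldsymbol x}u(t,\boldsymbol x)\big]=0,&(t,\boldsymbol x)\in[0,T)\times C([0,T];\mathbb R^d),\\ u(T,\boldsymbol x)=\xi(\boldsymbol x),&\boldsymbol x\in C([0,T];\mathbb R^d).\end{cases}$$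
   Context: Fix $T>0$ and $d\in\mathbb N$, $d\ge1$. $D([0,T];\mathbb R^d)$ is the set of c\`adl\`ag functions $\boldsymbol{\hat x}:[0,T]\to\mathbb R^d$ and $C([0,T];\mathbb R^d)$ the subset of continuous functions; $\|\cdot\|_\infty$ is the supremum norm (with $|\cdot|$ the Euclidean norm on $\mathbb R^d$), and $\boldsymbol{\hat x}(\cdot\wedge t)$ is the path $s\mapsto\boldsymbol{\hat x}(s\wedge t)$. Set $\boldsymbol{\hat\Lambda}=[0,T]\times D([0,T];\mathbb R^d)$ and $\boldsymbol\Lambda=[0,T]\times C([0,T];\mathbb R^d)$. $\boldsymbol{\hat\Lambda}$ is endowed with the pseudometric $\hat d_\infty((t,\boldsymbol{\hat x}),(t',\boldsymbol{\hat x}'))=|t-t'|+\|\boldsymbol{\hat x}(\cdot\wedge t)-\boldsymbol{\hat x}'(\cdot\wedge t')\|_\infty$, and $\boldsymbol\Lambda$ with its restriction $d_\infty$; continuity and semicontinuity are with respect to these. A map $\hat u:\boldsymbol{\hat\Lambda}\to\mathbb R$ is non-anticipative if $\hat u(t,\boldsymbol{\hat x})=\hat u(t,\boldsymbol{\hat x}(\cdot\wedge t))$ for all $(t,\boldsymbol{\hat x})$ (automatic if $\hat u$ is continuous). For non-anticipative $\hat u$: the horizontal derivative is $\partial_t^H\hat u(t,\boldsymbol{\hat x})=\lim_{\delta\to0^+}\frac{\hat u(t+\delta,\boldsymbol{\hat x}(\cdot\wedge t))-\hat u(t,\boldsymbol{\hat x})}{\delta}$ for $t<T$, and $\partial_t^H\hat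 u(T,\boldsymbol{\hat x})=\lim_{t\to T^-}\partial_t^H\hat u(t,\boldsymbol{\hat x})$; the vertical derivatives are $\partial^V_{x_i}\hat u(t,\boldsymbol{\hat x})=\lim_{h\to0}\frac{\hat u(t,\boldsymbol{\hat x}+h\mathbf e_i1_{[t,T]})-\hat u(t,\boldsymbol{\hat x})}{h}$ and $\partial^V_{x_ix_j}\hat u=\partial^V_{x_j}(\partial^V_{x_i}\hat u)$, where $\mathbf e_1,\dots,\mathbf e_d$ is the standard basis; $\partial^V_{\boldsymbol x}\hat u=(\partial^V_{x_i}\hat u)_i$, $\partial^V_{\boldsymbol x\boldsymbol x}\hat u=(\partial^V_{x_ix_j}\hat u)_{i,j}$. $\boldsymbol C^{1,2}(\boldsymbol{\hat\Lambda})$ is the set of continuous $\hat u:\boldsymbol{\hat\Lambda}\to\mathbb R$ such that $\partial_t^H\hat u,\partial^V_{\boldsymbol x}\hat u,\partial^V_{\boldsymbol x\boldsymbol x}\hat u$ exist everywhere on $\boldsymbol{\hat\Lambda}$ and are continuous. A map $\varphi:\boldsymbol\Lambda\to\mathbb R$ belongs to $\boldsymbol C^{1,2}(\boldsymbol\Lambda)$ if there is $\hat\varphi\in\boldsymbol C^{1,2}(\boldsymbol{\hat\Lambda})$ with $\hat\varphi=\varphi$ on $\boldsymbol\Lambda$; its pathwise derivatives are the restrictions to $\boldsymbol\Lambda$ of those of $\hat\varphi$ (independent of the choice of $\hat\varphi$). $\boldsymbol C^{1,2}_{\mathrm{pol}}(\boldsymbol\Lambda)$ is the set of $\varphi\in\boldsymbol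 C^{1,2}(\boldsymbol\Lambda)$ such that $\varphi,\partial_t^H\varphi,\partial^V_{\boldsymbol x}\varphi,\partial^V_{\boldsymbol x\boldsymbol x}\varphi$ satisfy a polynomial growth condition (i.e. are bounded in norm by $K(1+\|\boldsymbol x\|_\infty^q)$ for some constants $K,q>0$). An upper semicontinuous $u:\boldsymbol\Lambda\to\mathbb R$ is a viscosity subsolution of the path-dependent heat equation with terminal condition $\xi$ if $u(T,\cdot)\le\xi$ and, for any $(t,\boldsymbol x)\in[0,T)\times C([0,T];\mathbb R^d)$ and $\varphi\in\boldsymbol C^{1,2}_{\mathrm{pol}}(\boldsymbol\Lambda)$ with $(u-\varphi)(t,\boldsymbol x)=\sup_{\boldsymbol\Lambda}(u-\varphi)$, one has $-\partial_t^H\varphi(t,\boldsymbol x)-\frac12\mathrm{tr}[\partial^V_{\boldsymbol x\boldsymbol x}\varphi(t,\boldsymbol x)]\le0$. A lower semicontinuous $u$ is a viscosity supersolution if $u(T,\cdot)\ge\xi$ and, for any such $(t,\boldsymbol x)$ and $\varphi$ with $(u-\varphi)(t,\boldsymbol x)=\inf_{\boldsymbol\Lambda}(u-\varphi)$, one has $-\partial_t^H\varphi(t,\boldsymbol x)-\frac12\mathrm{tr}[\partial^V_{\boldsymbol x\boldsymbol x}\varphi(t,\boldsymbol x)]\ge0$. A continuous $u$ is a viscosity solution if it is both a sub- and a supersolution. $\boldsymbol W=(\boldsymbol W_s)_{s\in[0,T]}$ is a $d$-dimensional Brownian motion on a complete probability space $(\Omega,\mathcal F,\mathbb P)$, and $\boldsymbol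 W^{t,\boldsymbol x}_s=\boldsymbol x(s)$ for $s\le t$, $\boldsymbol W^{t,\boldsymbol x}_s=\boldsymbol x(t)+\boldsymbol W_s-\boldsymbol W_t$ for $s>t$. *)

theory Defs
  imports "HOL-Probability.Probability"
begin

section \<open>Path spaces\<close>

text \<open>Paths on $[0,T]$ are represented by functions that are extensional on \<open>{0..T}\<close>,
  so that two paths are equal iff they agree on $[0,T]$. The functionals below are total functions
  on time-path pairs; only their values on the relevant carrier matter.\<close>

definition cadlag_paths :: "real \<Rightarrow> (real \<Rightarrow> real ^ 'd) set" where
  "cadlag_paths T = {x \<in> extensional {0..T}.
     (\<forall>t\<in>{0..<T}. (x \<longlongrightarrow> x t) (at_right t)) \<and>
     (\<forall>t\<in>{0<..T}. \<exists>l. (x \<longlongrightarrow> l) (at_left t))}"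

definition cont_paths :: "real \<Rightarrow> (real \<Rightarrow> real ^ 'd) set" where
  "cont_paths T = {x \<in> extensional {0..T}. continuous_on {0..T} x}"

definition cadlag_domain :: "real \<Rightarrow> (real \<times> (real \<Rightarrow> real ^ 'd)) set" where
  "cadlag_domain T = {0..T} \<times> cadlag_paths T"

definition cont_domain :: "real \<Rightarrow> (real \<times> (real \<Rightarrow> real ^ 'd)) set" where
  "cont_domain T = {0..T} \<times> cont_paths T"

definition sup_norm :: "real \<Rightarrow> (real \<Rightarrow> real ^ 'd) \<Rightarrow> real" where
  "sup_norm T x = (SUP s\<in>{0..T}. norm (x s))"

definition sup_dist :: "real \<Rightarrow> (real \<Rightarrow> real ^ 'd) \<Rightarrow> (real \<Rightarrow> real ^ 'd) \<Rightarrow> real" where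
  "sup_dist T x y = sup_norm T (\<lambda>s. x s - y s)"

definition stopped :: "real \<Rightarrow> real \<Rightarrow> (real \<Rightarrow> real ^ 'd) \<Rightarrow> (real \<Rightarrow> real ^ 'd)" where
  "stopped T t x = (\<lambda>s\<in>{0..T}. x (min s t))"

definition d_inf ::
  "real \<Rightarrow> real \<times> (real \<Rightarrow> real ^ 'd) \<Rightarrow> real \<times> (real \<Rightarrow> real ^ 'd) \<Rightarrow> real" where
  "d_inf T = (\<lambda>(t, x) (t', x'). \<bar>t - t'\<bar> + sup_dist T (stopped T t x) (stopped T t' x'))"


section \<open>Continuity with respect to a pseudometric on a set\<close>

definition pm_continuous_on ::
  "('p \<Rightarrow> 'p \<Rightarrow> real) \<Rightarrow> 'p set \<Rightarrow> ('p \<Rightarrow> 'b::metric_space) \<Rightarrow> bool" where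
  "pm_continuous_on \<rho> S f \<longleftrightarrow>
     (\<forall>p\<in>S. \<forall>\<epsilon>>0. \<exists>\<delta>>0. \<forall>q\<in>S. \<rho> p q < \<delta> \<longrightarrow> dist (f q) (f p) < \<epsilon>)"

definition pm_usc_on :: "('p \<Rightarrow> 'p \<Rightarrow> real) \<Rightarrow> 'p set \<Rightarrow> ('p \<Rightarrow> real) \<Rightarrow> bool" where
  "pm_usc_on \<rho> S f \<longleftrightarrow>
     (\<forall>p\<in>S. \<forall>\<epsilon>>0. \<exists>\<delta>>0. \<forall>q\<in>S. \<rho> p q < \<delta> \<longrightarrow> f q < f p + \<epsilon>)"

definition pm_lsc_on :: "('p \<Rightarrow> 'p \<Rightarrow> real) \<Rightarrow> 'p set \<Rightarrow> ('p \<Rightarrow> real) \<Rightarrow> bool" where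
  "pm_lsc_on \<rho> S f \<longleftrightarrow>
     (\<forall>p\<in>S. \<forall>\<epsilon>>0. \<exists>\<delta>>0. \<forall>q\<in>S. \<rho> p q < \<delta> \<longrightarrow> f p - \<epsilon> < f q)"


section \<open>Pathwise derivatives\<close>

definition horizontal_quotient ::
  "real \<Rightarrow> (real \<times> (real \<Rightarrow> real ^ 'd) \<Rightarrow> real) \<Rightarrow> real \<Rightarrow> (real \<Rightarrow> real ^ 'd) \<Rightarrow> real \<Rightarrow> real" where
  "horizontal_quotient T u t x \<delta> = (u (t + \<delta>, stopped T t x) - u (t, x)) / \<delta>"

text \<open>\<open>Lim\<close> is meaningful only where the limit exists; existence is demanded separately by the
  differentiability predicates.\<close>

definition horizontal_deriv ::
  "real \<Rightarrow> (real \<times> (real \<Rightarrow> real ^ 'd) \<Rightarrow> real) \<Rightarrow> real \<times> (real \<Rightarrow> real ^ 'd) \<Rightarrow> real" where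
  "horizontal_deriv T u = (\<lambda>(t, x).
     if t < T then Lim (at_right 0) (horizontal_quotient T u t x)
     else Lim (at_left T) (\<lambda>s. Lim (at_right 0) (horizontal_quotient T u s x)))"

definition horizontally_differentiable ::
  "real \<Rightarrow> (real \<times> (real \<Rightarrow> real ^ 'd) \<Rightarrow> real) \<Rightarrow> bool" where
  "horizontally_differentiable T u \<longleftrightarrow> (\<forall>x\<in>cadlag_paths T.
     (\<forall>t\<in>{0..<T}. \<exists>l. (horizontal_quotient T u t x \<longlongrightarrow> l) (at_right 0)) \<and>
     (\<exists>l. ((\<lambda>t. horizontal_deriv T u (t, x)) \<longlongrightarrow> l) (at_left T)))"

definition bump ::
  "real \<Rightarrow> real \<Rightarrow> real ^ 'd \<Rightarrow> (real \<Rightarrow> real ^ 'd) \<Rightarrow> (real \<Rightarrow> real ^ 'd)" where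
  "bump T t y x = (\<lambda>s\<in>{0..T}. x s + (if t \<le> s then y else 0))"

definition vertical_quotient ::
  "real \<Rightarrow> 'd \<Rightarrow> (real \<times> (real \<Rightarrow> real ^ 'd) \<Rightarrow> real) \<Rightarrow> real \<Rightarrow> (real \<Rightarrow> real ^ 'd) \<Rightarrow> real \<Rightarrow> real"
  where
  "vertical_quotient T i u t x h = (u (t, bump T t (h *\<^sub>R axis i 1) x) - u (t, x)) / h"

definition vertical_deriv ::
  "real \<Rightarrow> 'd \<Rightarrow> (real \<times> (real \<Rightarrow> real ^ 'd) \<Rightarrow> real) \<Rightarrow> real \<times> (real \<Rightarrow> real ^ 'd) \<Rightarrow> real" where
  "vertical_deriv T i u = (\<lambda>(t, x). Lim (at 0) (vertical_quotient T i u t x))"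

definition vertically_differentiable ::
  "real \<Rightarrow> 'd \<Rightarrow> (real \<times> (real \<Rightarrow> real ^ 'd) \<Rightarrow> real) \<Rightarrow> bool" where
  "vertically_differentiable T i u \<longleftrightarrow>
     (\<forall>(t, x)\<in>cadlag_domain T. \<exists>l. (vertical_quotient T i u t x \<longlongrightarrow> l) (at 0))"

definition vertical_grad ::
  "real \<Rightarrow> (real \<times> (real \<Rightarrow> real ^ 'd) \<Rightarrow> real) \<Rightarrow> real \<times> (real \<Rightarrow> real ^ 'd) \<Rightarrow> real ^ 'd" where
  "vertical_grad T u p = (\<chi> i. vertical_deriv T i u p)"

definition vertical_hessian ::
  "real \<Rightarrow> (real \<times> (real \<Rightarrow> real ^ 'd) \<Rightarrow> real) \<Rightarrow> real \<times> (real \<Rightarrow> real ^ 'd) \<Rightarrow> real ^ 'd ^ 'd" where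
  "vertical_hessian T u p = (\<chi> i j. vertical_deriv T j (vertical_deriv T i u) p)"

text \<open>Continuity for \<open>d_inf\<close> forces non-anticipativity, because the pseudodistance between
  \<open>(t, x)\<close> and \<open>(t, stopped T t x)\<close> is zero.\<close>

definition C12_cadlag :: "real \<Rightarrow> (real \<times> (real \<Rightarrow> real ^ 'd) \<Rightarrow> real) set" where
  "C12_cadlag T = {u.
     pm_continuous_on (d_inf T) (cadlag_domain T) u \<and>
     horizontally_differentiable T u \<and>
     (\<forall>i. vertically_differentiable T i u) \<and>
     (\<forall>i j. vertically_differentiable T j (vertical_deriv T i u)) \<and>
     pm_continuous_on (d_inf T) (cadlag_domain T) (horizontal_deriv T u) \<and>
     pm_continuous_on (d_inf T) (cadlag_domain T) (vertical_grad T u) \<and>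
     pm_continuous_on (d_inf T) (cadlag_domain T) (vertical_hessian T u)}"

definition polynomial_growth ::
  "real \<Rightarrow> (real \<times> (real \<Rightarrow> real ^ 'd) \<Rightarrow> 'b::real_normed_vector) \<Rightarrow> bool" where
  "polynomial_growth T f \<longleftrightarrow> (\<exists>K>0. \<exists>q>0. \<forall>(t, x)\<in>cont_domain T.
     norm (f (t, x)) \<le> K * (1 + sup_norm T x powr q))"

text \<open>\<open>C12_pol_via T \<phi> \<psi>\<close>: the map \<open>\<phi>\<close> on continuous paths is of class $C^{1,2}_{pol}$, as witnessed
  by the extension \<open>\<psi>\<close> to cadlag paths. The pathwise derivatives of \<open>\<phi>\<close> are the restrictions of those
  of \<open>\<psi>\<close>; as they do not depend on the extension, quantifying over pairs \<open>(\<phi>, \<psi>)\<close> is the same as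
  quantifying over the functions \<open>\<phi>\<close> of that class.\<close>

definition C12_pol_via ::
  "real \<Rightarrow> (real \<times> (real \<Rightarrow> real ^ 'd) \<Rightarrow> real) \<Rightarrow> (real \<times> (real \<Rightarrow> real ^ 'd) \<Rightarrow> real) \<Rightarrow> bool" where
  "C12_pol_via T \<phi> \<psi> \<longleftrightarrow>
     \<psi> \<in> C12_cadlag T \<and> (\<forall>p\<in>cont_domain T. \<psi> p = \<phi> p) \<and>
     polynomial_growth T \<phi> \<and>
     polynomial_growth T (horizontal_deriv T \<psi>) \<and>
     polynomial_growth T (vertical_grad T \<psi>) \<and>
     polynomial_growth T (vertical_hessian T \<psi>)"


section \<open>Viscosity solutions of the path-dependent heat equation\<close>

text \<open>The supremum and infimum over the whole domain are taken in the extended reals, since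
  \<open>u - \<phi>\<close> need not be bounded.\<close>

definition viscosity_subsolution ::
  "real \<Rightarrow> ((real \<Rightarrow> real ^ 'd) \<Rightarrow> real) \<Rightarrow> (real \<times> (real \<Rightarrow> real ^ 'd) \<Rightarrow> real) \<Rightarrow> bool" where
  "viscosity_subsolution T \<xi> u \<longleftrightarrow>
     pm_usc_on (d_inf T) (cont_domain T) u \<and>
     (\<forall>x\<in>cont_paths T. u (T, x) \<le> \<xi> x) \<and>
     (\<forall>t\<in>{0..<T}. \<forall>x\<in>cont_paths T. \<forall>\<phi> \<psi>. C12_pol_via T \<phi> \<psi> \<longrightarrow>
        ereal (u (t, x) - \<phi> (t, x)) = (SUP p\<in>cont_domain T. ereal (u p - \<phi> p)) \<longrightarrow>
        - horizontal_deriv T \<psi> (t, x) - 1 / 2 * trace (vertical_hessian T \<psi> (t, x)) \<le> 0)"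

definition viscosity_supersolution ::
  "real \<Rightarrow> ((real \<Rightarrow> real ^ 'd) \<Rightarrow> real) \<Rightarrow> (real \<times> (real \<Rightarrow> real ^ 'd) \<Rightarrow> real) \<Rightarrow> bool" where
  "viscosity_supersolution T \<xi> u \<longleftrightarrow>
     pm_lsc_on (d_inf T) (cont_domain T) u \<and>
     (\<forall>x\<in>cont_paths T. u (T, x) \<ge> \<xi> x) \<and>
     (\<forall>t\<in>{0..<T}. \<forall>x\<in>cont_paths T. \<forall>\<phi> \<psi>. C12_pol_via T \<phi> \<psi> \<longrightarrow>
        ereal (u (t, x) - \<phi> (t, x)) = (INF p\<in>cont_domain T. ereal (u p - \<phi> p)) \<longrightarrow>
        - horizontal_deriv T \<psi> (t, x) - 1 / 2 * trace (vertical_hessian T \<psi> (t, x)) \<ge> 0)"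

definition viscosity_solution ::
  "real \<Rightarrow> ((real \<Rightarrow> real ^ 'd) \<Rightarrow> real) \<Rightarrow> (real \<times> (real \<Rightarrow> real ^ 'd) \<Rightarrow> real) \<Rightarrow> bool" where
  "viscosity_solution T \<xi> u \<longleftrightarrow>
     pm_continuous_on (d_inf T) (cont_domain T) u \<and>
     viscosity_subsolution T \<xi> u \<and> viscosity_supersolution T \<xi> u"


section \<open>Brownian motion\<close>

text \<open>The joint density below is that of the centred Gaussian law with covariance
  \<open>(t - s)\<close> times the identity matrix. Path continuity and \<open>W 0 = 0\<close> are required almost surely.\<close>

definition brownian_motion_on ::
  "real \<Rightarrow> 'a measure \<Rightarrow> (real \<Rightarrow> 'a \<Rightarrow> real ^ 'd) \<Rightarrow> bool" where
  "brownian_motion_on T M W \<longleftrightarrow> prob_space M \<and>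
     (\<forall>s\<in>{0..T}. W s \<in> borel_measurable M) \<and>
     (AE \<omega> in M. W 0 \<omega> = 0) \<and>
     (AE \<omega> in M. continuous_on {0..T} (\<lambda>s. W s \<omega>)) \<and>
     (\<forall>n. \<forall>\<tau> :: nat \<Rightarrow> real. (\<forall>k\<le>n. \<tau> k \<in> {0..T}) \<longrightarrow> (\<forall>k<n. \<tau> k < \<tau> (Suc k)) \<longrightarrow>
        prob_space.indep_vars M (\<lambda>_. borel) (\<lambda>k \<omega>. W (\<tau> (Suc k)) \<omega> - W (\<tau> k) \<omega>) {..<n}) \<and>
     (\<forall>s t. 0 \<le> s \<longrightarrow> s < t \<longrightarrow> t \<le> T \<longrightarrow>
        distributed M lborel (\<lambda>\<omega>. W t \<omega> - W s \<omega>)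
          (\<lambda>y. ennreal (\<Prod>i\<in>UNIV. normal_density 0 (sqrt (t - s)) (y $ i))))"

definition brownian_from ::
  "real \<Rightarrow> (real \<Rightarrow> 'a \<Rightarrow> real ^ 'd) \<Rightarrow> real \<Rightarrow> (real \<Rightarrow> real ^ 'd) \<Rightarrow> 'a \<Rightarrow> (real \<Rightarrow> real ^ 'd)" where
  "brownian_from T W t x \<omega> = (\<lambda>s\<in>{0..T}. if s \<le> t then x s else x t + W s \<omega> - W t \<omega>)"

end

theory Submission imports Defs begin

text \<open>Continuity of $v$ is a pathwise matter: if $(t_n, x_n)$ tends to $(t, x)$ for $d_\infty$, then
  the paths $W^{t_n,x_n}$ tend to $W^{t,x}$ uniformly, almost surely, and dominated convergence applies.

  For the viscosity property, let $v - \varphi$ be maximal at $(t, x)$, let $u = t + h$, and write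
  $L = \partial_t^H\varphi + \frac12 \mathrm{tr}\,\partial^V_{xx}\varphi$ at $(t, x)$. By the tower property
  (\<open>payoff_tower\<close>) the expectation of $v(u, W^{t,x}) - v(t, x)$ vanishes. Let $G$ be the event that
  the Brownian path moves by at most $r$ during $[t, u]$. Its complement has probability $O(h^2)$, by
  Ottaviani's inequality and fourth moments (\<open>grid_maximal_inequality\<close>), and $v$ is bounded; hence
  $E[1_G (v(u, W^{t,x}) - v(t, x))] = O(h^2)$. On $G$ the increment of $v$ is at most that of
  $\varphi$, so it remains to know that $E[1_G(\varphi(u, W^{t,x}) - \varphi(t, x))] = h L + O(\eta h) + O(h^2)$,
  where $\eta$ is as small as desired provided $r$ and $h$ are small. Dividing by $h$ gives $L \ge 0$.
  A minimum is treated in the same way; a sign $\sigma$ covers both cases at once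
  (\<open>expected_payoff_touching\<close>).

  The last expansion (\<open>local_expectation\<close>) takes the place of the functional Ito formula and needs no stochastic integral. On
  a grid of $[t, u]$ the Brownian path is replaced by the cadlag path that jumps by the Gaussian increment
  at each grid point. The extension $\hat\varphi$ to cadlag paths changes along such a path in two ways. Between grid points
  the path is frozen and the horizontal derivative governs the change. At a grid point the path is
  bumped by a Gaussian vector; moving one coordinate at a time, the first-order terms have
  expectation zero by symmetry, and the pure second derivatives contribute the trace
  (\<open>gaussian_local_expansion\<close>). Stopping at the first exit from the ball of radius $r$ and discarding jumps longer than
  $2r$ confines everything to a neighbourhood of $(t, x)$ where the derivatives are within $\eta$ of
  their values at $(t, x)$. The increments are independent, so each
  step can be integrated with the past held fixed (\<open>increments_iterated_expectation\<close>). As the grid is refined, the step paths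
  converge uniformly to the Brownian path, and bounded convergence gives the claim.

  The tower property is obtained in the same spirit: for polygons through the grid values it is
  Fubini's theorem for independent increments, and it passes to the limit by bounded convergence.\<close>

section \<open>Continuity for pseudometrics and distances between paths\<close>

lemma pm_continuous_on_seqI:
  assumes nonneg: "\<And>p q. p \<in> S \<Longrightarrow> q \<in> S \<Longrightarrow> 0 \<le> \<rho> p q"
    and lim: "\<And>p q. p \<in> S \<Longrightarrow> (\<And>n::nat. q n \<in> S) \<Longrightarrow> (\<lambda>n. \<rho> p (q n)) \<longlonglongrightarrow> 0 \<Longrightarrow> (\<lambda>n. f (q n)) \<longlonglongrightarrow> f p"
  shows "pm_continuous_on \<rho> S f"
  unfolding pm_continuous_on_def
proof (intro ballI allI impI, rule ccontr)
  fix p and \<epsilon> :: real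
  assume p: "p \<in> S" "0 < \<epsilon>" and no: "\<not> (\<exists>\<delta>>0. \<forall>q\<in>S. \<rho> p q < \<delta> \<longrightarrow> dist (f q) (f p) < \<epsilon>)"
  have "\<forall>n::nat. \<exists>q. q \<in> S \<and> \<rho> p q < inverse (real (Suc n)) \<and> \<not> dist (f q) (f p) < \<epsilon>"
    using no by (metis inverse_positive_iff_positive of_nat_0_less_iff zero_less_Suc)
  then obtain q where q: "q n \<in> S" "\<rho> p (q n) < inverse (real (Suc n))" "\<not> dist (f (q n)) (f p) < \<epsilon>" for n
    by metis
  have "(\<lambda>n. \<rho> p (q n)) \<longlonglongrightarrow> 0"
    by (rule tendsto_sandwich[OF _ _ tendsto_const LIMSEQ_inverse_real_of_nat])
      (use q p nonneg in \<open>auto intro!: always_eventually less_imp_le\<close>)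
  then have "(\<lambda>n. f (q n)) \<longlonglongrightarrow> f p" using lim p q by blast
  then have "\<forall>\<^sub>F n in sequentially. dist (f (q n)) (f p) < \<epsilon>" using p by (simp add: tendsto_iff)
  then show False using q by simp
qed

lemma pm_continuous_on_tendsto:
  assumes "pm_continuous_on \<rho> S f" "p \<in> S" "\<forall>\<^sub>F n in F. q n \<in> S"
    and close: "\<And>\<delta>. \<delta> > 0 \<Longrightarrow> \<forall>\<^sub>F n in F. \<rho> p (q n) < \<delta>"
  shows "((\<lambda>n. f (q n)) \<longlongrightarrow> f p) F"
proof (rule tendstoI)
  fix \<epsilon> :: real assume "0 < \<epsilon>"
  then obtain \<delta> where "\<delta> > 0" and \<delta>: "\<forall>q\<in>S. \<rho> p q < \<delta> \<longrightarrow> dist (f q) (f p) < \<epsilon>"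
    using assms(1,2) unfolding pm_continuous_on_def by blast
  from close[OF \<open>\<delta> > 0\<close>] assms(3) show "\<forall>\<^sub>F n in F. dist (f (q n)) (f p) < \<epsilon>" by eventually_elim (use \<delta> in auto)
qed

lemma cont_paths_bounded:
  fixes x :: "real \<Rightarrow> real ^ 'd"
  assumes "x \<in> cont_paths T" shows "bounded (x ` {0..T})"
  using assms by (auto simp: cont_paths_def intro!: compact_imp_bounded compact_continuous_image)

lemma cont_paths_subset_cadlag_paths: "cont_paths T \<subseteq> cadlag_paths T"
proof
  fix x :: "real \<Rightarrow> real ^ 'd" assume x: "x \<in> cont_paths T"
  then have c: "continuous_on {0..T} x" by (simp add: cont_paths_def)
  have r: "(x \<longlongrightarrow> x t) (at_right t)" if "t \<in> {0..<T}" for t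
  proof -
    have "(x \<longlongrightarrow> x t) (at t within {0..T})" using c that by (auto simp: continuous_on)
    then have "(x \<longlongrightarrow> x t) (at t within {t..T})" by (rule tendsto_within_subset) (use that in auto)
    then show ?thesis using that by (simp add: at_within_Icc_at_right)
  qed
  have l: "(x \<longlongrightarrow> x t) (at_left t)" if "t \<in> {0<..T}" for t
  proof -
    have "(x \<longlongrightarrow> x t) (at t within {0..T})" using c that by (auto simp: continuous_on)
    then have "(x \<longlongrightarrow> x t) (at t within {0..t})" by (rule tendsto_within_subset) (use that in auto)
    then show ?thesis using that by (simp add: at_within_Icc_at_left)
  qed
  show "x \<in> cadlag_paths T" using x r l unfolding cadlag_paths_def cont_paths_def by blast
qed

lemma sup_dist_le:
  assumes "0 \<le> T" "\<And>s. s \<in> {0..T} \<Longrightarrow> norm (x s - y s) \<le> c"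
  shows "sup_dist T x y \<le> c"
  unfolding sup_dist_def sup_norm_def by (rule cSUP_least) (use assms in auto)

lemma norm_diff_le_sup_dist:
  assumes "bounded (x ` {0..T})" "bounded (y ` {0..T})" "s \<in> {0..T}"
  shows "norm (x s - y s) \<le> sup_dist T x y"
proof -
  obtain a b where "\<And>s. s \<in> {0..T} \<Longrightarrow> norm (x s) \<le> a" "\<And>s. s \<in> {0..T} \<Longrightarrow> norm (y s) \<le> b"
    using assms(1,2) unfolding bounded_iff by (meson imageI)
  then have "bdd_above ((\<lambda>s. norm (x s - y s)) ` {0..T})"
    by (intro bdd_aboveI2[of _ _ "a + b"]) (meson add_mono norm_triangle_ineq4 order_trans)
  then show ?thesis unfolding sup_dist_def sup_norm_def using assms(3) by (intro cSUP_upper)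
qed

lemma d_inf_le:
  assumes "0 \<le> T" "t \<in> {0..T}" "u \<in> {0..T}"
    "\<And>s. s \<in> {0..T} \<Longrightarrow> norm (x (min s t) - y (min s u)) \<le> c"
  shows "d_inf T (t, x) (u, y) \<le> \<bar>t - u\<bar> + c"
  unfolding d_inf_def using assms
  by (auto intro!: sup_dist_le simp: stopped_def)

lemma norm_diff_le_d_inf:
  assumes "(t, x) \<in> cont_domain T" "(u, y) \<in> cont_domain T" "s \<in> {0..T}"
  shows "\<bar>t - u\<bar> + norm (x (min s t) - y (min s u)) \<le> d_inf T (t, x) (u, y)"
proof -
  have "bounded (stopped T t x ` {0..T})" if "(t, x) \<in> cont_domain T" for t and x :: "real \<Rightarrow> real ^ 'd"
  proof (rule bounded_subset)
    show "bounded (x ` {0..T})" using that by (auto simp: cont_domain_def intro: cont_paths_bounded)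
    show "stopped T t x ` {0..T} \<subseteq> x ` {0..T}" using that by (auto simp: cont_domain_def stopped_def)
  qed
  then have "norm (stopped T t x s - stopped T u y s) \<le> sup_dist T (stopped T t x) (stopped T u y)"
    using assms by (intro norm_diff_le_sup_dist) auto
  then show ?thesis using assms by (simp add: d_inf_def stopped_def)
qed

lemma d_inf_nonneg:
  assumes "(t, x) \<in> cont_domain T" "(u, y) \<in> cont_domain T"
  shows "0 \<le> d_inf T (t, x) (u, y)"
proof -
  have "t \<in> {0..T}" using assms by (simp add: cont_domain_def)
  from norm_diff_le_d_inf[OF assms this] show ?thesis
    using norm_ge_zero[of "x (min t t) - y (min t u)"] by linarith
qed

text \<open>The path that follows \<open>x\<close> up to \<open>t\<close> and then the increments of \<open>w\<close>. Using \<open>min s t\<close> and \<open>max s t\<close>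
  instead of a case distinction makes it additive in \<open>x\<close> and \<open>w\<close>, so distances split into a contribution
  of each.\<close>

definition concat_path :: "real \<Rightarrow> real \<Rightarrow> (real \<Rightarrow> real ^ 'd) \<Rightarrow> (real \<Rightarrow> real ^ 'd) \<Rightarrow> (real \<Rightarrow> real ^ 'd)" where
  "concat_path T t x w = (\<lambda>s\<in>{0..T}. x (min s t) + (w (max s t) - w t))"

lemma brownian_from_eq_concat_path: "brownian_from T W t x \<omega> = concat_path T t x (\<lambda>s. W s \<omega>)"
  by (auto simp: brownian_from_def concat_path_def fun_eq_iff restrict_def min_def max_def)

text \<open>The flow property behind the tower property: restarting at a later time with the same driving path
  changes nothing.\<close>

lemma concat_path_concat_path:
  assumes "0 \<le> t" "t \<le> u" "u \<le> T"
  shows "concat_path T u (concat_path T t x w) w = concat_path T t x w"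
  using assms by (auto simp: concat_path_def fun_eq_iff restrict_def min_def max_def)

lemma concat_path_in_cont_paths:
  assumes "x \<in> cont_paths T" "t \<in> {0..T}" "continuous_on {t..T} w"
  shows "concat_path T t x w \<in> cont_paths T"
proof -
  have "continuous_on {0..T} (\<lambda>s. x (min s t))"
    using assms by (intro continuous_on_compose2[of "{0..T}" x _ "\<lambda>s. min s t"])
      (auto simp: cont_paths_def intro!: continuous_intros)
  moreover have "continuous_on {0..T} (\<lambda>s. w (max s t))"
    using assms by (intro continuous_on_compose2[of "{t..T}" w _ "\<lambda>s. max s t"])
      (auto intro!: continuous_intros)
  ultimately have "continuous_on {0..T} (\<lambda>s. x (min s t) + (w (max s t) - w t))"
    by (intro continuous_intros)
  then have "continuous_on {0..T} (concat_path T t x w)"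
    by (rule continuous_on_eq) (simp add: concat_path_def)
  then show ?thesis by (simp add: cont_paths_def concat_path_def)
qed

lemma sup_dist_concat_path:
  assumes "(t, x) \<in> cont_domain T" "(u, y) \<in> cont_domain T"
    and w: "\<And>s s'. s \<in> {0..T} \<Longrightarrow> s' \<in> {0..T} \<Longrightarrow> \<bar>s - s'\<bar> \<le> \<bar>t - u\<bar> \<Longrightarrow> norm (w s - w s') \<le> \<epsilon>"
  shows "sup_dist T (concat_path T t x w) (concat_path T u y w) \<le> d_inf T (t, x) (u, y) + 2 * \<epsilon>"
proof (rule sup_dist_le)
  have tu: "t \<in> {0..T}" "u \<in> {0..T}" using assms(1,2) by (auto simp: cont_domain_def)
  then show "0 \<le> T" by auto
  fix s assume s: "s \<in> {0..T}"
  have "norm (w (max s t) - w (max s u)) \<le> \<epsilon>" "norm (w t - w u) \<le> \<epsilon>" using s tu by (auto intro!: w)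
  moreover have "norm (x (min s t) - y (min s u)) \<le> d_inf T (t, x) (u, y)"
    using norm_diff_le_d_inf[OF assms(1,2) s] by linarith
  moreover have eq: "concat_path T t x w s - concat_path T u y w s =
      (x (min s t) - y (min s u)) + ((w (max s t) - w (max s u)) - (w t - w u))"
    using s by (simp add: concat_path_def)
  ultimately show "norm (concat_path T t x w s - concat_path T u y w s) \<le> d_inf T (t, x) (u, y) + 2 * \<epsilon>"
    unfolding eq
    using norm_triangle_ineq[of "x (min s t) - y (min s u)" "(w (max s t) - w (max s u)) - (w t - w u)"]
      norm_triangle_ineq4[of "w (max s t) - w (max s u)" "w t - w u"] by linarith
qed

section \<open>Approximation of a path from its increments on a grid\<close>

definition grid :: "real \<Rightarrow> real \<Rightarrow> nat \<Rightarrow> nat \<Rightarrow> real" where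
  "grid a b n k = a + real k * (b - a) / real n"

lemma grid_0 [simp]: "grid a b n 0 = a" by (simp add: grid_def)

lemma grid_end [simp]: "n > 0 \<Longrightarrow> grid a b n n = b" by (simp add: grid_def)

lemma grid_strict_mono: "a < b \<Longrightarrow> n > 0 \<Longrightarrow> i < j \<Longrightarrow> grid a b n i < grid a b n j"
  by (simp add: grid_def divide_strict_right_mono)

lemma grid_mono: "a \<le> b \<Longrightarrow> i \<le> j \<Longrightarrow> grid a b n i \<le> grid a b n j"
  by (simp add: grid_def divide_right_mono mult_right_mono)

lemma grid_Suc_diff: "grid a b n (Suc k) - grid a b n k = (b - a) / real n"
  by (simp add: grid_def algebra_simps add_divide_distrib diff_divide_distrib)

lemma grid_in_interval: "a \<le> b \<Longrightarrow> n > 0 \<Longrightarrow> k \<le> n \<Longrightarrow> grid a b n k \<in> {a..b}"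
  using grid_mono[of a b 0 k n] grid_mono[of a b k n n] by auto

lemma grid_double: "grid a b n k = grid a b (2 * n) (2 * k)"
  by (simp add: grid_def)

lemma grid_cell:
  assumes "a < b" "n > 0" "s \<in> {a..b}"
  obtains k where "k < n" "grid a b n k \<le> s" "s \<le> grid a b n (Suc k)"
proof (cases "s = b")
  case True
  have "grid a b n (Suc (n - 1)) = b" using assms(2) by simp
  moreover have "grid a b n (n - 1) \<le> b" using grid_in_interval[of a b n "n - 1"] assms by auto
  ultimately show ?thesis using assms True that[of "n - 1"] by auto
next
  case False
  define k where "k = nat \<lfloor>(s - a) * n / (b - a)\<rfloor>"
  have pos: "0 \<le> (s - a) * n / (b - a)" using assms by auto
  have k: "real k \<le> (s - a) * n / (b - a)" "(s - a) * n / (b - a) < real k + 1"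
    unfolding k_def using pos by linarith+
  have "(s - a) * n / (b - a) < n" using assms False by (simp add: field_simps)
  with k have "k < n" by linarith
  with k assms show ?thesis
    by (intro that[of k]) (simp_all add: grid_def field_simps)
qed

text \<open>The weight of the j-th increment goes from 0 to 1 while \<open>s\<close> crosses the j-th cell, in an arbitrary
  manner inside the cell. Thus at a point of the cell \<open>k\<close> the earlier increments telescope to the value at the left end of the cell, the
  later ones vanish, and the error is bounded by twice the oscillation of \<open>w\<close> over one cell. Continuous weights give
  polygons, on which a functional of continuous paths can be evaluated; indicator weights give step
  paths, whose jumps are compatible with vertical derivatives.\<close>

lemma weighted_increments_uniform_limit:
  fixes w :: "real \<Rightarrow> 'b::real_normed_vector"
  assumes "a < b" "continuous_on {a..b} w"
    and low: "\<And>n j s. s < grid a b n (Suc j) \<Longrightarrow> s \<le> grid a b n j \<Longrightarrow> \<rho> n j s = 0"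
    and high: "\<And>n j s. n > 0 \<Longrightarrow> grid a b n (Suc j) \<le> s \<Longrightarrow> \<rho> n j s = 1"
    and rng: "\<And>n j s. \<bar>\<rho> n j s\<bar> \<le> 1"
  shows "uniform_limit {a..b}
    (\<lambda>n s. \<Sum>j<n. \<rho> n j s *\<^sub>R (w (grid a b n (Suc j)) - w (grid a b n j))) (\<lambda>s. w s - w a) sequentially"
proof (rule uniform_limitI)
  fix \<epsilon> :: real assume \<epsilon>: "0 < \<epsilon>"
  have "uniformly_continuous_on {a..b} w" using assms(2) by (simp add: compact_uniformly_continuous)
  then obtain \<delta> where \<delta>: "\<delta> > 0" "\<And>s s'. s \<in> {a..b} \<Longrightarrow> s' \<in> {a..b} \<Longrightarrow> \<bar>s - s'\<bar> < \<delta> \<Longrightarrow> norm (w s - w s') < \<epsilon> / 2"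
    using \<epsilon> unfolding uniformly_continuous_on_def dist_norm by (metis half_gt_zero real_norm_def)
  obtain N :: nat where N: "(b - a) / \<delta> < real N" using reals_Archimedean2 by blast
  show "\<forall>\<^sub>F n in sequentially. \<forall>s\<in>{a..b}. dist (\<Sum>j<n. \<rho> n j s *\<^sub>R (w (grid a b n (Suc j)) - w (grid a b n j))) (w s - w a) < \<epsilon>"
    using eventually_ge_at_top[of N]
  proof eventually_elim
    case (elim n)
    have "0 < (b - a) / \<delta>" using \<delta> assms by simp
    then have n: "n > 0" "(b - a) / \<delta> < real n" using N elim by linarith+
    then have mesh: "(b - a) / real n < \<delta>" using \<delta> by (simp add: field_simps)
    show ?case
    proof
      fix s assume s: "s \<in> {a..b}"
      obtain k where k: "k < n" "grid a b n k \<le> s" "s \<le> grid a b n (Suc k)"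
        using grid_cell[OF assms(1) n(1) s] .
      define z where "z j = w (grid a b n (Suc j)) - w (grid a b n j)" for j
      have "(\<Sum>j<n. \<rho> n j s *\<^sub>R z j) = (\<Sum>j<k. \<rho> n j s *\<^sub>R z j) + (\<Sum>j\<in>{k..<n}. \<rho> n j s *\<^sub>R z j)"
        using k by (simp add: lessThan_atLeast0 sum.atLeastLessThan_concat)
      also have "(\<Sum>j\<in>{k..<n}. \<rho> n j s *\<^sub>R z j) = \<rho> n k s *\<^sub>R z k + (\<Sum>j\<in>{Suc k..<n}. \<rho> n j s *\<^sub>R z j)"
        using k by (simp add: sum.atLeast_Suc_lessThan)
      also have "(\<Sum>j\<in>{Suc k..<n}. \<rho> n j s *\<^sub>R z j) = 0"
      proof (rule sum.neutral, rule ballI)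
        fix j assume j: "j \<in> {Suc k..<n}"
        then have "s \<le> grid a b n j" using k grid_mono[of a b "Suc k" j n] assms(1) by auto
        then have "\<rho> n j s = 0"
          using grid_strict_mono[OF assms(1) n(1), of j "Suc j"] by (intro low) auto
        then show "\<rho> n j s *\<^sub>R z j = 0" by simp
      qed
      also have "(\<Sum>j<k. \<rho> n j s *\<^sub>R z j) = (\<Sum>j<k. z j)"
      proof (rule sum.cong[OF refl])
        fix j assume "j \<in> {..<k}"
        then have "grid a b n (Suc j) \<le> s" using k grid_mono[of a b "Suc j" k n] assms(1) by auto
        then show "\<rho> n j s *\<^sub>R z j = z j" by (simp add: high n)
      qed
      also have "(\<Sum>j<k. z j) = w (grid a b n k) - w a"
        unfolding z_def by (subst sum_lessThan_telescope) simp
      finally have eq: "(\<Sum>j<n. \<rho> n j s *\<^sub>R z j) - (w s - w a) = (w (grid a b n k) - w s) + \<rho> n k s *\<^sub>R z k"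
        by simp
      have gk: "grid a b n k \<in> {a..b}" "grid a b n (Suc k) \<in> {a..b}"
        using grid_in_interval[of a b n] k n assms(1) by auto
      have "norm (w (grid a b n k) - w s) < \<epsilon> / 2"
        using gk s k mesh grid_Suc_diff[of a b n k] by (intro \<delta>) auto
      moreover have "norm (z k) < \<epsilon> / 2"
        unfolding z_def using gk s k mesh grid_Suc_diff[of a b n k] by (intro \<delta>) auto
      moreover have "norm (\<rho> n k s *\<^sub>R z k) \<le> norm (z k)" using rng[of n k s] by (simp add: mult_left_le_one_le)
      ultimately show "dist (\<Sum>j<n. \<rho> n j s *\<^sub>R (w (grid a b n (Suc j)) - w (grid a b n j))) (w s - w a) < \<epsilon>"
        unfolding dist_norm z_def[symmetric] eq using norm_triangle_ineq[of "w (grid a b n k) - w s" "\<rho> n k s *\<^sub>R z k"]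
        by linarith
    qed
  qed
qed

definition ramp :: "real \<Rightarrow> real \<Rightarrow> real \<Rightarrow> real" where
  "ramp c d s = max 0 (min 1 ((s - c) / (d - c)))"

definition polygon :: "real \<Rightarrow> real \<Rightarrow> nat \<Rightarrow> (nat \<Rightarrow> real ^ 'd) \<Rightarrow> real \<Rightarrow> real ^ 'd" where
  "polygon a b n p s = (\<Sum>j<n. ramp (grid a b n j) (grid a b n (Suc j)) s *\<^sub>R p j)"

definition increments :: "real \<Rightarrow> real \<Rightarrow> nat \<Rightarrow> (real \<Rightarrow> 'b) \<Rightarrow> nat \<Rightarrow> 'b::minus" where
  "increments a b n w j = w (grid a b n (Suc j)) - w (grid a b n j)"

lemma continuous_on_polygon [continuous_intros]: "a < b \<Longrightarrow> n > 0 \<Longrightarrow> continuous_on S (polygon a b n p)"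
  unfolding polygon_def ramp_def
  by (intro continuous_intros) (metis grid_strict_mono lessI less_irrefl right_minus_eq)

lemma polygon_uniform_limit:
  assumes "a < b" "continuous_on {a..b} w"
  shows "uniform_limit {a..b} (\<lambda>n. polygon a b n (increments a b n w)) (\<lambda>s. w s - w a) sequentially"
  unfolding polygon_def increments_def
proof (rule weighted_increments_uniform_limit[OF assms])
  fix n j s
  show "ramp (grid a b n j) (grid a b n (Suc j)) s = 0" if "s < grid a b n (Suc j)" "s \<le> grid a b n j"
  proof -
    have "(s - grid a b n j) / (grid a b n (Suc j) - grid a b n j) \<le> 0"
      using that grid_mono[of a b j "Suc j" n] assms(1) by (intro divide_nonpos_nonneg) auto
    then show ?thesis unfolding ramp_def by linarith
  qed
  show "\<bar>ramp (grid a b n j) (grid a b n (Suc j)) s\<bar> \<le> 1" by (auto simp: ramp_def)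
  show "ramp (grid a b n j) (grid a b n (Suc j)) s = 1" if "n > 0" "grid a b n (Suc j) \<le> s"
    using that grid_strict_mono[OF assms(1), of n j "Suc j"] by (auto simp: ramp_def min_def max_def)
qed

lemma polygon_diff: "norm (polygon a b n p s - polygon a b n q s) \<le> (\<Sum>j<n. norm (p j - q j))"
proof -
  have "norm (polygon a b n p s - polygon a b n q s) =
     norm (\<Sum>j<n. ramp (grid a b n j) (grid a b n (Suc j)) s *\<^sub>R (p j - q j))"
    by (simp add: polygon_def sum_subtractf scaleR_diff_right)
  also have "\<dots> \<le> (\<Sum>j<n. norm (p j - q j))"
    by (intro sum_norm_le) (auto simp: ramp_def intro!: mult_left_le_one_le)
  finally show ?thesis .
qed

section \<open>A mean value inequality for right derivatives\<close>

text \<open>Horizontal derivatives are one-sided, so the usual mean value theorem does not apply. For each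
  $\varepsilon > 0$ the set of points up to which \<open>g\<close> grows at rate at most $c + \varepsilon$ is closed, and its
  supremum cannot be smaller than \<open>b\<close>, since the right derivative there allows going further.\<close>

lemma right_derivative_upper_bound:
  fixes g :: "real \<Rightarrow> real"
  assumes "a \<le> b" "continuous_on {a..b} g"
    and lim: "\<And>s. s \<in> {a..<b} \<Longrightarrow> ((\<lambda>\<delta>. (g (s + \<delta>) - g s) / \<delta>) \<longlongrightarrow> l s) (at_right 0)"
    and le: "\<And>s. s \<in> {a..<b} \<Longrightarrow> l s \<le> c"
  shows "g b - g a \<le> c * (b - a)"
proof -
  have main: "g b - g a \<le> (c + \<epsilon>) * (b - a)" if \<epsilon>: "\<epsilon> > 0" for \<epsilon>
  proof -
    define S where "S = {s \<in> {a..b}. g s - g a - (c + \<epsilon>) * (s - a) \<le> 0}"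
    have "continuous_on {a..b} (\<lambda>s. g s - g a - (c + \<epsilon>) * (s - a))"
      using assms(2) by (intro continuous_intros)
    from continuous_closed_preimage[OF this closed_atLeastAtMost closed_atMost, of 0] have S: "closed S"
      unfolding S_def vimage_def Int_def atMost_iff mem_Collect_eq by blast
    have aS: "a \<in> S" using assms(1) by (simp add: S_def)
    have bdd: "bdd_above S" by (rule bdd_aboveI[of _ b]) (auto simp: S_def)
    define m where "m = Sup S"
    have mS: "m \<in> S" unfolding m_def using closed_contains_Sup S aS bdd by blast
    have "m = b"
    proof (rule ccontr)
      assume "m \<noteq> b"
      then have m: "m \<in> {a..<b}" using mS by (auto simp: S_def)
      have "\<forall>\<^sub>F \<delta> in at_right 0. (g (m + \<delta>) - g m) / \<delta> < c + \<epsilon>"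
        using order_tendstoD(2)[OF lim[OF m], of "c + \<epsilon>"] le[OF m] \<epsilon> by linarith
      moreover have "\<forall>\<^sub>F \<delta> in at_right 0. \<delta> < b - m"
        using order_tendstoD(2)[OF tendsto_ident_at, of 0 "b - m" "{0<..}"] m by simp
      moreover have "\<forall>\<^sub>F \<delta> in at_right (0::real). \<delta> > 0" by (simp add: eventually_at_right_less)
      ultimately have "\<forall>\<^sub>F \<delta> in at_right 0. 0 < \<delta> \<and> m + \<delta> \<in> S"
      proof eventually_elim
        case (elim \<delta>)
        then have "g (m + \<delta>) - g m < (c + \<epsilon>) * \<delta>" by (simp add: pos_divide_less_eq)
        moreover have "g m - g a - (c + \<epsilon>) * (m - a) \<le> 0" using mS by (simp add: S_def)
        moreover have "(c + \<epsilon>) * (m + \<delta> - a) = (c + \<epsilon>) * (m - a) + (c + \<epsilon>) * \<delta>"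
          by (simp add: algebra_simps)
        ultimately show ?case using m elim by (simp add: S_def)
      qed
      then obtain \<delta> where "0 < \<delta>" "m + \<delta> \<in> S" 
        using eventually_happens[of _ "at_right (0::real)"] by (auto simp: trivial_limit_at_right_real)
      then show False using cSup_upper[OF _ bdd, of "m + \<delta>"] by (simp add: m_def)
    qed
    then show ?thesis using mS by (simp add: S_def)
  qed
  show ?thesis
  proof (cases "a = b")
    case False
    then have ab: "b - a > 0" using assms by simp
    show ?thesis
    proof (rule field_le_epsilon)
      fix e :: real assume "e > 0"
      then have "g b - g a \<le> (c + e / (b - a)) * (b - a)" using ab by (intro main) simp
      also have "\<dots> = c * (b - a) + e" using ab by (simp add: distrib_right)
      finally show "g b - g a \<le> c * (b - a) + e" .
    qed
  qed simp
qed

lemma right_derivative_approx: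
  fixes g :: "real \<Rightarrow> real"
  assumes "a \<le> b" "continuous_on {a..b} g"
    and lim: "\<And>s. s \<in> {a..<b} \<Longrightarrow> ((\<lambda>\<delta>. (g (s + \<delta>) - g s) / \<delta>) \<longlongrightarrow> l s) (at_right 0)"
    and le: "\<And>s. s \<in> {a..<b} \<Longrightarrow> \<bar>l s - c\<bar> \<le> \<eta>"
  shows "\<bar>g b - g a - c * (b - a)\<bar> \<le> \<eta> * (b - a)"
proof -
  have "g b - g a \<le> (c + \<eta>) * (b - a)"
  proof (rule right_derivative_upper_bound[OF assms(1,2) lim])
    show "l s \<le> c + \<eta>" if "s \<in> {a..<b}" for s using le[OF that] by linarith
  qed
  moreover have "- g b - (- g a) \<le> (\<eta> - c) * (b - a)"
  proof (rule right_derivative_upper_bound[of a b "\<lambda>s. - g s" "\<lambda>s. - l s"])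
    fix s assume s: "s \<in> {a..<b}"
    have "(\<lambda>\<delta>. (- g (s + \<delta>) - - g s) / \<delta>) = (\<lambda>\<delta>. - ((g (s + \<delta>) - g s) / \<delta>))"
      by (simp add: fun_eq_iff diff_divide_distrib)
    then show "((\<lambda>\<delta>. (- g (s + \<delta>) - - g s) / \<delta>) \<longlongrightarrow> - l s) (at_right 0)"
      using tendsto_minus[OF lim[OF s]] by simp
    show "- l s \<le> \<eta> - c" using le[OF s] by simp
  qed (use assms in \<open>auto intro!: continuous_intros\<close>)
  ultimately show ?thesis by (simp add: algebra_simps abs_le_iff)
qed

section \<open>Bounded convergence, independence and finitely many coordinates\<close>

lemma (in complete_measure) borel_measurable_AE_cong:
  assumes f: "f \<in> borel_measurable M" and eq: "AE x in M. f x = g x"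
  shows "g \<in> borel_measurable M"
proof (rule measurableI)
  obtain N where N: "N \<in> null_sets M" "{x \<in> space M. f x \<noteq> g x} \<subseteq> N"
    using eq by (auto elim: AE_E simp: null_sets_def)
  fix A :: "'b set" assume A: "A \<in> sets borel"
  have "g -` A \<inter> space M \<inter> N \<in> null_sets M" by (rule complete2[OF _ N(1)]) auto
  moreover have "f -` A \<inter> space M \<in> sets M" using f A by (rule measurable_sets)
  ultimately have "(f -` A \<inter> space M - N) \<union> (g -` A \<inter> space M \<inter> N) \<in> sets M" using N by auto
  also have "(f -` A \<inter> space M - N) \<union> (g -` A \<inter> space M \<inter> N) = g -` A \<inter> space M" using N(2) by auto
  finally show "g -` A \<inter> space M \<in> sets M" .
qed simp

locale complete_prob_space = prob_space + complete_measure

text \<open>Completeness gives the measurability of the limit: functionals of the Brownian path are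
  controlled only on the almost sure event that the path is continuous.\<close>

lemma (in complete_prob_space) bounded_convergence_AE:
  fixes u :: "nat \<Rightarrow> 'a \<Rightarrow> real"
  assumes u[measurable]: "\<And>n. u n \<in> borel_measurable M"
    and lim: "AE \<omega> in M. (\<lambda>n. u n \<omega>) \<longlonglongrightarrow> f \<omega>" and bound: "\<And>n. AE \<omega> in M. \<bar>u n \<omega>\<bar> \<le> B"
  shows "f \<in> borel_measurable M" "integrable M f" "(\<lambda>n. expectation (u n)) \<longlonglongrightarrow> expectation f"
proof -
  have "(\<lambda>\<omega>. lim (\<lambda>n. u n \<omega>)) \<in> borel_measurable M" by measurable
  then show f[measurable]: "f \<in> borel_measurable M"
    by (rule borel_measurable_AE_cong) (use lim in \<open>auto elim!: eventually_mono intro: limI\<close>)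
  have B: "AE \<omega> in M. norm (u n \<omega>) \<le> B" for n using bound by simp
  show "integrable M f" "(\<lambda>n. expectation (u n)) \<longlonglongrightarrow> expectation f"
    using integrable_dominated_convergence[OF f u _ lim B] integral_dominated_convergence[OF f u _ lim B] by auto
qed

lemma (in prob_space) indep_var_expectation_eq_iterated:
  fixes F :: "'b \<Rightarrow> 'b \<Rightarrow> real"
  assumes ind: "indep_var S X N Y"
    and F: "(\<lambda>(x, y). F x y) \<in> borel_measurable (S \<Otimes>\<^sub>M N)"
    and bound: "\<And>x y. \<bar>F x y\<bar> \<le> B"
  shows "expectation (\<lambda>\<omega>. F (X \<omega>) (Y \<omega>)) = expectation (\<lambda>\<omega>. expectation (\<lambda>\<omega>'. F (X \<omega>) (Y \<omega>')))"
    and "(\<lambda>\<omega>. expectation (\<lambda>\<omega>'. F (X \<omega>) (Y \<omega>'))) \<in> borel_measurable M"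
proof -
  have rv[measurable]: "X \<in> measurable M S" "Y \<in> measurable M N"
    and eq: "distr M S X \<Otimes>\<^sub>M distr M N Y = distr M (S \<Otimes>\<^sub>M N) (\<lambda>\<omega>. (X \<omega>, Y \<omega>))"
    using ind by (auto simp: indep_var_distribution_eq)
  interpret X: prob_space "distr M S X" by (rule prob_space_distr) simp
  interpret Y: prob_space "distr M N Y" by (rule prob_space_distr) simp
  interpret XY: pair_prob_space "distr M S X" "distr M N Y" ..
  note F[measurable]
  have m: "(\<lambda>(x, y). F x y) \<in> borel_measurable (distr M S X \<Otimes>\<^sub>M distr M N Y)" by simp
  have Fx[measurable]: "F x \<in> borel_measurable N" if "x \<in> space S" for x
    using measurable_Pair2[OF F that] by simp
  have int: "integrable (distr M S X \<Otimes>\<^sub>M distr M N Y) (\<lambda>(x, y). F x y)"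
    by (rule XY.P.integrable_const_bound[of _ B]) (use m bound in auto)
  have inner: "(\<integral>y. F x y \<partial>distr M N Y) = expectation (\<lambda>\<omega>'. F x (Y \<omega>'))" if "x \<in> space S" for x
    using that by (subst integral_distr) auto
  have meas: "(\<lambda>x. \<integral>y. F x y \<partial>distr M N Y) \<in> borel_measurable S"
    using Y.borel_measurable_lebesgue_integral[of "\<lambda>x y. F x y" S] F by simp
  have "expectation (\<lambda>\<omega>. F (X \<omega>) (Y \<omega>)) = (\<integral>z. (case z of (x, y) \<Rightarrow> F x y) \<partial>distr M (S \<Otimes>\<^sub>M N) (\<lambda>\<omega>. (X \<omega>, Y \<omega>)))"
    by (subst integral_distr) auto
  also have "\<dots> = (\<integral>x. \<integral>y. F x y \<partial>distr M N Y \<partial>distr M S X)"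
    unfolding eq[symmetric] using XY.integral_fst'[OF int] by simp
  also have "\<dots> = (\<integral>\<omega>. (\<integral>y. F (X \<omega>) y \<partial>distr M N Y) \<partial>M)"
    using meas by (subst integral_distr) auto
  also have "\<dots> = expectation (\<lambda>\<omega>. expectation (\<lambda>\<omega>'. F (X \<omega>) (Y \<omega>')))"
    by (intro Bochner_Integration.integral_cong refl inner measurable_space[OF rv(1)])
  finally show "expectation (\<lambda>\<omega>. F (X \<omega>) (Y \<omega>)) = expectation (\<lambda>\<omega>. expectation (\<lambda>\<omega>'. F (X \<omega>) (Y \<omega>')))" .
  have "(\<lambda>\<omega>. \<integral>y. F (X \<omega>) y \<partial>distr M N Y) \<in> borel_measurable M"
    using measurable_compose[OF rv(1) meas] .
  then show "(\<lambda>\<omega>. expectation (\<lambda>\<omega>'. F (X \<omega>) (Y \<omega>'))) \<in> borel_measurable M"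
    by (rule measurable_cong[THEN iffD1, rotated]) (use inner measurable_space[OF rv(1)] in auto)
qed

text \<open>Functionals of a path built from finitely many increments are handled as functions of the whole sequence of increments; this
  criterion makes them continuous for the product topology, hence Borel measurable.\<close>

lemma continuous_on_finitely_many_coordinates:
  fixes F :: "(nat \<Rightarrow> 'b::real_normed_vector) \<Rightarrow> 'c::metric_space"
  assumes "\<And>p \<epsilon>. \<epsilon> > 0 \<Longrightarrow> \<exists>\<delta>>0. \<forall>q. (\<Sum>j<n. norm (q j - p j)) < \<delta> \<longrightarrow> dist (F q) (F p) < \<epsilon>"
  shows "continuous_on UNIV F"
proof -
  have "(F \<longlongrightarrow> F p) (at p)" for p
  proof (rule tendstoI)
    fix \<epsilon> :: real assume "0 < \<epsilon>"
    with assms obtain \<delta> where \<delta>: "\<delta> > 0" "\<forall>q. (\<Sum>j<n. norm (q j - p j)) < \<delta> \<longrightarrow> dist (F q) (F p) < \<epsilon>" by blast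
    have "continuous_on UNIV (\<lambda>q::nat \<Rightarrow> 'b. \<Sum>j<n. norm (q j - p j))"
      by (intro continuous_intros continuous_on_product_coordinates)
    then have "((\<lambda>q. \<Sum>j<n. norm (q j - p j)) \<longlongrightarrow> (\<Sum>j<n. norm (p j - p j))) (at p)"
      unfolding continuous_on_def by blast
    then have "\<forall>\<^sub>F q in at p. (\<Sum>j<n. norm (q j - p j)) < \<delta>" using \<delta>(1) by (intro order_tendstoD(2)) auto
    then show "\<forall>\<^sub>F q in at p. dist (F q) (F p) < \<epsilon>" by (rule eventually_mono) (use \<delta> in auto)
  qed
  then show ?thesis by (simp add: continuous_on_def)
qed

section \<open>Gaussian increments\<close>

lemma borel_measurable_vec_nth [measurable (raw)]:
  fixes f :: "'a \<Rightarrow> real ^ 'd"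
  assumes "f \<in> borel_measurable N" shows "(\<lambda>x. f x $ i) \<in> borel_measurable N"
  by (rule borel_measurable_continuous_on[OF _ assms]) (intro continuous_intros)

abbreviation gaussian_density :: "real \<Rightarrow> real ^ 'd \<Rightarrow> real" where
  "gaussian_density \<delta> y \<equiv> (\<Prod>i\<in>UNIV. normal_density 0 (sqrt \<delta>) (y $ i))"

lemma nn_integral_lborel_vec_prod:
  fixes g :: "'d::finite \<Rightarrow> real \<Rightarrow> ennreal"
  assumes "\<And>i. g i \<in> borel_measurable borel"
  shows "(\<integral>\<^sup>+y. (\<Prod>i\<in>UNIV. g i (y $ i)) \<partial>lborel) = (\<Prod>i\<in>UNIV. \<integral>\<^sup>+x. g i x \<partial>lborel)"
proof -
  define e where "e i = (axis i 1 :: real ^ 'd)" for i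
  have inj: "inj e" by (auto simp: e_def inj_def axis_eq_axis)
  have B: "Basis = range e" by (auto simp: e_def Basis_vec_def)
  have "(\<integral>\<^sup>+y. (\<Prod>b\<in>Basis. g (inv e b) (y \<bullet> b)) \<partial>lborel) = (\<Prod>b\<in>Basis. \<integral>\<^sup>+x. g (inv e b) x \<partial>lborel)"
    by (rule nn_integral_lborel_prod) (use assms in auto)
  then show ?thesis unfolding B prod.reindex[OF inj]
    by (simp add: inv_f_f[OF inj]) (simp add: e_def inner_axis)
qed

context prob_space begin

context
  fixes \<delta> :: real and Z :: "'a \<Rightarrow> real ^ 'd"
  assumes \<delta>: "\<delta> > 0"
    and Z: "distributed M lborel Z (\<lambda>y. ennreal (gaussian_density \<delta> y))"
begin

lemma gaussian_measurable: "Z \<in> borel_measurable M"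
  using distributed_measurable[OF Z] by simp

lemma gaussian_coordinate_moment:
  "has_bochner_integral M (\<lambda>\<omega>. (Z \<omega> $ i) ^ (2 * k)) (fact (2 * k) / ((2 / \<delta>) ^ k * fact k))" (is "has_bochner_integral M _ ?c")
proof (rule has_bochner_integral_nn_integral)
  note [measurable] = gaussian_measurable
  have s: "sqrt \<delta> > 0" using \<delta> by simp
  note nd = normal_moment_even[OF s, of 0]
  have sq: "(sqrt \<delta>)\<^sup>2 = \<delta>" using \<delta> by simp
  have mom: "(\<integral>\<^sup>+x. ennreal (normal_density 0 (sqrt \<delta>) x * x ^ (2 * m)) \<partial>lborel) = ennreal (fact (2 * m) / ((2 / \<delta>) ^ m * fact m))" for m
    using nd[of m] \<delta> unfolding sq by (intro has_bochner_integral_iff[THEN iffD1, THEN conjunct1, THEN nn_integral_eq_integral, THEN trans])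
       (auto simp: has_bochner_integral_iff)
  have "(\<integral>\<^sup>+\<omega>. ennreal ((Z \<omega> $ i) ^ (2 * k)) \<partial>M) = (\<integral>\<^sup>+y. ennreal (gaussian_density \<delta> y) * ennreal ((y $ i) ^ (2 * k)) \<partial>lborel)"
    using distributed_nn_integral[OF Z, of "\<lambda>y. ennreal ((y $ i) ^ (2 * k))"] by simp
  also have "\<dots> = (\<integral>\<^sup>+y. (\<Prod>j\<in>UNIV. ennreal (normal_density 0 (sqrt \<delta>) (y $ j) * (if j = i then (y $ j) ^ (2 * k) else 1))) \<partial>lborel)"
  proof (rule nn_integral_cong)
    fix y :: "real ^ 'd"
    have "(\<Prod>j\<in>UNIV. if j = i then (y $ j) ^ (2 * k) else 1) = (y $ i) ^ (2 * k)" by simp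
    then show "ennreal (gaussian_density \<delta> y) * ennreal ((y $ i) ^ (2 * k)) =
      (\<Prod>j\<in>UNIV. ennreal (normal_density 0 (sqrt \<delta>) (y $ j) * (if j = i then (y $ j) ^ (2 * k) else 1)))"
      by (subst prod_ennreal) (auto simp: prod.distrib ennreal_mult' prod_nonneg)
  qed
  also have "\<dots> = (\<Prod>j\<in>UNIV. \<integral>\<^sup>+x. ennreal (normal_density 0 (sqrt \<delta>) x * (if j = i then x ^ (2 * k) else 1)) \<partial>lborel)"
    by (rule nn_integral_lborel_vec_prod[of "\<lambda>j x. ennreal (normal_density 0 (sqrt \<delta>) x * (if j = i then x ^ (2 * k) else 1))"]) auto
  also have "\<dots> = (\<Prod>j\<in>UNIV. if j = i then ennreal ?c else 1)"
    using mom[of k] mom[of 0] by (intro prod.cong) auto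
  also have "\<dots> = ennreal ?c" by simp
  finally show "(\<integral>\<^sup>+\<omega>. ennreal ((Z \<omega> $ i) ^ (2 * k)) \<partial>M) = ennreal ?c" .
  show "(\<lambda>\<omega>. (Z \<omega> $ i) ^ (2 * k)) \<in> borel_measurable M" by measurable
qed (use \<delta> in auto)

lemma gaussian_coordinate_variance:
  "integrable M (\<lambda>\<omega>. (Z \<omega> $ i)\<^sup>2)" "expectation (\<lambda>\<omega>. (Z \<omega> $ i)\<^sup>2) = \<delta>"
  using gaussian_coordinate_moment[of i 1] \<delta> by (auto simp: has_bochner_integral_iff)

text \<open>Fourth moments are used because of the power $\delta^2$: the probability that an increment is not
  small is then negligible after division by the time step, which second moments would not give.\<close>

lemma gaussian_fourth_moment:
  "integrable M (\<lambda>\<omega>. norm (Z \<omega>) ^ 4)" "expectation (\<lambda>\<omega>. norm (Z \<omega>) ^ 4) \<le> 3 * (real CARD('d))\<^sup>2 * \<delta>\<^sup>2"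
proof -
  note [measurable] = gaussian_measurable
  have m4: "integrable M (\<lambda>\<omega>. (Z \<omega> $ i) ^ 4)" "expectation (\<lambda>\<omega>. (Z \<omega> $ i) ^ 4) = 3 * \<delta>\<^sup>2" for i
    using gaussian_coordinate_moment[of i 2] \<delta> by (auto simp: has_bochner_integral_iff field_simps fact_numeral)
  have le: "norm z ^ 4 \<le> real CARD('d) * (\<Sum>i\<in>UNIV. (z $ i) ^ 4)" for z :: "real ^ 'd"
  proof -
    have "norm z ^ 4 = ((norm z)\<^sup>2)\<^sup>2" by simp
    also have "(norm z)\<^sup>2 = (\<Sum>i\<in>UNIV. (z $ i)\<^sup>2)"
      by (simp add: norm_vec_def L2_set_def sum_nonneg)
    also have "(\<dots>)\<^sup>2 \<le> (\<Sum>i\<in>UNIV. ((z $ i)\<^sup>2)\<^sup>2) * real CARD('d)" by (rule sum_squared_le_sum_of_squares)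
    finally show ?thesis by (simp add: mult.commute)
  qed
  have int: "integrable M (\<lambda>\<omega>. real CARD('d) * (\<Sum>i\<in>UNIV. (Z \<omega> $ i) ^ 4))" using m4 by auto
  show i: "integrable M (\<lambda>\<omega>. norm (Z \<omega>) ^ 4)"
    
  proof (rule Bochner_Integration.integrable_bound[OF int])
    have "0 \<le> real CARD('d) * (\<Sum>i\<in>UNIV. (Z \<omega> $ i) ^ 4)" for \<omega> by (simp add: sum_nonneg)
    then show "AE \<omega> in M. norm (norm (Z \<omega>) ^ 4) \<le> norm (real CARD('d) * (\<Sum>i\<in>UNIV. (Z \<omega> $ i) ^ 4))"
      using le by (intro AE_I2) simp
    show "(\<lambda>\<omega>. norm (Z \<omega>) ^ 4) \<in> borel_measurable M" by measurable
  qed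
  have "expectation (\<lambda>\<omega>. norm (Z \<omega>) ^ 4) \<le> expectation (\<lambda>\<omega>. real CARD('d) * (\<Sum>i\<in>UNIV. (Z \<omega> $ i) ^ 4))"
    by (rule integral_mono[OF i int le])
  also have "\<dots> = 3 * (real CARD('d))\<^sup>2 * \<delta>\<^sup>2" using m4 by (simp add: power2_eq_square)
  finally show "expectation (\<lambda>\<omega>. norm (Z \<omega>) ^ 4) \<le> 3 * (real CARD('d))\<^sup>2 * \<delta>\<^sup>2" .
qed

lemma gaussian_tail:
  assumes r: "r > 0"
  shows "prob {\<omega> \<in> space M. norm (Z \<omega>) > r} \<le> 3 * (real CARD('d))\<^sup>2 * \<delta>\<^sup>2 / r ^ 4"
proof -
  note [measurable] = gaussian_measurable
  have m: "{\<omega> \<in> space M. norm (Z \<omega>) > r} \<in> events" by measurable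
  have "prob {\<omega> \<in> space M. norm (Z \<omega>) > r} = expectation (indicator {\<omega> \<in> space M. norm (Z \<omega>) > r})" using m by simp
  also have "\<dots> \<le> expectation (\<lambda>\<omega>. norm (Z \<omega>) ^ 4 / r ^ 4)"
  proof (rule integral_mono)
    show "integrable M (indicator {\<omega> \<in> space M. norm (Z \<omega>) > r} :: _ \<Rightarrow> real)"
      using m by (simp add: emeasure_eq_measure)
    show "indicator {\<omega> \<in> space M. norm (Z \<omega>) > r} \<omega> \<le> norm (Z \<omega>) ^ 4 / r ^ 4" for \<omega>
      using r power_mono[of r "norm (Z \<omega>)" 4] by (auto simp: indicator_def)
  qed (use gaussian_fourth_moment in auto)
  also have "\<dots> \<le> 3 * (real CARD('d))\<^sup>2 * \<delta>\<^sup>2 / r ^ 4"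
    using gaussian_fourth_moment(2) r by (simp add: divide_right_mono)
  finally show ?thesis .
qed

lemma gaussian_truncated_variance:
  assumes r: "r > 0"
  shows "integrable M (\<lambda>\<omega>. if norm (Z \<omega>) \<le> r then (Z \<omega> $ i)\<^sup>2 else 0)"
    and "expectation (\<lambda>\<omega>. if norm (Z \<omega>) \<le> r then (Z \<omega> $ i)\<^sup>2 else 0) \<le> \<delta>"
    and "\<bar>expectation (\<lambda>\<omega>. if norm (Z \<omega>) \<le> r then (Z \<omega> $ i)\<^sup>2 else 0) - \<delta>\<bar> \<le> 3 * (real CARD('d))\<^sup>2 * \<delta>\<^sup>2 / r\<^sup>2"
proof -
  note [measurable] = gaussian_measurable
  let ?t = "\<lambda>\<omega>. if norm (Z \<omega>) \<le> r then (Z \<omega> $ i)\<^sup>2 else 0"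
  show int: "integrable M ?t"
    by (rule Bochner_Integration.integrable_bound[OF gaussian_coordinate_variance(1)[of i]]) auto
  show le: "expectation ?t \<le> \<delta>"
    unfolding gaussian_coordinate_variance(2)[of i, symmetric]
    by (rule integral_mono[OF int gaussian_coordinate_variance(1)]) auto
  have "(z $ i)\<^sup>2 - (if norm z \<le> r then (z $ i)\<^sup>2 else 0) \<le> norm z ^ 4 / r\<^sup>2" for z :: "real ^ 'd"
  proof (cases "norm z \<le> r")
    case False
    have "(z $ i)\<^sup>2 \<le> (norm z)\<^sup>2" using component_le_norm_cart[of z i] by (simp add: abs_le_square_iff[symmetric])
    moreover have "r\<^sup>2 \<le> (norm z)\<^sup>2" using False r by (intro power_mono) auto
    ultimately have "(z $ i)\<^sup>2 * r\<^sup>2 \<le> (norm z)\<^sup>2 * (norm z)\<^sup>2" by (intro mult_mono) auto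
    then show ?thesis using False r by (simp add: field_simps power2_eq_square power4_eq_xxxx)
  qed simp
  then have "expectation (\<lambda>\<omega>. (Z \<omega> $ i)\<^sup>2 - ?t \<omega>) \<le> expectation (\<lambda>\<omega>. norm (Z \<omega>) ^ 4 / r\<^sup>2)"
    using int gaussian_coordinate_variance(1) gaussian_fourth_moment(1) by (intro integral_mono) auto
  also have "\<dots> \<le> 3 * (real CARD('d))\<^sup>2 * \<delta>\<^sup>2 / r\<^sup>2"
    using gaussian_fourth_moment(2) r by (simp add: divide_right_mono)
  also have "expectation (\<lambda>\<omega>. (Z \<omega> $ i)\<^sup>2 - ?t \<omega>) = \<delta> - expectation ?t"
    using int gaussian_coordinate_variance by simp
  finally show "\<bar>expectation ?t - \<delta>\<bar> \<le> 3 * (real CARD('d))\<^sup>2 * \<delta>\<^sup>2 / r\<^sup>2" using le by simp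
qed

end
end

definition flip :: "'d \<Rightarrow> real ^ 'd \<Rightarrow> real ^ 'd" where
  "flip i y = (\<chi> j. if j = i then - (y $ j) else y $ j)"

lemma lborel_distr_flip: "distr lborel borel (flip i :: real ^ 'd \<Rightarrow> _) = lborel"
proof -
  define c where "c j = (if j = axis i 1 then -1 else 1 :: real)" for j :: "real ^ 'd"
  have "flip i y = 0 + (\<Sum>j\<in>Basis. (c j * (y \<bullet> j)) *\<^sub>R j)" for y :: "real ^ 'd"
  proof (rule euclidean_eqI)
    fix b :: "real ^ 'd" assume b: "b \<in> Basis"
    then obtain k where k: "b = axis k 1" by (auto simp: Basis_vec_def)
    show "flip i y \<bullet> b = (0 + (\<Sum>j\<in>Basis. (c j * (y \<bullet> j)) *\<^sub>R j)) \<bullet> b"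
      using b by (simp add: inner_sum_left_Basis) (simp add: k c_def flip_def inner_axis axis_eq_axis)
  qed
  then have eq: "flip i = (\<lambda>y. 0 + (\<Sum>j\<in>Basis. (c j * (y \<bullet> j)) *\<^sub>R j))" by auto
  have "lborel = density (distr lborel borel (flip i)) (\<lambda>_. ennreal (\<Prod>j\<in>Basis. \<bar>c j\<bar>))"
    unfolding eq by (rule lborel_affine_euclidean) (auto simp: c_def)
  also have "(\<Prod>j\<in>Basis. \<bar>c j\<bar>) = 1" by (intro prod.neutral) (auto simp: c_def)
  also have "density (distr lborel borel (flip i)) (\<lambda>_. ennreal 1) = distr lborel borel (flip i)"
    by (simp add: density_1)
  finally show ?thesis by simp
qed

lemma flip_measurable [measurable]: "flip i \<in> borel_measurable borel"
proof -
  have "continuous_on UNIV (\<lambda>y::real ^ 'a. if j = i then - (y $ j) else y $ j)" for j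
    by (cases "j = i") (auto intro!: continuous_intros)
  then have "continuous_on UNIV (flip i)" unfolding flip_def by (rule continuous_on_vec_lambda)
  then show ?thesis by (rule borel_measurable_continuous_onI)
qed

text \<open>The Gaussian density is even in each coordinate and Lebesgue measure is invariant under the
  reflection, so the expectation equals its own negative.\<close>

lemma (in prob_space) gaussian_expectation_odd:
  fixes Z :: "'a \<Rightarrow> real ^ 'd" and g :: "real ^ 'd \<Rightarrow> real"
  assumes Z: "distributed M lborel Z (\<lambda>y. ennreal (gaussian_density \<delta> y))"
    and [measurable]: "g \<in> borel_measurable borel" and odd: "\<And>y. g (flip i y) = - g y"
  shows "expectation (\<lambda>\<omega>. g (Z \<omega>)) = 0"
proof -
  have even: "gaussian_density \<delta> (flip i y) = gaussian_density \<delta> y" for y :: "real ^ 'd"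
    by (intro prod.cong) (auto simp: flip_def normal_density_def)
  have "(\<integral>y. gaussian_density \<delta> y * g y \<partial>lborel) = (\<integral>y. gaussian_density \<delta> y * g y \<partial>distr lborel borel (flip i))"
    by (simp add: lborel_distr_flip)
  also have "\<dots> = (\<integral>y. gaussian_density \<delta> (flip i y) * g (flip i y) \<partial>lborel)"
    by (rule integral_distr) auto
  also have "\<dots> = - (\<integral>y. gaussian_density \<delta> y * g y \<partial>lborel)" by (simp add: even odd)
  finally have "(\<integral>y. gaussian_density \<delta> y * g y \<partial>lborel) = 0" by simp
  then show ?thesis using distributed_integral[OF Z, of g] by (simp add: prod_nonneg)
qed


lemma second_order_taylor_approx:
  fixes g :: "real \<Rightarrow> real"
  assumes "\<And>s. (g has_real_derivative g1 s) (at s)" "\<And>s. (g1 has_real_derivative g2 s) (at s)"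
    and near: "\<And>s. \<bar>s\<bar> \<le> \<bar>x\<bar> \<Longrightarrow> \<bar>g2 s - a\<bar> \<le> \<eta>"
  shows "\<bar>g x - g 0 - g1 0 * x - a / 2 * x\<^sup>2\<bar> \<le> \<eta> / 2 * x\<^sup>2"
proof (cases "x = 0")
  case False
  define D where "D m = (if m = 0 then g else if m = 1 then g1 else g2)" for m :: nat
  have "\<exists>t. (if x < 0 then x < t \<and> t < 0 else 0 < t \<and> t < x) \<and>
      g x = (\<Sum>m<2. D m 0 / fact m * (x - 0) ^ m) + D 2 t / fact 2 * (x - 0) ^ 2"
  proof (rule Taylor[of 2 D g "- \<bar>x\<bar>" "\<bar>x\<bar>" 0 x])
    show "\<forall>m t. m < 2 \<and> - \<bar>x\<bar> \<le> t \<and> t \<le> \<bar>x\<bar> \<longrightarrow> DERIV (D m) t :> D (Suc m) t"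
      using assms(1,2) by (auto simp: D_def less_2_cases_iff)
  qed (use False in \<open>auto simp: D_def\<close>)
  then obtain t where "if x < 0 then x < t \<and> t < 0 else 0 < t \<and> t < x"
      and D: "g x = (\<Sum>m<2. D m 0 / fact m * (x - 0) ^ m) + D 2 t / fact 2 * (x - 0) ^ 2" by blast
  then have t: "\<bar>t\<bar> \<le> \<bar>x\<bar>" by (auto split: if_splits)
  have gx: "g x = g 0 + g1 0 * x + g2 t / 2 * x\<^sup>2" using D by (simp add: D_def numeral_2_eq_2)
  have "g x - g 0 - g1 0 * x - a / 2 * x\<^sup>2 = (g2 t - a) / 2 * x\<^sup>2" using gx by (simp add: algebra_simps diff_divide_distrib)
  moreover have "\<bar>g2 t - a\<bar> / 2 * x\<^sup>2 \<le> \<eta> / 2 * x\<^sup>2" using near[OF t] by (intro mult_right_mono) auto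
  ultimately show ?thesis by (simp only: abs_mult abs_divide) simp
qed simp

text \<open>The vector \<open>Z\<close> is reached from 0 by switching on its coordinates one after the other, \<open>J I y\<close> being
  the vector \<open>y\<close> with only the coordinates in \<open>I\<close> switched on. Switching on the coordinate \<open>i\<close> is a
  one-dimensional Taylor expansion. Its first-order term is odd in that coordinate, because the partial
  derivative is evaluated at a point where this coordinate is still zero, so its
  expectation vanishes. The quadratic terms are left, and they contain pure second derivatives only, which
  is what the trace asks for.\<close>

lemma (in prob_space) gaussian_local_expansion:
  fixes Z :: "'a \<Rightarrow> real ^ 'd" and f :: "real ^ 'd \<Rightarrow> real"
  assumes \<delta>: "\<delta> > 0" and Z: "distributed M lborel Z (\<lambda>y. ennreal (gaussian_density \<delta> y))" and r: "r > 0"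
    and f: "continuous_on UNIV f" and f1: "\<And>i. continuous_on UNIV (f1 i)"
    and d1: "\<And>i y. ((\<lambda>h. (f (y + h *\<^sub>R axis i 1) - f y) / h) \<longlongrightarrow> f1 i y) (at 0)"
    and d2: "\<And>i y. ((\<lambda>h. (f1 i (y + h *\<^sub>R axis i 1) - f1 i y) / h) \<longlongrightarrow> f2 i y) (at 0)"
    and near: "\<And>i y. norm y \<le> r \<Longrightarrow> \<bar>f2 i y - a i\<bar> \<le> \<eta>"
  shows "integrable M (\<lambda>\<omega>. if norm (Z \<omega>) \<le> r then f (Z \<omega>) - f 0 else 0)"
    and "\<bar>expectation (\<lambda>\<omega>. if norm (Z \<omega>) \<le> r then f (Z \<omega>) - f 0 else 0) - \<delta> / 2 * (\<Sum>i\<in>UNIV. a i)\<bar>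
      \<le> \<eta> * real CARD('d) * \<delta> / 2 + 3 * (real CARD('d))\<^sup>2 * \<delta>\<^sup>2 / r\<^sup>2 * (\<Sum>i\<in>UNIV. \<bar>a i\<bar>) / 2"
proof -
  note [measurable] = gaussian_measurable[OF \<delta> Z]
  define J where "J I y = (\<chi> j. if j \<in> I then y $ j else 0)" for I and y :: "real ^ 'd"
  have J_cont: "continuous_on UNIV (J I)" for I
    unfolding J_def
  proof (rule continuous_on_vec_lambda)
    show "continuous_on UNIV (\<lambda>y::real ^ 'd. if j \<in> I then y $ j else 0)" for j
      by (cases "j \<in> I") (auto intro!: continuous_intros)
  qed
  have J_norm: "norm (J I y) \<le> norm y" for I y
    by (rule norm_le_componentwise_cart) (simp add: J_def)
  have "\<exists>b. \<forall>y\<in>cball 0 r. \<bar>g y\<bar> \<le> b" if "continuous_on UNIV g" for g :: "real ^ 'd \<Rightarrow> real"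
    using compact_imp_bounded[OF compact_continuous_image[OF continuous_on_subset[OF that] compact_cball], of 0 r]
    by (auto simp: bounded_iff)
  then have bnd: "\<exists>b. \<forall>y. norm y \<le> r \<longrightarrow> \<bar>g y\<bar> \<le> b" if "continuous_on UNIV g" for g :: "real ^ 'd \<Rightarrow> real"
    using that by (metis mem_cball_0)
  define tr where "tr g \<omega> = (if norm (Z \<omega>) \<le> r then g (Z \<omega>) else 0)" for g :: "real ^ 'd \<Rightarrow> real" and \<omega>
  have tr_meas: "tr g \<in> borel_measurable M" if "continuous_on UNIV g" for g
  proof -
    have [measurable]: "g \<in> borel_measurable borel" using that by (rule borel_measurable_continuous_onI)
    show ?thesis unfolding tr_def by measurable
  qed
  have tr_int: "integrable M (tr g)" if cont: "continuous_on UNIV g" for g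
  proof -
    obtain b where b: "\<And>y. norm y \<le> r \<Longrightarrow> \<bar>g y\<bar> \<le> b" using bnd[OF cont] by blast
    have "\<bar>tr g \<omega>\<bar> \<le> \<bar>b\<bar>" for \<omega> using b[of "Z \<omega>"] by (auto simp: tr_def)
    then show ?thesis by (intro integrable_const_bound[of _ "\<bar>b\<bar>"] tr_meas that) auto
  qed
  have fJ: "continuous_on UNIV (\<lambda>y. f (J I y) - f 0)" for I
    by (intro continuous_intros continuous_on_compose2[OF f J_cont]) auto
  have f1J: "continuous_on UNIV (\<lambda>y. f1 i (J I y) * y $ i)" for I i
    by (intro continuous_intros continuous_on_compose2[OF f1 J_cont]) auto
  have sq: "continuous_on UNIV (\<lambda>y::real ^ 'd. (y $ i)\<^sup>2)" for i by (intro continuous_intros)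
  have der: "((\<lambda>s. f (y + s *\<^sub>R axis i 1)) has_real_derivative f1 i (y + s *\<^sub>R axis i 1)) (at s)"
    "((\<lambda>s. f1 i (y + s *\<^sub>R axis i 1)) has_real_derivative f2 i (y + s *\<^sub>R axis i 1)) (at s)" for y i s
    using d1[of "y + s *\<^sub>R axis i 1" i] d2[of i "y + s *\<^sub>R axis i 1"]
    by (simp_all add: DERIV_def scaleR_add_left add.assoc)
  define q where "q i = expectation (tr (\<lambda>y. (y $ i)\<^sup>2))" for i
  have main: "\<bar>expectation (tr (\<lambda>y. f (J I y) - f 0)) - (\<Sum>i\<in>I. a i / 2 * q i)\<bar> \<le> (\<Sum>i\<in>I. \<eta> / 2 * q i)" if "finite I" for I
    using that
  proof induction
    case empty
    have "J {} y = 0" for y by (simp add: J_def vec_eq_iff)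
    then show ?case by (simp add: tr_def)
  next
    case (insert i I)
    have Jins: "J (insert i I) y = J I y + (y $ i) *\<^sub>R axis i 1" for y
      using insert(2) by (auto simp: J_def vec_eq_iff axis_def)
    have point: "\<bar>f (J (insert i I) y) - f (J I y) - f1 i (J I y) * y $ i - a i / 2 * (y $ i)\<^sup>2\<bar> \<le> \<eta> / 2 * (y $ i)\<^sup>2"
      if y: "norm y \<le> r" for y
    proof -
      have "\<bar>f2 i (J I y + s *\<^sub>R axis i 1) - a i\<bar> \<le> \<eta>" if s: "\<bar>s\<bar> \<le> \<bar>y $ i\<bar>" for s
      proof (rule near)
        have "norm (J I y + s *\<^sub>R axis i 1) \<le> norm y"
          by (rule norm_le_componentwise_cart) (use s insert(2) in \<open>auto simp: J_def axis_def\<close>)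
        then show "norm (J I y + s *\<^sub>R axis i 1) \<le> r" using y by simp
      qed
      from second_order_taylor_approx[OF der this] show ?thesis by (simp add: Jins)
    qed
    have zero: "expectation (tr (\<lambda>y. f1 i (J I y) * y $ i)) = 0"
    proof -
      define g where "g y = (if norm y \<le> r then f1 i (J I y) * y $ i else 0)" for y
      have [measurable]: "(\<lambda>y. f1 i (J I y) * y $ i) \<in> borel_measurable borel"
        by (rule borel_measurable_continuous_onI[OF f1J])
      have "g \<in> borel_measurable borel" unfolding g_def by measurable
      moreover have "g (flip i y) = - g y" for y
      proof -
        have "J I (flip i y) = J I y" using insert(2) by (auto simp: J_def flip_def vec_eq_iff)
        moreover have "norm (flip i y) = norm y"
          by (intro antisym norm_le_componentwise_cart) (auto simp: flip_def)
        ultimately show ?thesis by (simp add: g_def flip_def)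
      qed
      ultimately have "expectation (\<lambda>\<omega>. g (Z \<omega>)) = 0" by (rule gaussian_expectation_odd[OF Z])
      then show ?thesis by (simp add: g_def tr_def[abs_def])
    qed
    let ?L = "\<lambda>\<omega>. tr (\<lambda>y. f (J (insert i I) y) - f 0) \<omega> - tr (\<lambda>y. f (J I y) - f 0) \<omega>
        - tr (\<lambda>y. f1 i (J I y) * y $ i) \<omega> - a i / 2 * tr (\<lambda>y. (y $ i)\<^sup>2) \<omega>"
    note ints = tr_int[OF fJ[of "insert i I"]] tr_int[OF fJ[of I]] tr_int[OF f1J[of i I]] tr_int[OF sq[of i]]
    have L: "expectation ?L = expectation (tr (\<lambda>y. f (J (insert i I) y) - f 0)) - expectation (tr (\<lambda>y. f (J I y) - f 0)) - a i / 2 * q i"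
      using ints zero by (simp add: q_def)
    have "\<bar>expectation ?L\<bar> \<le> expectation (\<lambda>\<omega>. \<bar>?L \<omega>\<bar>)" by (rule integral_abs_bound)
    also have "\<dots> \<le> expectation (\<lambda>\<omega>. \<eta> / 2 * tr (\<lambda>y. (y $ i)\<^sup>2) \<omega>)"
    proof (rule integral_mono)
      show "\<bar>?L \<omega>\<bar> \<le> \<eta> / 2 * tr (\<lambda>y. (y $ i)\<^sup>2) \<omega>" for \<omega>
        using point[of "Z \<omega>"] by (simp add: tr_def)
    qed (use ints in \<open>auto intro!: integrable_abs Bochner_Integration.integrable_diff integrable_mult_right\<close>)
    also have "\<dots> = \<eta> / 2 * q i" using ints by (simp add: q_def)
    finally show ?case using insert.IH unfolding L sum.insert[OF insert.hyps] by linarith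
  qed
  have JU: "J UNIV y = y" for y by (simp add: J_def vec_eq_iff)
  have tr_eq: "tr (\<lambda>y. f (J UNIV y) - f 0) = (\<lambda>\<omega>. if norm (Z \<omega>) \<le> r then f (Z \<omega>) - f 0 else 0)"
    by (simp add: tr_def fun_eq_iff JU)
  show "integrable M (\<lambda>\<omega>. if norm (Z \<omega>) \<le> r then f (Z \<omega>) - f 0 else 0)"
    using tr_int[OF fJ[of UNIV]] by (simp add: tr_eq)
  let ?m = "3 * (real CARD('d))\<^sup>2 * \<delta>\<^sup>2 / r\<^sup>2"
  have q: "q i \<le> \<delta>" "\<bar>q i - \<delta>\<bar> \<le> ?m" for i
    using gaussian_truncated_variance(2,3)[OF \<delta> Z r, of i] by (simp_all add: q_def tr_def[abs_def])
  have \<eta>: "\<eta> \<ge> 0" 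
  proof -
    have "\<bar>f2 undefined 0 - a undefined\<bar> \<le> \<eta>" using near[of 0 undefined] r by simp
    then show ?thesis by linarith
  qed
  have "(\<Sum>i\<in>UNIV. \<eta> / 2 * q i) \<le> (\<Sum>i\<in>(UNIV::'d set). \<eta> / 2 * \<delta>)"
    using q(1) \<eta> by (intro sum_mono mult_left_mono) auto
  also have "\<dots> = \<eta> * real CARD('d) * \<delta> / 2" by simp
  finally have 1: "(\<Sum>i\<in>UNIV. \<eta> / 2 * q i) \<le> \<eta> * real CARD('d) * \<delta> / 2" .
  have "(\<Sum>i\<in>UNIV. a i / 2 * q i) - \<delta> / 2 * (\<Sum>i\<in>UNIV. a i) = (\<Sum>i\<in>UNIV. a i / 2 * (q i - \<delta>))"
  proof -
    have "a i / 2 * (q i - \<delta>) = a i / 2 * q i - \<delta> / 2 * a i" for i by (simp add: right_diff_distrib)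
    then show ?thesis by (simp only: sum_subtractf sum_distrib_left)
  qed
  also have "\<bar>\<dots>\<bar> \<le> (\<Sum>i\<in>UNIV. \<bar>a i\<bar> / 2 * ?m)"
  proof (rule order_trans[OF sum_abs sum_mono])
    show "\<bar>a i / 2 * (q i - \<delta>)\<bar> \<le> \<bar>a i\<bar> / 2 * ?m" for i
      unfolding abs_mult abs_divide using q(2)[of i] by (intro mult_mono) auto
  qed
  also have "\<dots> = ?m * (\<Sum>i\<in>UNIV. \<bar>a i\<bar>) / 2"
    unfolding sum_distrib_right[symmetric] sum_divide_distrib[symmetric] by (simp add: ac_simps)
  finally have 2: "\<bar>(\<Sum>i\<in>UNIV. a i / 2 * q i) - \<delta> / 2 * (\<Sum>i\<in>UNIV. a i)\<bar> \<le> ?m * (\<Sum>i\<in>UNIV. \<bar>a i\<bar>) / 2" .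
  show "\<bar>expectation (\<lambda>\<omega>. if norm (Z \<omega>) \<le> r then f (Z \<omega>) - f 0 else 0) - \<delta> / 2 * (\<Sum>i\<in>UNIV. a i)\<bar>
      \<le> \<eta> * real CARD('d) * \<delta> / 2 + ?m * (\<Sum>i\<in>UNIV. \<bar>a i\<bar>) / 2"
    using main[OF finite_class.finite_UNIV] 1 2 unfolding tr_eq by linarith
qed

section \<open>Brownian motion: independence of past and future, maximal inequality\<close>

locale brownian = complete_prob_space M for M :: "'a measure" +
  fixes T :: real and W :: "real \<Rightarrow> 'a \<Rightarrow> real ^ 'd"
  assumes T_pos: "0 < T" and BM: "brownian_motion_on T M W"
begin

abbreviation path :: "'a \<Rightarrow> real \<Rightarrow> real ^ 'd" where
  "path \<omega> \<equiv> (\<lambda>s. W s \<omega>)"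

lemma W_measurable: "s \<in> {0..T} \<Longrightarrow> W s \<in> borel_measurable M"
  using BM by (auto simp: brownian_motion_on_def)

lemma AE_continuous: "AE \<omega> in M. continuous_on {0..T} (path \<omega>)"
  using BM by (auto simp: brownian_motion_on_def)

lemma increment_gaussian:
  "0 \<le> s \<Longrightarrow> s < t \<Longrightarrow> t \<le> T \<Longrightarrow> distributed M lborel (\<lambda>\<omega>. W t \<omega> - W s \<omega>) (\<lambda>y. ennreal (gaussian_density (t - s) y))"
  using BM by (auto simp: brownian_motion_on_def)

text \<open>Independence of past and future in integrated form: the first \<open>k\<close> increments may be taken from \<open>\<omega>\<close>
  and the others from an independent copy \<open>\<omega>'\<close>.\<close>

lemma increments_iterated_expectation:
  fixes \<tau> :: "nat \<Rightarrow> real" and H :: "(nat \<Rightarrow> real ^ 'd) \<Rightarrow> real"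
  defines "Z \<omega> j \<equiv> W (\<tau> (Suc j)) \<omega> - W (\<tau> j) \<omega>"
  assumes \<tau>: "\<And>j. j \<le> n \<Longrightarrow> \<tau> j \<in> {0..T}" "\<And>j. j < n \<Longrightarrow> \<tau> j < \<tau> (Suc j)"
    and H: "H \<in> borel_measurable borel" and bound: "\<And>p. \<bar>H p\<bar> \<le> B"
    and dep: "\<And>p q. (\<And>j. j < n \<Longrightarrow> p j = q j) \<Longrightarrow> H p = H q" and k: "k \<le> n"
  shows "expectation (\<lambda>\<omega>. H (Z \<omega>)) = expectation (\<lambda>\<omega>. expectation (\<lambda>\<omega>'. H (\<lambda>j. if j < k then Z \<omega> j else Z \<omega>' j)))"
    and "(\<lambda>\<omega>. H (Z \<omega>)) \<in> borel_measurable M"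
    and "(\<lambda>\<omega>. expectation (\<lambda>\<omega>'. H (\<lambda>j. if j < k then Z \<omega> j else Z \<omega>' j))) \<in> borel_measurable M"
    and "\<And>\<omega>. (\<lambda>\<omega>'. H (\<lambda>j. if j < k then Z \<omega> j else Z \<omega>' j)) \<in> borel_measurable M"
proof -
  have ind: "indep_vars (\<lambda>_. borel) (\<lambda>j \<omega>. Z \<omega> j) {..<n}"
    using BM \<tau> unfolding brownian_motion_on_def Z_def by blast
  define F where "F x y = H (\<lambda>j. if j < k then x j else if j < n then y j else 0)" for x y
  let ?X = "\<lambda>\<omega>. restrict (Z \<omega>) {..<k}" and ?Y = "\<lambda>\<omega>. restrict (Z \<omega>) {k..<n}"
  let ?PX = "\<Pi>\<^sub>M j\<in>{..<k}. (borel :: (real ^ 'd) measure)" and ?PY = "\<Pi>\<^sub>M j\<in>{k..<n}. (borel :: (real ^ 'd) measure)"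
  have iv: "indep_var ?PX ?X ?PY ?Y"
    by (rule indep_var_restrict[OF ind]) (use k in auto)
  have "(\<lambda>z j. if j < k then fst z j else if j < n then snd z j else 0) \<in> borel_measurable (?PX \<Otimes>\<^sub>M ?PY)"
  proof (rule measurable_coordinatewise_then_product)
    fix j
    consider "j < k" | "\<not> j < k" "j < n" | "\<not> j < n" "\<not> j < k" using k by linarith
    then show "(\<lambda>z. if j < k then fst z j else if j < n then snd z j else 0) \<in> borel_measurable (?PX \<Otimes>\<^sub>M ?PY)"
    proof cases
      case 1
      then have "(\<lambda>x. x j) \<in> borel_measurable ?PX" by (intro measurable_component_singleton) auto
      then show ?thesis using 1 by (simp add: measurable_compose[OF measurable_fst])
    next
      case 2
      then have "(\<lambda>x. x j) \<in> borel_measurable ?PY" by (intro measurable_component_singleton) auto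
      then show ?thesis using 2 by (simp add: measurable_compose[OF measurable_snd])
    qed simp
  qed
  from measurable_compose[OF this H] have F: "(\<lambda>(x, y). F x y) \<in> borel_measurable (?PX \<Otimes>\<^sub>M ?PY)"
    by (simp add: F_def case_prod_beta')
  have FXY: "F (?X \<omega>) (?Y \<omega>') = H (\<lambda>j. if j < k then Z \<omega> j else Z \<omega>' j)" for \<omega> \<omega>'
    unfolding F_def by (rule dep) auto
  have FX: "F (?X \<omega>) (?Y \<omega>) = H (Z \<omega>)" for \<omega>
    unfolding F_def by (rule dep) auto
  have Fb: "\<bar>F x y\<bar> \<le> B" for x y by (simp add: F_def bound)
  note it = indep_var_expectation_eq_iterated[OF iv F Fb, unfolded FXY if_cancel]
  show "expectation (\<lambda>\<omega>. H (Z \<omega>)) = expectation (\<lambda>\<omega>. expectation (\<lambda>\<omega>'. H (\<lambda>j. if j < k then Z \<omega> j else Z \<omega>' j)))"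
    and "(\<lambda>\<omega>. expectation (\<lambda>\<omega>'. H (\<lambda>j. if j < k then Z \<omega> j else Z \<omega>' j))) \<in> borel_measurable M"
    using it by blast+
  have [measurable]: "?X \<in> measurable M ?PX" "?Y \<in> measurable M ?PY"
    using iv by (auto simp: indep_var_distribution_eq)
  have "(\<lambda>\<omega>. (case (?X \<omega>, ?Y \<omega>) of (x, y) \<Rightarrow> F x y)) \<in> borel_measurable M"
    by (rule measurable_compose[OF _ F]) measurable
  then show "(\<lambda>\<omega>. H (Z \<omega>)) \<in> borel_measurable M" by (simp add: FX)
  fix \<omega>
  show "(\<lambda>\<omega>'. H (\<lambda>j. if j < k then Z \<omega> j else Z \<omega>' j)) \<in> borel_measurable M"
  proof (cases "\<omega> \<in> space M")
    case True
    have "(\<lambda>\<omega>'. (case (?X \<omega>, ?Y \<omega>') of (x, y) \<Rightarrow> F x y)) \<in> borel_measurable M"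
      by (rule measurable_compose[OF _ F]) (use measurable_space[OF \<open>?X \<in> measurable M ?PX\<close> True] in measurable)
    then show ?thesis by (simp add: FXY)
  next
    case False
    have "(\<lambda>\<omega>'. (case (?X \<omega>, ?Y \<omega>') of (x, y) \<Rightarrow> F x y)) \<in> borel_measurable M"
      by (rule measurable_compose[OF _ F]) (intro measurable_Pair measurable_const, auto simp: space_PiM)
    then show ?thesis by (simp add: FXY)
  qed
qed

text \<open>Ottaviani's inequality. If the walk first leaves the ball of radius \<open>r\<close> at time \<open>k\<close>, then with
  conditional probability at least one half the remaining increment is at most $r/2$, and in that case
  the final position is outside the ball of radius $r/2$. So the exit probability is at most twice the
  tail probability at the final time, which the fourth moment bounds by $O((u-t)^2)$.\<close>

lemma grid_maximal_inequality:
  assumes tu: "0 \<le> t" "t < u" "u \<le> T" and n: "n > 0" and r: "r > 0"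
    and small: "96 * (real CARD('d))\<^sup>2 * (u - t)\<^sup>2 / r ^ 4 \<le> 1"
  shows "{\<omega> \<in> space M. \<exists>k\<le>n. norm (W (grid t u n k) \<omega> - W t \<omega>) > r} \<in> events"
    and "prob {\<omega> \<in> space M. \<exists>k\<le>n. norm (W (grid t u n k) \<omega> - W t \<omega>) > r} \<le> 96 * (real CARD('d))\<^sup>2 * (u - t)\<^sup>2 / r ^ 4"
proof -
  define Z where "Z \<omega> j = W (grid t u n (Suc j)) \<omega> - W (grid t u n j) \<omega>" for \<omega> j
  \<comment> \<open>position after \<open>k\<close> steps, and increment over the remaining steps\<close>
  define S where "S k p = (\<Sum>j<k. p j)" for k and p :: "nat \<Rightarrow> real ^ 'd"
  define R where "R k p = (\<Sum>j\<in>{k..<n}. p j)" for k and p :: "nat \<Rightarrow> real ^ 'd"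
  define first where "first k p \<longleftrightarrow> (\<forall>j<k. norm (S j p) \<le> r) \<and> norm (S k p) > r" for k p
  have gridT: "grid t u n k \<in> {0..T}" if "k \<le> n" for k
    using grid_in_interval[of t u n k] tu n that by auto
  have grid_less: "grid t u n k < grid t u n (Suc k)" for k using grid_strict_mono[of t u n k "Suc k"] tu n by simp
  have SZ: "S k (Z \<omega>) = W (grid t u n k) \<omega> - W t \<omega>" for k \<omega>
    unfolding S_def Z_def by (subst sum_lessThan_telescope) simp
  have RZ: "R k (Z \<omega>) = W u \<omega> - W (grid t u n k) \<omega>" if "k \<le> n" for k \<omega>
    unfolding R_def Z_def using sum_Suc_diff'[OF that, of "\<lambda>j. W (grid t u n j) \<omega>"] n by simp
  have Wd: "(\<lambda>\<omega>. W (grid t u n k) \<omega> - W t \<omega>) \<in> borel_measurable M" if "k \<le> n" for k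
    using W_measurable[OF gridT[OF that]] W_measurable[of t] tu by auto
  have [measurable]: "S k \<in> borel_measurable borel" "R k \<in> borel_measurable borel" for k
    unfolding S_def R_def
    by (auto intro!: borel_measurable_continuous_onI continuous_on_sum continuous_on_product_coordinates)
  have [measurable]: "Measurable.pred borel (first k)" for k unfolding first_def by measurable
  have firstM: "{\<omega> \<in> space M. first k (Z \<omega>)} \<in> events" if "k \<le> n" for k
  proof -
    have SZm: "(\<lambda>\<omega>. norm (S j (Z \<omega>))) \<in> borel_measurable M" if "j \<le> k" for j
      unfolding SZ by (rule measurable_compose[OF Wd[OF order_trans[OF that \<open>k \<le> n\<close>]] borel_measurable_norm])
    have "{\<omega> \<in> space M. norm (S j (Z \<omega>)) \<le> r} \<in> events" if "j \<in> {..<k}" for j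
      using that by (intro borel_measurable_le SZm) auto
    then have "{\<omega> \<in> space M. \<forall>j\<in>{..<k}. norm (S j (Z \<omega>)) \<le> r} \<in> events"
      by (rule sets.sets_Collect_finite_All[OF _ finite_lessThan])
    moreover have "{\<omega> \<in> space M. norm (S k (Z \<omega>)) > r} \<in> events"
      by (intro borel_measurable_less SZm) auto
    ultimately have "{\<omega> \<in> space M. \<forall>j\<in>{..<k}. norm (S j (Z \<omega>)) \<le> r} \<inter> {\<omega> \<in> space M. norm (S k (Z \<omega>)) > r} \<in> events"
      by (rule sets.Int)
    moreover have "{\<omega> \<in> space M. \<forall>j\<in>{..<k}. norm (S j (Z \<omega>)) \<le> r} \<inter> {\<omega> \<in> space M. norm (S k (Z \<omega>)) > r}
        = {\<omega> \<in> space M. first k (Z \<omega>)}" by (auto simp: first_def)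
    ultimately show ?thesis by simp
  qed
  let ?q = "3 * (real CARD('d))\<^sup>2 * (u - t)\<^sup>2 / (r / 2) ^ 4"
  have q: "?q = 48 * (real CARD('d))\<^sup>2 * (u - t)\<^sup>2 / r ^ 4" by (simp add: power_divide)
  define H where "H k p = (if first k p \<and> norm (R k p) \<le> r / 2 then 1 else 0 :: real)" for k p
  have Hm: "H k \<in> borel_measurable borel" for k unfolding H_def by measurable
  \<comment> \<open>the event \<open>first k\<close> depends on the past of \<open>k\<close> only, the remainder \<open>R k\<close> on its future\<close>
  have prob_first: "prob {\<omega> \<in> space M. first k (Z \<omega>)} \<le> 2 * expectation (\<lambda>\<omega>. H k (Z \<omega>))" if k: "k \<le> n" for k
  proof -
    have dep: "H k p = H k p'" if "\<And>j. j < n \<Longrightarrow> p j = p' j" for p p'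
    proof -
      have "S j p = S j p'" if "j \<le> k" for j unfolding S_def using that k \<open>\<And>j. j < n \<Longrightarrow> p j = p' j\<close> by (intro sum.cong) auto
      moreover have "R k p = R k p'" unfolding R_def using that by (intro sum.cong) auto
      ultimately show ?thesis by (simp add: H_def first_def)
    qed
    note it = increments_iterated_expectation[of n "grid t u n" "H k" 1 k, OF gridT grid_less Hm _ dep k, folded Z_def]
    have Hmerge: "H k (\<lambda>j. if j < k then Z \<omega> j else Z \<omega>' j) = (if first k (Z \<omega>) \<and> norm (R k (Z \<omega>')) \<le> r / 2 then 1 else 0)" for \<omega> \<omega>'
    proof -
      have "S i (\<lambda>j. if j < k then Z \<omega> j else Z \<omega>' j) = S i (Z \<omega>)" if "i \<le> k" for i
        unfolding S_def using that by (intro sum.cong) auto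
      moreover have "R k (\<lambda>j. if j < k then Z \<omega> j else Z \<omega>' j) = R k (Z \<omega>')"
        unfolding R_def by (intro sum.cong) auto
      ultimately show ?thesis by (simp add: H_def first_def)
    qed
    let ?E = "{\<omega>' \<in> space M. norm (R k (Z \<omega>')) \<le> r / 2}"
    have Rm[measurable]: "(\<lambda>\<omega>. R k (Z \<omega>)) \<in> borel_measurable M"
      unfolding RZ[OF k] using W_measurable[OF gridT[OF k]] W_measurable[of u] tu by auto
    have half: "prob ?E \<ge> 1 / 2"
    proof (cases "k = n")
      case True
      then have "?E = space M" using r by (auto simp: R_def)
      then show ?thesis by (simp add: prob_space)
    next
      case False
      have gk: "t \<le> grid t u n k" "grid t u n k < u"
        using grid_strict_mono[of t u n k n] grid_in_interval[of t u n k] False k tu n by auto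
      have "prob {\<omega> \<in> space M. norm (W u \<omega> - W (grid t u n k) \<omega>) > r / 2} \<le> 3 * (real CARD('d))\<^sup>2 * (u - grid t u n k)\<^sup>2 / (r / 2) ^ 4"
        by (rule gaussian_tail[OF _ increment_gaussian]) (use gk tu r in auto)
      also have "\<dots> \<le> ?q" using gk r by (intro divide_right_mono mult_left_mono power_mono) auto
      also have "\<dots> \<le> 1 / 2" using small unfolding q by simp
      also have "{\<omega> \<in> space M. norm (W u \<omega> - W (grid t u n k) \<omega>) > r / 2} = space M - ?E" by (auto simp: RZ[OF k])
      also have "prob (space M - ?E) = 1 - prob ?E" by (rule prob_compl) measurable
      finally show ?thesis by simp
    qed
    have "expectation (\<lambda>\<omega>. H k (Z \<omega>)) = expectation (\<lambda>\<omega>. expectation (\<lambda>\<omega>'. H k (\<lambda>j. if j < k then Z \<omega> j else Z \<omega>' j)))"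
      by (rule it(1)) (auto simp: H_def)
    also have "\<dots> = expectation (\<lambda>\<omega>. indicator {\<omega> \<in> space M. first k (Z \<omega>)} \<omega> * prob ?E)"
    proof (rule Bochner_Integration.integral_cong[OF refl])
      fix \<omega> assume \<omega>: "\<omega> \<in> space M"
      have "expectation (\<lambda>\<omega>'. H k (\<lambda>j. if j < k then Z \<omega> j else Z \<omega>' j)) =
          expectation (\<lambda>\<omega>'. indicator {\<omega> \<in> space M. first k (Z \<omega>)} \<omega> * indicator ?E \<omega>')"
        by (rule Bochner_Integration.integral_cong[OF refl]) (use \<omega> in \<open>auto simp: Hmerge indicator_def\<close>)
      also have "\<dots> = indicator {\<omega> \<in> space M. first k (Z \<omega>)} \<omega> * prob ?E"
      proof -
        have "?E \<in> events" by measurable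
        then show ?thesis by simp
      qed
      finally show "expectation (\<lambda>\<omega>'. H k (\<lambda>j. if j < k then Z \<omega> j else Z \<omega>' j)) = indicator {\<omega> \<in> space M. first k (Z \<omega>)} \<omega> * prob ?E" .
    qed
    also have "\<dots> = prob {\<omega> \<in> space M. first k (Z \<omega>)} * prob ?E"
      using firstM[OF k] by simp
    finally show ?thesis using mult_left_mono[OF half, of "prob {\<omega> \<in> space M. first k (Z \<omega>)}"] by simp
  qed
  have HZm: "(\<lambda>\<omega>. H k (Z \<omega>)) \<in> borel_measurable M" if k: "k \<le> n" for k
  proof -
    have [measurable]: "Measurable.pred M (\<lambda>\<omega>. first k (Z \<omega>))" using firstM[OF k] by (simp add: pred_def)
    have [measurable]: "(\<lambda>\<omega>. R k (Z \<omega>)) \<in> borel_measurable M"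
      unfolding RZ[OF k] using W_measurable[OF gridT[OF k]] W_measurable[of u] tu by auto
    show ?thesis unfolding H_def by measurable
  qed
  have HZi: "integrable M (\<lambda>\<omega>. H k (Z \<omega>))" if k: "k \<le> n" for k
    by (rule integrable_const_bound[of _ 1, OF _ HZm[OF k]]) (auto simp: H_def)
  have "(\<Sum>k\<le>n. prob {\<omega> \<in> space M. first k (Z \<omega>)}) \<le> (\<Sum>k\<le>n. 2 * expectation (\<lambda>\<omega>. H k (Z \<omega>)))"
    by (rule sum_mono) (simp add: prob_first)
  also have "\<dots> = 2 * expectation (\<lambda>\<omega>. \<Sum>k\<le>n. H k (Z \<omega>))"
    using HZi by (subst Bochner_Integration.integral_sum) (auto simp: sum_distrib_left)
  also have "expectation (\<lambda>\<omega>. \<Sum>k\<le>n. H k (Z \<omega>)) \<le> prob {\<omega> \<in> space M. norm (W u \<omega> - W t \<omega>) > r / 2}"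
  proof -
    let ?D = "{\<omega> \<in> space M. norm (W u \<omega> - W t \<omega>) > r / 2}"
    have [measurable]: "W u \<in> borel_measurable M" "W t \<in> borel_measurable M" using W_measurable tu by auto
    have D: "?D \<in> events" by measurable
    have "(\<Sum>k\<le>n. H k (Z \<omega>)) \<le> indicator ?D \<omega>" if \<omega>: "\<omega> \<in> space M" for \<omega>
    proof (cases "\<exists>k\<le>n. H k (Z \<omega>) \<noteq> 0")
      case True
      then obtain k where k: "k \<le> n" "first k (Z \<omega>)" "norm (R k (Z \<omega>)) \<le> r / 2" by (auto simp: H_def split: if_splits)
      have "H i (Z \<omega>) = 0" if "i \<noteq> k" for i
        using that k(2) unfolding H_def first_def by (metis linorder_neqE_nat not_le)
      then have "(\<Sum>i\<le>n. H i (Z \<omega>)) = (\<Sum>i\<in>{k}. H i (Z \<omega>))" using k(1) by (intro sum.mono_neutral_right) auto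
      also have "\<dots> \<le> 1" by (simp add: H_def)
      also have "norm (W u \<omega> - W t \<omega>) > r / 2"
      proof -
        have "W u \<omega> - W t \<omega> = S k (Z \<omega>) + R k (Z \<omega>)" using k(1) by (simp add: SZ RZ)
        then show ?thesis using k(2,3) norm_triangle_ineq4[of "S k (Z \<omega>) + R k (Z \<omega>)" "R k (Z \<omega>)"] by (simp add: first_def)
      qed
      then have "1 = indicator ?D \<omega>" using \<omega> by simp
      finally show ?thesis by simp
    qed simp
    then have "expectation (\<lambda>\<omega>. \<Sum>k\<le>n. H k (Z \<omega>)) \<le> expectation (indicator ?D)"
      using D HZi by (intro integral_mono) (auto simp: emeasure_eq_measure)
    then show ?thesis using D by simp
  qed
  also have "\<dots> \<le> ?q" by (rule gaussian_tail[OF _ increment_gaussian]) (use tu r in auto)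
  finally have le: "(\<Sum>k\<le>n. prob {\<omega> \<in> space M. first k (Z \<omega>)}) \<le> 96 * (real CARD('d))\<^sup>2 * (u - t)\<^sup>2 / r ^ 4"
    unfolding q by simp
  have ex: "(\<exists>k\<le>n. norm (S k p) > r) \<longleftrightarrow> (\<exists>k\<le>n. first k p)" for p
  proof
    assume "\<exists>k\<le>n. norm (S k p) > r"
    then obtain k where k: "k \<le> n" "norm (S k p) > r" by blast
    define m where "m = (LEAST k. norm (S k p) > r)"
    have "norm (S m p) > r" unfolding m_def using k(2) by (rule LeastI)
    moreover have "norm (S j p) \<le> r" if "j < m" for j using not_less_Least[of j] that unfolding m_def by force
    moreover have "m \<le> k" unfolding m_def using k(2) by (rule Least_le)
    ultimately show "\<exists>k\<le>n. first k p" using k(1) unfolding first_def by (meson order_trans)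
  qed (auto simp: first_def)
  have eq: "{\<omega> \<in> space M. \<exists>k\<le>n. norm (W (grid t u n k) \<omega> - W t \<omega>) > r} = (\<Union>k\<in>{..n}. {\<omega> \<in> space M. first k (Z \<omega>)})"
    unfolding SZ[symmetric] ex by auto
  show "{\<omega> \<in> space M. \<exists>k\<le>n. norm (W (grid t u n k) \<omega> - W t \<omega>) > r} \<in> events"
    unfolding eq using firstM by (intro sets.finite_UN) auto
  have "prob (\<Union>k\<in>{..n}. {\<omega> \<in> space M. first k (Z \<omega>)}) \<le> (\<Sum>k\<le>n. prob {\<omega> \<in> space M. first k (Z \<omega>)})"
    by (rule finite_measure_subadditive_finite) (use firstM in auto)
  then show "prob {\<omega> \<in> space M. \<exists>k\<le>n. norm (W (grid t u n k) \<omega> - W t \<omega>) > r} \<le> 96 * (real CARD('d))\<^sup>2 * (u - t)\<^sup>2 / r ^ 4"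
    unfolding eq using le by simp
qed

end

section \<open>The tower property and continuity of the expected payoff\<close>

lemma polygon_cong: "(\<And>j. j < n \<Longrightarrow> p j = q j) \<Longrightarrow> polygon a b n p = polygon a b n q"
  by (simp add: polygon_def fun_eq_iff)

lemma concat_path_diff:
  "s \<in> {0..T} \<Longrightarrow> concat_path T t x w s - concat_path T t x w' s = (w (max s t) - w t) - (w' (max s t) - w' t)"
  by (simp add: concat_path_def)

lemma sup_dist_concat_path_le:
  assumes u: "u \<in> {0..T}" and y: "\<And>s. s \<in> {0..u} \<Longrightarrow> norm (y s - y' s) \<le> c"
    and w: "\<And>s. s \<in> {u..T} \<Longrightarrow> norm ((w s - w u) - (w' s - w' u)) \<le> e"
  shows "sup_dist T (concat_path T u y w) (concat_path T u y' w') \<le> c + e"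
proof (rule sup_dist_le)
  show "0 \<le> T" using u by auto
  fix s assume s: "s \<in> {0..T}"
  have "norm (y (min s u) - y' (min s u)) \<le> c" using s u by (intro y) auto
  moreover have "norm ((w (max s u) - w u) - (w' (max s u) - w' u)) \<le> e" using s u by (intro w) auto
  moreover have "concat_path T u y w s - concat_path T u y' w' s =
      (y (min s u) - y' (min s u)) + ((w (max s u) - w u) - (w' (max s u) - w' u))"
    using s by (simp add: concat_path_def)
  ultimately show "norm (concat_path T u y w s - concat_path T u y' w' s) \<le> c + e"
    by (metis norm_triangle_mono)
qed

lemma polygon_increments_close:
  assumes "a < b" "continuous_on {a..b} w" "\<epsilon> > 0"
  shows "\<forall>\<^sub>F n in sequentially. \<forall>s\<in>{a..b}.
    norm ((polygon a b n (increments a b n w) s - polygon a b n (increments a b n w) a) - (w s - w a)) \<le> \<epsilon>"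
  using uniform_limitD[OF polygon_uniform_limit[OF assms(1,2)] half_gt_zero[OF assms(3)]]
proof eventually_elim
  case (elim n)
  show ?case
  proof
    fix s assume s: "s \<in> {a..b}"
    let ?P = "polygon a b n (increments a b n w)"
    have "norm (?P s - (w s - w a)) < \<epsilon> / 2" "norm (?P a - (w a - w a)) < \<epsilon> / 2"
      using elim[rule_format, OF s] elim[rule_format, of a] assms(1) unfolding dist_norm by auto
    moreover have eq: "(?P s - ?P a) - (w s - w a) = (?P s - (w s - w a)) - (?P a - (w a - w a))" by simp
    ultimately show "norm ((?P s - ?P a) - (w s - w a)) \<le> \<epsilon>"
      unfolding eq using norm_triangle_ineq4[of "?P s - (w s - w a)" "?P a - (w a - w a)"] by linarith
  qed
qed

text \<open>A path following \<open>x\<close> up to \<open>t\<close>, one polygon on $[t,u]$ and another on $[u,T]$. The first \<open>n\<close> increments of the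
  sequence \<open>p\<close> drive the first segment and the next \<open>n\<close> the second one, so that past and future of \<open>u\<close> are
  separated.\<close>

definition two_segment_path :: "real \<Rightarrow> real \<Rightarrow> real \<Rightarrow> (real \<Rightarrow> real ^ 'd) \<Rightarrow> nat \<Rightarrow> (nat \<Rightarrow> real ^ 'd) \<Rightarrow> (real \<Rightarrow> real ^ 'd)" where
  "two_segment_path T t u x n p =
    concat_path T u (concat_path T t x (polygon t u n p)) (polygon u T n (\<lambda>j. p (n + j)))"

definition two_segment_grid :: "real \<Rightarrow> real \<Rightarrow> real \<Rightarrow> nat \<Rightarrow> nat \<Rightarrow> real" where
  "two_segment_grid T t u n k = (if k \<le> n then grid t u n k else grid u T n (k - n))"

context
  fixes T t u :: real and x :: "real \<Rightarrow> real ^ 'd"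
  assumes tu: "0 \<le> t" "t < u" "u < T" and x: "x \<in> cont_paths T"
begin

lemma two_segment_path_in_cont_paths: "n > 0 \<Longrightarrow> two_segment_path T t u x n p \<in> cont_paths T"
  unfolding two_segment_path_def using tu x
  by (intro concat_path_in_cont_paths continuous_on_polygon) auto

lemma sup_dist_two_segment_path:
  "sup_dist T (two_segment_path T t u x n p) (two_segment_path T t u x n q) \<le> 2 * (\<Sum>j<2 * n. norm (q j - p j))"
proof -
  have pol: "norm ((polygon a b n p s - polygon a b n p s') - (polygon a b n q s - polygon a b n q s')) \<le> 2 * (\<Sum>j<n. norm (q j - p j))"
    for a b s s' and p q :: "nat \<Rightarrow> real ^ 'd"
  proof -
    have "norm (polygon a b n p s - polygon a b n q s) \<le> (\<Sum>j<n. norm (q j - p j))" for s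
      using polygon_diff[of a b n p s q] by (simp add: norm_minus_commute)
    from this[of s] this[of s'] show ?thesis
      using norm_triangle_ineq4[of "polygon a b n p s - polygon a b n q s" "polygon a b n p s' - polygon a b n q s'"]
      by (simp add: algebra_simps)
  qed
  have "sup_dist T (two_segment_path T t u x n p) (two_segment_path T t u x n q)
      \<le> 2 * (\<Sum>j<n. norm (q j - p j)) + 2 * (\<Sum>j<n. norm (q (n + j) - p (n + j)))"
    unfolding two_segment_path_def
    by (rule sup_dist_concat_path_le) (use tu in \<open>auto simp: concat_path_diff intro!: pol\<close>)
  also have "(\<Sum>j<n. norm (q (n + j) - p (n + j))) = (\<Sum>j\<in>{n..<2 * n}. norm (q j - p j))"
    by (rule sum.reindex_bij_witness[of _ "\<lambda>j. j - n" "\<lambda>j. n + j"]) auto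
  also have "2 * (\<Sum>j<n. norm (q j - p j)) + 2 * \<dots> = 2 * (\<Sum>j<2 * n. norm (q j - p j))"
    by (simp add: lessThan_atLeast0 sum.atLeastLessThan_concat flip: distrib_left)
  finally show ?thesis .
qed

lemma two_segment_grid_range:
  assumes "n > 0" "j \<le> 2 * n" shows "two_segment_grid T t u n j \<in> {0..T}"
proof (cases "j \<le> n")
  case True
  then show ?thesis using grid_in_interval[of t u n j] assms tu by (simp add: two_segment_grid_def)
next
  case False
  then have "j - n \<le> n" using assms by simp
  then show ?thesis using False grid_in_interval[of u T n "j - n"] assms tu by (simp add: two_segment_grid_def)
qed

lemma two_segment_grid_less: "n > 0 \<Longrightarrow> j < 2 * n \<Longrightarrow> two_segment_grid T t u n j < two_segment_grid T t u n (Suc j)"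
proof -
  assume n: "n > 0"
  consider "j < n" | "j = n" | "j > n" by linarith
  then show ?thesis
  proof cases
    case 1 then show ?thesis using grid_strict_mono[of t u n j "Suc j"] tu n by (simp add: two_segment_grid_def)
  next
    case 2 then show ?thesis using grid_strict_mono[of u T n 0 1] tu n by (simp add: two_segment_grid_def)
  next
    case 3 then show ?thesis using grid_strict_mono[of u T n "j - n" "Suc j - n"] tu n by (simp add: two_segment_grid_def)
  qed
qed

lemma two_segment_path_increments:
  fixes w w' :: "real \<Rightarrow> real ^ 'd"
  assumes n: "n > 0"
  defines "Z v j \<equiv> v (two_segment_grid T t u n (Suc j)) - v (two_segment_grid T t u n j)"
  shows "two_segment_path T t u x n (\<lambda>j. if j < n then Z w j else Z w' j) =
    concat_path T u (concat_path T t x (polygon t u n (increments t u n w))) (polygon u T n (increments u T n w'))"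
proof -
  have "polygon t u n (\<lambda>j. if j < n then Z w j else Z w' j) = polygon t u n (increments t u n w)"
    by (rule polygon_cong) (simp add: Z_def increments_def two_segment_grid_def)
  moreover have "polygon u T n (\<lambda>j. if n + j < n then Z w (n + j) else Z w' (n + j)) = polygon u T n (increments u T n w')"
    by (rule polygon_cong) (use n in \<open>auto simp: Z_def increments_def two_segment_grid_def\<close>)
  ultimately show ?thesis by (simp add: two_segment_path_def)
qed

text \<open>Two driving paths are allowed because the increments before and after \<open>u\<close> will come from
  independent copies of the Brownian motion.\<close>

lemma two_segment_polygons_converge:
  fixes w w' :: "real \<Rightarrow> real ^ 'd"
  assumes w: "continuous_on {0..T} w" "continuous_on {0..T} w'"
    and \<xi>: "pm_continuous_on (sup_dist T) (cont_paths T) \<xi>"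
  shows "(\<lambda>n. \<xi> (concat_path T u (concat_path T t x (polygon t u (Suc n) (increments t u (Suc n) w)))
      (polygon u T (Suc n) (increments u T (Suc n) w')))) \<longlonglongrightarrow> \<xi> (concat_path T u (concat_path T t x w) w')"
proof (rule pm_continuous_on_tendsto[OF \<xi>])
  let ?y = "concat_path T u (concat_path T t x w) w'"
  let ?y' = "\<lambda>n. concat_path T u (concat_path T t x (polygon t u n (increments t u n w))) (polygon u T n (increments u T n w'))"
  show y: "?y \<in> cont_paths T"
    using tu x w by (intro concat_path_in_cont_paths) (auto elim: continuous_on_subset)
  have y': "?y' (Suc n) \<in> cont_paths T" for n
    using tu x by (intro concat_path_in_cont_paths continuous_on_polygon) auto
  then show "\<forall>\<^sub>F n in sequentially. ?y' (Suc n) \<in> cont_paths T" by simp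
  fix \<epsilon> :: real assume \<epsilon>: "0 < \<epsilon>"
  have e3: "\<epsilon> / 3 > 0" using \<epsilon> by simp
  have cw: "continuous_on {t..u} w" "continuous_on {u..T} w'" using w tu by (auto elim!: continuous_on_subset)
  have "\<forall>\<^sub>F n in sequentially. sup_dist T ?y (?y' n) < \<epsilon>"
    using polygon_increments_close[OF tu(2) cw(1) e3] polygon_increments_close[OF tu(3) cw(2) e3]
  proof eventually_elim
    case (elim n)
    have "sup_dist T ?y (?y' n) \<le> \<epsilon> / 3 + \<epsilon> / 3"
    proof (rule sup_dist_concat_path_le)
      fix s assume s: "s \<in> {0..u}"
      have "max s t \<in> {t..u}" using s tu by auto
      then show "norm (concat_path T t x w s - concat_path T t x (polygon t u n (increments t u n w)) s) \<le> \<epsilon> / 3"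
        using s tu elim(1) by (subst concat_path_diff) (auto simp: norm_minus_commute)
    next
      fix s assume s: "s \<in> {u..T}"
      then show "norm ((w' s - w' u) - (polygon u T n (increments u T n w') s - polygon u T n (increments u T n w') u)) \<le> \<epsilon> / 3"
        using elim(2) by (auto simp: norm_minus_commute)
    qed (use tu in auto)
    then show ?case using \<epsilon> by simp
  qed
  then show "\<forall>\<^sub>F n in sequentially. sup_dist T ?y (?y' (Suc n)) < \<epsilon>"
    by (rule eventually_sequentially_Suc[THEN iffD2])
qed

end

locale brownian_payoff = brownian M T W for M :: "'a measure" and T and W :: "real \<Rightarrow> 'a \<Rightarrow> real ^ 'd" +
  fixes \<xi> :: "(real \<Rightarrow> real ^ 'd) \<Rightarrow> real" and B :: real
  assumes payoff_continuous: "pm_continuous_on (sup_dist T) (cont_paths T) \<xi>"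
    and payoff_bounded: "\<And>x. x \<in> cont_paths T \<Longrightarrow> \<bar>\<xi> x\<bar> \<le> B"
begin

definition expected_payoff :: "real \<Rightarrow> (real \<Rightarrow> real ^ 'd) \<Rightarrow> real" where
  "expected_payoff t x = expectation (\<lambda>\<omega>. \<xi> (concat_path T t x (path \<omega>)))"

lemma concat_path_continuous:
  assumes "(t, x) \<in> cont_domain T" "continuous_on {0..T} w"
  shows "concat_path T t x w \<in> cont_paths T"
  using assms by (intro concat_path_in_cont_paths) (auto simp: cont_domain_def elim: continuous_on_subset)

lemma AE_payoff_bounded:
  assumes "(t, x) \<in> cont_domain T"
  shows "AE \<omega> in M. \<bar>\<xi> (concat_path T t x (path \<omega>))\<bar> \<le> B"
  using AE_continuous by eventually_elim (rule payoff_bounded[OF concat_path_continuous[OF assms]])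

text \<open>For polygons through the grid values the payoff is a function of finitely many independent
  increments, and averaging first over those after \<open>u\<close> is an iterated expectation. As the grid is refined, the inner
  expectations converge to the expected payoff at time \<open>u\<close>, and then the outer ones converge too. Working with
  iterated integrals throughout avoids any question of joint measurability in the two sample points for the limit.\<close>

lemma payoff_tower:
  assumes tu: "0 \<le> t" "t < u" "u < T" and x: "x \<in> cont_paths T"
  shows "(\<lambda>\<omega>. \<xi> (concat_path T t x (path \<omega>))) \<in> borel_measurable M"
    and "integrable M (\<lambda>\<omega>. expected_payoff u (concat_path T t x (path \<omega>)))"
    and "expectation (\<lambda>\<omega>. expected_payoff u (concat_path T t x (path \<omega>))) = expected_payoff t x"
proof -
  define Z where "Z n w = (\<lambda>j. w (two_segment_grid T t u n (Suc j)) - w (two_segment_grid T t u n j))"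
    for n and w :: "real \<Rightarrow> real ^ 'd"
  define H where "H n p = \<xi> (two_segment_path T t u x n p)" for n p
  have Hb: "\<bar>H n p\<bar> \<le> B" if "n > 0" for n p
    unfolding H_def by (rule payoff_bounded[OF two_segment_path_in_cont_paths[OF tu x that]])
  have Hm: "H n \<in> borel_measurable borel" if n: "n > 0" for n
  proof (rule borel_measurable_continuous_onI, rule continuous_on_finitely_many_coordinates[where n = "2 * n"])
    fix p :: "nat \<Rightarrow> real ^ 'd" and \<epsilon> :: real assume "\<epsilon> > 0"
    then obtain \<delta> where \<delta>: "\<delta> > 0"
        "\<And>y. y \<in> cont_paths T \<Longrightarrow> sup_dist T (two_segment_path T t u x n p) y < \<delta> \<Longrightarrow> dist (\<xi> y) (H n p) < \<epsilon>"
      using payoff_continuous two_segment_path_in_cont_paths[OF tu x n] unfolding pm_continuous_on_def H_def by blast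
    have "dist (H n q) (H n p) < \<epsilon>" if "(\<Sum>j<2 * n. norm (q j - p j)) < \<delta> / 2" for q
      unfolding H_def[of n q]
      by (rule \<delta>(2)[OF two_segment_path_in_cont_paths[OF tu x n]])
        (use sup_dist_two_segment_path[OF tu x, of n p q] that in linarith)
    then show "\<exists>\<delta>>0. \<forall>q. (\<Sum>j<2 * n. norm (q j - p j)) < \<delta> \<longrightarrow> dist (H n q) (H n p) < \<epsilon>"
      using \<delta>(1) by (intro exI[of _ "\<delta> / 2"]) auto
  qed
  have dep: "H n p = H n q" if "\<And>j. j < 2 * n \<Longrightarrow> p j = q j" for n p q
  proof -
    have "polygon t u n p = polygon t u n q" by (rule polygon_cong) (simp add: that)
    moreover have "polygon u T n (\<lambda>j. p (n + j)) = polygon u T n (\<lambda>j. q (n + j))"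
      by (rule polygon_cong) (simp add: that)
    ultimately show ?thesis by (simp add: H_def two_segment_path_def)
  qed
  define E where "E n \<omega> \<omega>' = H (Suc n) (\<lambda>j. if j < Suc n then Z (Suc n) (path \<omega>) j else Z (Suc n) (path \<omega>') j)" for n \<omega> \<omega>'
  note it = increments_iterated_expectation[where n = "2 * Suc n" and \<tau> = "two_segment_grid T t u (Suc n)" and H = "H (Suc n)" and k = "Suc n" for n,
      OF two_segment_grid_range[OF tu x] two_segment_grid_less[OF tu x] Hm Hb dep]
  have it1: "expectation (\<lambda>\<omega>. H (Suc n) (Z (Suc n) (path \<omega>))) = expectation (\<lambda>\<omega>. expectation (E n \<omega>))"
    "(\<lambda>\<omega>. H (Suc n) (Z (Suc n) (path \<omega>))) \<in> borel_measurable M"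
    "(\<lambda>\<omega>. expectation (E n \<omega>)) \<in> borel_measurable M"
    "\<And>\<omega>. E n \<omega> \<in> borel_measurable M" for n
    unfolding E_def Z_def by (rule it; simp)+
  have Eb: "\<bar>E n \<omega> \<omega>'\<bar> \<le> B" for n \<omega> \<omega>' unfolding E_def by (rule Hb) simp
  have lim: "(\<lambda>n. E n \<omega> \<omega>') \<longlonglongrightarrow> \<xi> (concat_path T u (concat_path T t x (path \<omega>)) (path \<omega>'))"
    if "continuous_on {0..T} (path \<omega>)" "continuous_on {0..T} (path \<omega>')" for \<omega> \<omega>'
    using two_segment_polygons_converge[OF tu x that payoff_continuous]
    unfolding E_def H_def Z_def by (simp only: two_segment_path_increments[OF tu x zero_less_Suc, where w = "path \<omega>" and w' = "path \<omega>'"])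
  \<comment> \<open>with the same sample point in both segments the polygons approximate the Brownian path itself\<close>
  have diag: "H (Suc n) (Z (Suc n) (path \<omega>)) = E n \<omega> \<omega>" for n \<omega> by (simp add: E_def)
  have cc: "concat_path T u (concat_path T t x (path \<omega>)) (path \<omega>) = concat_path T t x (path \<omega>)" for \<omega>
    using tu by (intro concat_path_concat_path) auto
  have "AE \<omega> in M. (\<lambda>n. E n \<omega> \<omega>) \<longlonglongrightarrow> \<xi> (concat_path T t x (path \<omega>))"
    using AE_continuous by eventually_elim (metis lim cc)
  note outer = bounded_convergence_AE[OF it1(2)[unfolded diag] this AE_I2[OF Eb]]
  show "(\<lambda>\<omega>. \<xi> (concat_path T t x (path \<omega>))) \<in> borel_measurable M" by (rule outer(1))
  have inner: "(\<lambda>n. expectation (E n \<omega>)) \<longlonglongrightarrow> expected_payoff u (concat_path T t x (path \<omega>))"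
    if \<omega>: "continuous_on {0..T} (path \<omega>)" for \<omega>
    unfolding expected_payoff_def
  proof (rule bounded_convergence_AE(3)[OF it1(4) _ AE_I2[OF Eb]])
    show "AE \<omega>' in M. (\<lambda>n. E n \<omega> \<omega>') \<longlonglongrightarrow> \<xi> (concat_path T u (concat_path T t x (path \<omega>)) (path \<omega>'))"
      using AE_continuous by eventually_elim (rule lim[OF \<omega>])
  qed
  have B: "B \<ge> 0" using order_trans[OF abs_ge_zero Hb[of 1]] by simp
  have bE: "\<bar>expectation (E n \<omega>)\<bar> \<le> B" for n \<omega>
  proof -
    have "\<bar>expectation (E n \<omega>)\<bar> \<le> expectation (\<lambda>\<omega>'. \<bar>E n \<omega> \<omega>'\<bar>)" by (rule integral_abs_bound)
    also have "\<dots> \<le> expectation (\<lambda>_. B)"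
      by (rule integral_mono) (auto intro!: integrable_abs integrable_const_bound[of _ B] it1(4) simp: Eb)
    finally show ?thesis by (simp add: prob_space)
  qed
  have "AE \<omega> in M. (\<lambda>n. expectation (E n \<omega>)) \<longlonglongrightarrow> expected_payoff u (concat_path T t x (path \<omega>))"
    using AE_continuous by eventually_elim (rule inner)
  note iter = bounded_convergence_AE[OF it1(3) this AE_I2[OF bE]]
  show "integrable M (\<lambda>\<omega>. expected_payoff u (concat_path T t x (path \<omega>)))" by (rule iter(2))
  show "expectation (\<lambda>\<omega>. expected_payoff u (concat_path T t x (path \<omega>))) = expected_payoff t x"
    using LIMSEQ_unique[OF iter(3)] outer(3) it1(1) unfolding diag expected_payoff_def by simp
qed

lemma concat_path_end: "x \<in> cont_paths T \<Longrightarrow> concat_path T T x w = x"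
  by (auto simp: concat_path_def cont_paths_def fun_eq_iff restrict_def extensional_def max_def min_def)

lemma expected_payoff_end: "x \<in> cont_paths T \<Longrightarrow> expected_payoff T x = \<xi> x"
  by (simp add: expected_payoff_def concat_path_end prob_space)

lemma payoff_measurable:
  assumes "(t, x) \<in> cont_domain T"
  shows "(\<lambda>\<omega>. \<xi> (concat_path T t x (path \<omega>))) \<in> borel_measurable M"
proof (cases "t = T")
  case True
  then show ?thesis using assms by (simp add: concat_path_end cont_domain_def)
next
  case False
  then show ?thesis using assms by (intro payoff_tower(1)[of t "(t + T) / 2"]) (auto simp: cont_domain_def field_simps)
qed

lemma payoff_integrable: "(t, x) \<in> cont_domain T \<Longrightarrow> integrable M (\<lambda>\<omega>. \<xi> (concat_path T t x (path \<omega>)))"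
  by (rule integrable_const_bound[of _ B]) (use AE_payoff_bounded payoff_measurable in auto)

lemma expected_payoff_bounded:
  assumes "(t, x) \<in> cont_domain T" shows "\<bar>expected_payoff t x\<bar> \<le> B"
proof -
  have "\<bar>expected_payoff t x\<bar> \<le> expectation (\<lambda>\<omega>. \<bar>\<xi> (concat_path T t x (path \<omega>))\<bar>)"
    unfolding expected_payoff_def by (rule integral_abs_bound)
  also have "\<dots> \<le> expectation (\<lambda>_. B)"
    by (rule integral_mono_AE) (use AE_payoff_bounded[OF assms] payoff_integrable[OF assms] in auto)
  finally show ?thesis by (simp add: prob_space)
qed

lemma expected_payoff_continuous: "pm_continuous_on (d_inf T) (cont_domain T) (\<lambda>(t, x). expected_payoff t x)"
proof (rule pm_continuous_on_seqI)
  fix p and q :: "nat \<Rightarrow> real \<times> (real \<Rightarrow> real ^ 'd)"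
  assume p: "p \<in> cont_domain T" and q: "\<And>n. q n \<in> cont_domain T" and lim: "(\<lambda>n. d_inf T p (q n)) \<longlonglongrightarrow> 0"
  obtain t x where tx: "p = (t, x)" by (cases p)
  define u y where "u n = fst (q n)" and "y n = snd (q n)" for n
  have q_eq: "q n = (u n, y n)" for n by (simp add: u_def y_def)
  have conv: "(\<lambda>n. \<xi> (concat_path T (u n) (y n) w)) \<longlonglongrightarrow> \<xi> (concat_path T t x w)" if w: "continuous_on {0..T} w" for w
  proof (rule pm_continuous_on_tendsto[OF payoff_continuous])
    show "concat_path T t x w \<in> cont_paths T" using p w by (simp add: tx concat_path_continuous)
    show "\<forall>\<^sub>F n in sequentially. concat_path T (u n) (y n) w \<in> cont_paths T"
      using q w by (intro always_eventually allI concat_path_continuous) (simp_all add: q_eq)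
    fix \<epsilon> :: real assume \<epsilon>: "0 < \<epsilon>"
    have "uniformly_continuous_on {0..T} w" using w by (simp add: compact_uniformly_continuous)
    then obtain \<delta> where \<delta>: "\<delta> > 0" "\<And>s s'. s \<in> {0..T} \<Longrightarrow> s' \<in> {0..T} \<Longrightarrow> \<bar>s - s'\<bar> < \<delta> \<Longrightarrow> norm (w s - w s') < \<epsilon> / 3"
      using \<epsilon> unfolding uniformly_continuous_on_def dist_norm by (metis divide_pos_pos real_norm_def zero_less_numeral)
    have "\<forall>\<^sub>F n in sequentially. d_inf T p (q n) < min \<delta> (\<epsilon> / 3)"
      using lim \<delta> \<epsilon> by (intro order_tendstoD(2)) auto
    then show "\<forall>\<^sub>F n in sequentially. sup_dist T (concat_path T t x w) (concat_path T (u n) (y n) w) < \<epsilon>"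
    proof eventually_elim
      case (elim n)
      have dom: "(t, x) \<in> cont_domain T" "(u n, y n) \<in> cont_domain T" using p q[of n] by (auto simp: tx q_eq)
      have "\<bar>t - u n\<bar> + norm (x (min 0 t) - y n (min 0 (u n))) \<le> d_inf T p (q n)"
        using norm_diff_le_d_inf[OF dom, of 0] T_pos by (simp add: tx q_eq)
      then have "\<bar>t - u n\<bar> < \<delta>"
        using elim norm_ge_zero[of "x (min 0 t) - y n (min 0 (u n))"] by linarith
      then have "sup_dist T (concat_path T t x w) (concat_path T (u n) (y n) w) \<le> d_inf T (t, x) (u n, y n) + 2 * (\<epsilon> / 3)"
        using \<delta>(2) by (intro sup_dist_concat_path dom) (auto intro!: less_imp_le)
      then show ?case using elim by (simp add: tx q_eq)
    qed
  qed
  have "(\<lambda>n. expected_payoff (u n) (y n)) \<longlonglongrightarrow> expected_payoff t x"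
    unfolding expected_payoff_def
  proof (rule bounded_convergence_AE(3))
    show "AE \<omega> in M. (\<lambda>n. \<xi> (concat_path T (u n) (y n) (path \<omega>))) \<longlonglongrightarrow> \<xi> (concat_path T t x (path \<omega>))"
      using AE_continuous by eventually_elim (rule conv)
    show "(\<lambda>\<omega>. \<xi> (concat_path T (u n) (y n) (path \<omega>))) \<in> borel_measurable M" for n
      using q[of n] by (intro payoff_measurable) (simp add: q_eq)
    show "AE \<omega> in M. \<bar>\<xi> (concat_path T (u n) (y n) (path \<omega>))\<bar> \<le> B" for n
      using q[of n] by (intro AE_payoff_bounded) (simp add: q_eq)
  qed
  then show "(\<lambda>n. case q n of (t, x) \<Rightarrow> expected_payoff t x) \<longlonglongrightarrow> (case p of (t, x) \<Rightarrow> expected_payoff t x)"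
    by (simp add: q_eq tx)
qed (auto intro: d_inf_nonneg)

end

section \<open>Pathwise derivatives along step paths\<close>

lemma cadlag_bump:
  assumes "x \<in> cadlag_paths T" shows "bump T a y x \<in> cadlag_paths T"
proof -
  have r: "(bump T a y x \<longlongrightarrow> bump T a y x t) (at_right t)" if t: "t \<in> {0..<T}" for t
  proof -
    have "\<forall>\<^sub>F s in at_right t. x s + (if a \<le> t then y else 0) = bump T a y x s"
    proof (cases "a \<le> t")
      case True
      have "\<forall>\<^sub>F s in at_right t. s \<in> {t<..<T}" using t by (intro eventually_at_right_real) auto
      then show ?thesis by eventually_elim (use True t in \<open>auto simp: bump_def\<close>)
    next
      case False
      have "\<forall>\<^sub>F s in at_right t. s \<in> {t<..<min a T}" using t False by (intro eventually_at_right_real) auto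
      then show ?thesis by eventually_elim (use False t in \<open>auto simp: bump_def\<close>)
    qed
    moreover have "((\<lambda>s. x s + (if a \<le> t then y else 0)) \<longlongrightarrow> x t + (if a \<le> t then y else 0)) (at_right t)"
      using assms t by (intro tendsto_add tendsto_const) (auto simp: cadlag_paths_def)
    moreover have "bump T a y x t = x t + (if a \<le> t then y else 0)" using t by (simp add: bump_def)
    ultimately show ?thesis by (simp add: Lim_transform_eventually)
  qed
  have l: "\<exists>l. (bump T a y x \<longlongrightarrow> l) (at_left t)" if t: "t \<in> {0<..T}" for t
  proof -
    obtain l where l: "(x \<longlongrightarrow> l) (at_left t)" using assms t unfolding cadlag_paths_def by blast
    have "\<forall>\<^sub>F s in at_left t. x s + (if a < t then y else 0) = bump T a y x s"
    proof (cases "a < t")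
      case True
      have "\<forall>\<^sub>F s in at_left t. s \<in> {max a 0<..<t}" using t True by (intro eventually_at_left_real) auto
      then show ?thesis by eventually_elim (use True t in \<open>auto simp: bump_def\<close>)
    next
      case False
      have "\<forall>\<^sub>F s in at_left t. s \<in> {0<..<t}" using t by (intro eventually_at_left_real) auto
      then show ?thesis by eventually_elim (use False t in \<open>auto simp: bump_def\<close>)
    qed
    moreover have "((\<lambda>s. x s + (if a < t then y else 0)) \<longlongrightarrow> l + (if a < t then y else 0)) (at_left t)"
      by (intro tendsto_add tendsto_const l)
    ultimately show ?thesis by (blast intro: Lim_transform_eventually)
  qed
  show ?thesis using r l unfolding cadlag_paths_def by (auto simp: bump_def)
qed

lemma bump_bump: "bump T a z (bump T a y x) = bump T a (y + z) x"
  by (auto simp: bump_def fun_eq_iff restrict_def)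

lemma bump_zero: "x \<in> cadlag_paths T \<Longrightarrow> bump T a 0 x = x"
  by (auto simp: bump_def cadlag_paths_def fun_eq_iff restrict_def extensional_def)

lemma continuous_on_bump:
  fixes g :: "real \<times> (real \<Rightarrow> real ^ 'd) \<Rightarrow> 'b::metric_space"
  assumes g: "pm_continuous_on (d_inf T) (cadlag_domain T) g" and sx: "(s, x) \<in> cadlag_domain T"
  shows "continuous_on UNIV (\<lambda>y. g (s, bump T s y x))"
  unfolding continuous_on_def
proof
  fix y :: "real ^ 'd"
  have s: "s \<in> {0..T}" "x \<in> cadlag_paths T" using sx by (auto simp: cadlag_domain_def)
  then have dom: "(s, bump T s z x) \<in> cadlag_domain T" for z by (simp add: cadlag_domain_def cadlag_bump)
  have le: "d_inf T (s, bump T s y x) (s, bump T s z x) \<le> norm (y - z)" for z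
  proof -
    have "d_inf T (s, bump T s y x) (s, bump T s z x) \<le> \<bar>s - s\<bar> + norm (y - z)"
      by (rule d_inf_le) (use s in \<open>auto simp: bump_def\<close>)
    then show ?thesis by simp
  qed
  have "((\<lambda>z. g (s, bump T s z x)) \<longlongrightarrow> g (s, bump T s y x)) (at y)"
  proof (rule tendstoI)
    fix \<epsilon> :: real assume "0 < \<epsilon>"
    then obtain \<delta> where \<delta>: "\<delta> > 0" "\<And>q. q \<in> cadlag_domain T \<Longrightarrow> d_inf T (s, bump T s y x) q < \<delta> \<Longrightarrow> dist (g q) (g (s, bump T s y x)) < \<epsilon>"
      using g dom unfolding pm_continuous_on_def by blast
    have "\<forall>\<^sub>F z in at y. dist z y < \<delta>" using \<delta>(1) by (rule tendstoD[OF tendsto_ident_at])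
    then show "\<forall>\<^sub>F z in at y. dist (g (s, bump T s z x)) (g (s, bump T s y x)) < \<epsilon>"
    proof eventually_elim
      case (elim z)
      then show ?case using le[of z] by (intro \<delta>(2) dom) (simp add: dist_norm norm_minus_commute)
    qed
  qed
  then show "((\<lambda>z. g (s, bump T s z x)) \<longlongrightarrow> g (s, bump T s y x)) (at y within UNIV)" .
qed

text \<open>Bumps at the same time add up, so vertical derivatives at bumped paths are ordinary partial
  derivatives of the function of the bump size.\<close>

lemma vertical_deriv_bump:
  fixes g :: "real \<times> (real \<Rightarrow> real ^ 'd) \<Rightarrow> real"
  assumes "vertically_differentiable T i g" "(s, x) \<in> cadlag_domain T"
  shows "((\<lambda>h. (g (s, bump T s (y + h *\<^sub>R axis i 1) x) - g (s, bump T s y x)) / h) \<longlongrightarrow>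
    vertical_deriv T i g (s, bump T s y x)) (at 0)"
proof -
  have "(s, bump T s y x) \<in> cadlag_domain T" using assms(2) by (simp add: cadlag_domain_def cadlag_bump)
  then obtain l where l: "(vertical_quotient T i g s (bump T s y x) \<longlongrightarrow> l) (at 0)"
    using assms(1) unfolding vertically_differentiable_def by blast
  then have "vertical_deriv T i g (s, bump T s y x) = l"
    unfolding vertical_deriv_def by (simp add: tendsto_Lim)
  then show ?thesis using l by (simp add: vertical_quotient_def[abs_def] bump_bump)
qed

lemma pm_continuous_on_component:
  assumes "pm_continuous_on \<rho> S f" "\<And>p q. dist (g q) (g p) \<le> dist (f q) (f p)"
  shows "pm_continuous_on \<rho> S g"
  using assms unfolding pm_continuous_on_def by (meson le_less_trans)

text \<open>The path \<open>x\<close> stopped at \<open>t\<close>, with jumps \<open>p 0, ..., p (k - 1)\<close> at the times \<open>\<tau> 1, ..., \<tau> k\<close>. It is built by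
  bumps so that each jump is directly a vertical displacement.\<close>

primrec step_path :: "real \<Rightarrow> real \<Rightarrow> (real \<Rightarrow> real ^ 'd) \<Rightarrow> (nat \<Rightarrow> real) \<Rightarrow> (nat \<Rightarrow> real ^ 'd) \<Rightarrow> nat \<Rightarrow> real \<Rightarrow> real ^ 'd" where
  "step_path T t x \<tau> p 0 = stopped T t x"
| "step_path T t x \<tau> p (Suc k) = bump T (\<tau> (Suc k)) (p k) (step_path T t x \<tau> p k)"

lemma step_path_cong: "(\<And>j. j < k \<Longrightarrow> p j = q j) \<Longrightarrow> step_path T t x \<tau> p k = step_path T t x \<tau> q k"
  by (induction k) auto

lemma step_path_eq:
  "s \<in> {0..T} \<Longrightarrow> step_path T t x \<tau> p k s = x (min s t) + (\<Sum>j<k. if \<tau> (Suc j) \<le> s then p j else 0)"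
  by (induction k) (auto simp: stopped_def bump_def)

context
  fixes T t :: real and x :: "real \<Rightarrow> real ^ 'd" and \<tau> :: "nat \<Rightarrow> real"
  assumes t: "t \<in> {0..T}" and x: "x \<in> cont_paths T" and \<tau>0: "\<tau> 0 = t" and mono: "mono \<tau>"
begin

lemma step_path_cadlag: "step_path T t x \<tau> p k \<in> cadlag_paths T"
proof (induction k)
  case 0
  have "stopped T t x = concat_path T t x (\<lambda>_. 0)" by (simp add: stopped_def concat_path_def)
  then show ?case
    using concat_path_in_cont_paths[OF x t, of "\<lambda>_. 0"] cont_paths_subset_cadlag_paths by auto
qed (simp add: cadlag_bump)

lemma tau_ge: "t \<le> \<tau> k" using monoD[OF mono, of 0 k] \<tau>0 by simp

lemma step_path_constant_after:
  assumes "s \<in> {0..T}" "s' \<in> {0..T}" "\<tau> k \<le> s" "\<tau> k \<le> s'"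
  shows "step_path T t x \<tau> p k s = step_path T t x \<tau> p k s'"
proof -
  have "(\<Sum>j<k. if \<tau> (Suc j) \<le> s then p j else 0) = (\<Sum>j<k. if \<tau> (Suc j) \<le> s' then p j else 0)"
  proof (rule sum.cong[OF refl])
    fix j assume "j \<in> {..<k}"
    then have "\<tau> (Suc j) \<le> \<tau> k" by (intro monoD[OF mono]) auto
    then show "(if \<tau> (Suc j) \<le> s then p j else 0) = (if \<tau> (Suc j) \<le> s' then p j else 0)" using assms by auto
  qed
  moreover have "min s t = t" "min s' t = t" using tau_ge[of k] assms by auto
  ultimately show ?thesis using assms by (simp add: step_path_eq)
qed

lemma stopped_step_path:
  assumes "\<tau> k \<le> s" "s \<in> {0..T}"
  shows "stopped T s (step_path T t x \<tau> p k) = step_path T t x \<tau> p k"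
proof
  fix \<sigma>
  show "stopped T s (step_path T t x \<tau> p k) \<sigma> = step_path T t x \<tau> p k \<sigma>"
  proof (cases "\<sigma> \<in> {0..T}")
    case True
    then show ?thesis
      using step_path_constant_after[of s \<sigma> k p] assms by (auto simp: stopped_def min_def)
  next
    case False
    then show ?thesis using step_path_cadlag[of p k] by (auto simp: stopped_def cadlag_paths_def extensional_def)
  qed
qed

text \<open>The jumps that have occurred by time \<open>s\<close> form an initial segment, so a bound on the partial
  sums of the jumps bounds the distance of the step path to the stopped path at all times.\<close>

lemma partial_jump_sum: "\<exists>m\<le>k. (\<Sum>j<k. if \<tau> (Suc j) \<le> s then p j else 0) = (\<Sum>j<m. p j :: real ^ 'd)"
proof (induction k)
  case (Suc k)
  show ?case
  proof (cases "\<tau> (Suc k) \<le> s")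
    case True
    have "(\<Sum>j<Suc k. if \<tau> (Suc j) \<le> s then p j else 0) = (\<Sum>j<Suc k. p j)"
    proof (rule sum.cong[OF refl])
      fix j assume "j \<in> {..<Suc k}"
      then have "\<tau> (Suc j) \<le> \<tau> (Suc k)" by (intro monoD[OF mono]) auto
      then show "(if \<tau> (Suc j) \<le> s then p j else 0) = p j" using True by auto
    qed
    then show ?thesis by blast
  next
    case False
    then show ?thesis using Suc.IH by (auto intro: le_SucI)
  qed
qed simp

lemma d_inf_step_path:
  assumes "\<And>m. m \<le> k \<Longrightarrow> norm (\<Sum>j<m. p j) \<le> r" "s \<in> {0..T}" "t \<le> s"
  shows "d_inf T (t, x) (s, step_path T t x \<tau> p k) \<le> (s - t) + r"
    and "d_inf T (t, x) (s, bump T a z (step_path T t x \<tau> p k)) \<le> (s - t) + (r + norm z)"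
proof -
  have "norm (x (min \<sigma> t) - step_path T t x \<tau> p k (min \<sigma> s)) \<le> r" if \<sigma>: "\<sigma> \<in> {0..T}" for \<sigma>
  proof -
    obtain m where m: "m \<le> k" "(\<Sum>j<k. if \<tau> (Suc j) \<le> min \<sigma> s then p j else 0) = (\<Sum>j<m. p j)"
      using partial_jump_sum by blast
    have "min (min \<sigma> s) t = min \<sigma> t" using assms(3) by auto
    then have "step_path T t x \<tau> p k (min \<sigma> s) = x (min \<sigma> t) + (\<Sum>j<m. p j)"
      using step_path_eq[of "min \<sigma> s" T t x \<tau> p k] \<sigma> assms(2) m(2) by auto
    then show ?thesis using assms(1)[OF m(1)] by simp
  qed note le = this
  have T: "0 \<le> T" using t by auto
  show "d_inf T (t, x) (s, step_path T t x \<tau> p k) \<le> (s - t) + r"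
    using d_inf_le[OF T t assms(2), of x "step_path T t x \<tau> p k" r] le assms(3) by simp
  have "norm (x (min \<sigma> t) - bump T a z (step_path T t x \<tau> p k) (min \<sigma> s)) \<le> r + norm z" if \<sigma>: "\<sigma> \<in> {0..T}" for \<sigma>
  proof -
    let ?b = "if a \<le> min \<sigma> s then z else 0"
    have "bump T a z (step_path T t x \<tau> p k) (min \<sigma> s) = step_path T t x \<tau> p k (min \<sigma> s) + ?b"
    proof -
      have "min \<sigma> s \<in> {0..T}" using \<sigma> assms(2) by auto
      then show ?thesis by (simp add: bump_def)
    qed
    then have eq: "x (min \<sigma> t) - bump T a z (step_path T t x \<tau> p k) (min \<sigma> s) = (x (min \<sigma> t) - step_path T t x \<tau> p k (min \<sigma> s)) - ?b"
      by simp
    have "norm ?b \<le> norm z" by simp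
    then show ?thesis unfolding eq
      using le[OF \<sigma>] norm_triangle_ineq4[of "x (min \<sigma> t) - step_path T t x \<tau> p k (min \<sigma> s)" ?b] by linarith
  qed
  then have "d_inf T (t, x) (s, bump T a z (step_path T t x \<tau> p k)) \<le> \<bar>t - s\<bar> + (r + norm z)"
    by (intro d_inf_le[OF T t assms(2)]) auto
  then show "d_inf T (t, x) (s, bump T a z (step_path T t x \<tau> p k)) \<le> (s - t) + (r + norm z)"
    using assms(3) by simp
qed

lemma d_inf_step_paths:
  assumes "s \<in> {0..T}"
  shows "d_inf T (s, step_path T t x \<tau> p k) (s, step_path T t x \<tau> q k) \<le> (\<Sum>j<k. norm (q j - p j))"
proof -
  have "d_inf T (s, step_path T t x \<tau> p k) (s, step_path T t x \<tau> q k) \<le> \<bar>s - s\<bar> + (\<Sum>j<k. norm (q j - p j))"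
  proof (rule d_inf_le)
    fix \<sigma> assume "\<sigma> \<in> {0..T}"
    then have "min \<sigma> s \<in> {0..T}" using assms by auto
    then have "step_path T t x \<tau> p k (min \<sigma> s) - step_path T t x \<tau> q k (min \<sigma> s) =
        (\<Sum>j<k. if \<tau> (Suc j) \<le> min \<sigma> s then p j - q j else 0)"
      unfolding step_path_eq[OF \<open>min \<sigma> s \<in> {0..T}\<close>] add_diff_add
      by (simp add: sum_subtractf[symmetric] if_distrib cong: if_cong)
    also have "norm \<dots> \<le> (\<Sum>j<k. norm (q j - p j))"
      by (rule sum_norm_le) (auto simp: norm_minus_commute)
    finally show "norm (step_path T t x \<tau> p k (min \<sigma> s) - step_path T t x \<tau> q k (min \<sigma> s)) \<le> (\<Sum>j<k. norm (q j - p j))" .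
  qed (use assms t in auto)
  then show ?thesis by simp
qed

lemma continuous_on_step_path:
  assumes g: "pm_continuous_on (d_inf T) (cadlag_domain T) g" and s: "s \<in> {0..T}"
  shows "continuous_on UNIV (\<lambda>p. g (s, step_path T t x \<tau> p k) :: real)"
proof (rule continuous_on_finitely_many_coordinates[where n = k])
  fix p :: "nat \<Rightarrow> real ^ 'd" and \<epsilon> :: real assume "\<epsilon> > 0"
  have dom: "(s, step_path T t x \<tau> q k) \<in> cadlag_domain T" for q using s step_path_cadlag by (simp add: cadlag_domain_def)
  then obtain \<delta> where \<delta>: "\<delta> > 0" "\<And>y. y \<in> cadlag_domain T \<Longrightarrow> d_inf T (s, step_path T t x \<tau> p k) y < \<delta> \<Longrightarrow> dist (g y) (g (s, step_path T t x \<tau> p k)) < \<epsilon>"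
    using g \<open>\<epsilon> > 0\<close> unfolding pm_continuous_on_def by blast
  then show "\<exists>\<delta>>0. \<forall>q. (\<Sum>j<k. norm (q j - p j)) < \<delta> \<longrightarrow> dist (g (s, step_path T t x \<tau> q k)) (g (s, step_path T t x \<tau> p k)) < \<epsilon>"
    using d_inf_step_paths[OF s] dom by (meson le_less_trans)
qed

text \<open>Between two jump times the step path is frozen: it equals its own stopped version, so the
  horizontal derivative is the right derivative in time of \<open>\<psi>\<close> along the fixed path.\<close>

lemma horizontal_increment:
  assumes \<psi>: "pm_continuous_on (d_inf T) (cadlag_domain T) \<psi>" "horizontally_differentiable T \<psi>"
    and k: "\<tau> (Suc k) < T"
    and near: "\<And>s. s \<in> {\<tau> k..<\<tau> (Suc k)} \<Longrightarrow> \<bar>horizontal_deriv T \<psi> (s, step_path T t x \<tau> p k) - a\<bar> \<le> \<eta>"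
  shows "\<bar>\<psi> (\<tau> (Suc k), step_path T t x \<tau> p k) - \<psi> (\<tau> k, step_path T t x \<tau> p k) - a * (\<tau> (Suc k) - \<tau> k)\<bar>
    \<le> \<eta> * (\<tau> (Suc k) - \<tau> k)"
proof (rule right_derivative_approx[where g = "\<lambda>s. \<psi> (s, step_path T t x \<tau> p k)" and l = "\<lambda>s. horizontal_deriv T \<psi> (s, step_path T t x \<tau> p k)"])
  let ?Y = "step_path T t x \<tau> p k"
  have in_T: "s \<in> {0..T}" if "s \<in> {\<tau> k..\<tau> (Suc k)}" for s using that k t tau_ge[of k] by auto
  show "\<tau> k \<le> \<tau> (Suc k)" by (rule monoD[OF mono]) simp
  show "continuous_on {\<tau> k..\<tau> (Suc k)} (\<lambda>s. \<psi> (s, ?Y))"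
    unfolding continuous_on_def
  proof
    fix s assume s: "s \<in> {\<tau> k..\<tau> (Suc k)}"
    have le: "d_inf T (s, ?Y) (s', ?Y) \<le> \<bar>s - s'\<bar>" if s': "s' \<in> {\<tau> k..\<tau> (Suc k)}" for s'
    proof -
      have "d_inf T (s, ?Y) (s', ?Y) \<le> \<bar>s - s'\<bar> + 0"
      proof (rule d_inf_le)
        fix \<sigma> assume \<sigma>: "\<sigma> \<in> {0..T}"
        have "?Y (min \<sigma> s) = ?Y (min \<sigma> s')"
        proof (cases "\<sigma> \<le> \<tau> k")
          case True then show ?thesis using s s' by (simp add: min_def)
        next
          case False then show ?thesis using s s' \<sigma> in_T[OF s] in_T[OF s'] by (intro step_path_constant_after) auto
        qed
        then show "norm (?Y (min \<sigma> s) - ?Y (min \<sigma> s')) \<le> 0" by simp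
      qed (use in_T[OF s] in_T[OF s'] t in auto)
      then show ?thesis by simp
    qed
    show "((\<lambda>s. \<psi> (s, ?Y)) \<longlongrightarrow> \<psi> (s, ?Y)) (at s within {\<tau> k..\<tau> (Suc k)})"
    proof (rule tendstoI)
      fix \<epsilon> :: real assume \<epsilon>: "0 < \<epsilon>"
      have dom: "(s, ?Y) \<in> cadlag_domain T" if "s \<in> {\<tau> k..\<tau> (Suc k)}" for s
        using in_T[OF that] step_path_cadlag by (simp add: cadlag_domain_def)
      obtain \<delta> where \<delta>: "\<delta> > 0" "\<And>y. y \<in> cadlag_domain T \<Longrightarrow> d_inf T (s, ?Y) y < \<delta> \<Longrightarrow> dist (\<psi> y) (\<psi> (s, ?Y)) < \<epsilon>"
        using \<psi>(1) \<epsilon> dom[OF s] unfolding pm_continuous_on_def by blast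
      have "\<forall>\<^sub>F s' in at s within {\<tau> k..\<tau> (Suc k)}. dist s' s < \<delta>" by (rule tendstoD[OF tendsto_ident_at \<delta>(1)])
      moreover have "\<forall>\<^sub>F s' in at s within {\<tau> k..\<tau> (Suc k)}. s' \<in> {\<tau> k..\<tau> (Suc k)}" by (simp add: eventually_at_filter)
      ultimately show "\<forall>\<^sub>F s' in at s within {\<tau> k..\<tau> (Suc k)}. dist (\<psi> (s', ?Y)) (\<psi> (s, ?Y)) < \<epsilon>"
      proof eventually_elim
        case (elim s')
        then show ?case using le[OF elim(2)] by (intro \<delta>(2) dom) (auto simp: dist_real_def abs_minus_commute)
      qed
    qed
  qed
  fix s assume s: "s \<in> {\<tau> k..<\<tau> (Suc k)}"
  have sT: "s \<in> {0..<T}" using in_T[of s] s k by auto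
  then obtain l where l: "(horizontal_quotient T \<psi> s ?Y \<longlongrightarrow> l) (at_right 0)"
    using \<psi>(2) step_path_cadlag unfolding horizontally_differentiable_def by blast
  have "horizontal_deriv T \<psi> (s, ?Y) = l" using sT l by (simp add: horizontal_deriv_def tendsto_Lim)
  moreover have "stopped T s ?Y = ?Y" using s sT by (intro stopped_step_path) auto
  ultimately show "((\<lambda>\<delta>. (\<psi> (s + \<delta>, ?Y) - \<psi> (s, ?Y)) / \<delta>) \<longlongrightarrow> horizontal_deriv T \<psi> (s, ?Y)) (at_right 0)"
    using l by (simp add: horizontal_quotient_def[abs_def])
  show "\<bar>horizontal_deriv T \<psi> (s, ?Y) - a\<bar> \<le> \<eta>" by (rule near[OF s])
qed

end

lemma step_paths_converge:
  fixes x w :: "real \<Rightarrow> real ^ 'd"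
  assumes tu: "0 \<le> t" "t < u" "u \<le> T" and x: "x \<in> cont_paths T" and w: "continuous_on {0..T} w"
    and g: "pm_continuous_on (d_inf T) (cadlag_domain T) g"
  shows "(\<lambda>n. g (u, step_path T t x (grid t u n) (increments t u n w) n)) \<longlonglongrightarrow> g (u, concat_path T t x w)"
proof (rule pm_continuous_on_tendsto[OF g])
  have t: "t \<in> {0..T}" and u: "u \<in> {0..T}" using tu by auto
  have "concat_path T t x w \<in> cont_paths T"
    by (rule concat_path_in_cont_paths[OF x t]) (use w tu in \<open>auto elim: continuous_on_subset\<close>)
  then show dom: "(u, concat_path T t x w) \<in> cadlag_domain T"
    using cont_paths_subset_cadlag_paths u by (auto simp: cadlag_domain_def)
  have mono: "mono (grid t u n)" for n using tu by (intro monoI grid_mono) auto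
  have "step_path T t x (grid t u n) p n \<in> cadlag_paths T" for n p
    by (rule step_path_cadlag[OF t x _ mono]) simp
  then show "\<forall>\<^sub>F n in sequentially. (u, step_path T t x (grid t u n) (increments t u n w) n) \<in> cadlag_domain T"
    using u by (simp add: cadlag_domain_def)
  let ?Y = "\<lambda>n. step_path T t x (grid t u n) (increments t u n w) n"
  let ?\<rho> = "\<lambda>n j s. if grid t u n (Suc j) \<le> s then 1 else 0 :: real"
  have cw: "continuous_on {t..u} w" using w tu by (auto elim: continuous_on_subset)
  have lim: "uniform_limit {t..u} (\<lambda>n s. \<Sum>j<n. ?\<rho> n j s *\<^sub>R (w (grid t u n (Suc j)) - w (grid t u n j))) (\<lambda>s. w s - w t) sequentially"
    by (rule weighted_increments_uniform_limit[OF tu(2) cw]) auto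
  have le: "\<forall>\<^sub>F n in sequentially. d_inf T (u, concat_path T t x w) (u, ?Y n) \<le> \<epsilon>" if "\<epsilon> > 0" for \<epsilon>
    using uniform_limitD[OF lim that] eventually_gt_at_top[of 0]
  proof eventually_elim
    case (elim n)
    have "d_inf T (u, concat_path T t x w) (u, ?Y n) \<le> \<bar>u - u\<bar> + \<epsilon>"
    proof (rule d_inf_le)
      fix s assume s: "s \<in> {0..T}"
      define \<sigma> where "\<sigma> = max (min s u) t"
      have \<sigma>: "\<sigma> \<in> {t..u}" using tu by (auto simp: \<sigma>_def)
      have m: "min s u \<in> {0..T}" "min (min s u) t = min s t" using s tu by auto
      have "(\<Sum>j<n. if grid t u n (Suc j) \<le> min s u then increments t u n w j else 0) =
          (\<Sum>j<n. ?\<rho> n j \<sigma> *\<^sub>R (w (grid t u n (Suc j)) - w (grid t u n j)))"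
      proof (rule sum.cong[OF refl])
        fix j
        have "t < grid t u n (Suc j)" using grid_strict_mono[OF tu(2) elim(2), of 0 "Suc j"] by simp
        then have "grid t u n (Suc j) \<le> min s u \<longleftrightarrow> grid t u n (Suc j) \<le> \<sigma>" by (auto simp: \<sigma>_def max_def)
        then show "(if grid t u n (Suc j) \<le> min s u then increments t u n w j else 0) =
          ?\<rho> n j \<sigma> *\<^sub>R (w (grid t u n (Suc j)) - w (grid t u n j))" by (simp add: increments_def)
      qed
      then have "?Y n (min s u) = x (min s t) + (\<Sum>j<n. ?\<rho> n j \<sigma> *\<^sub>R (w (grid t u n (Suc j)) - w (grid t u n j)))"
        unfolding step_path_eq[OF m(1)] m(2) by simp
      moreover have "concat_path T t x w (min s u) = x (min s t) + (w \<sigma> - w t)"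
        using m by (simp add: concat_path_def \<sigma>_def)
      moreover have "dist (\<Sum>j<n. ?\<rho> n j \<sigma> *\<^sub>R (w (grid t u n (Suc j)) - w (grid t u n j))) (w \<sigma> - w t) < \<epsilon>"
        using elim(1) \<sigma> by blast
      ultimately show "norm (concat_path T t x w (min s u) - ?Y n (min s u)) \<le> \<epsilon>"
        by (simp add: dist_norm norm_minus_commute)
    qed (use tu in auto)
    then show ?case by simp
  qed
  show "\<forall>\<^sub>F n in sequentially. d_inf T (u, concat_path T t x w) (u, ?Y n) < \<delta>" if "\<delta> > 0" for \<delta>
    using le[OF half_gt_zero[OF that]] by (rule eventually_mono) (use that in linarith)
qed

section \<open>Short-time expansion of the expectation along Brownian paths\<close>

context brownian begin

text \<open>One step of the grid with the past \<open>p\<close> fixed: the frozen motion contributes $a\delta$ and the Gaussian jump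
  $\frac{\delta}{2}\sum_i A_i$. The jump is truncated at $2r$, which keeps the path
  within distance $3r$ of the frozen path \<open>x\<close>, and the truncation costs only $O(\delta^2)$.\<close>

lemma one_step_expectation:
  fixes Z :: "'a \<Rightarrow> real ^ 'd" and \<psi> :: "real \<times> (real \<Rightarrow> real ^ 'd) \<Rightarrow> real" and A :: "'d \<Rightarrow> real"
  assumes t: "t \<in> {0..T}" and x: "x \<in> cont_paths T" and \<tau>: "\<tau> 0 = t" "mono \<tau>" "\<tau> (Suc k) < T"
    and \<psi>: "\<psi> \<in> C12_cadlag T"
    and \<delta>: "\<tau> (Suc k) - \<tau> k = \<delta>" "0 < \<delta>" "\<delta> \<le> 1"
    and Z: "distributed M lborel Z (\<lambda>y. ennreal (gaussian_density \<delta> y))"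
    and p: "\<And>m. m \<le> k \<Longrightarrow> norm (\<Sum>j<m. p j) \<le> r" and r: "r > 0" "(\<tau> (Suc k) - t) + 3 * r < \<rho>"
    and near: "\<And>q. q \<in> cadlag_domain T \<Longrightarrow> d_inf T (t, x) q < \<rho> \<Longrightarrow> \<bar>horizontal_deriv T \<psi> q - a\<bar> \<le> \<eta>"
      "\<And>q i. q \<in> cadlag_domain T \<Longrightarrow> d_inf T (t, x) q < \<rho> \<Longrightarrow> \<bar>vertical_deriv T i (vertical_deriv T i \<psi>) q - A i\<bar> \<le> \<eta>"
  defines "Y \<equiv> step_path T t x \<tau> p k"
  shows "\<bar>expectation (\<lambda>\<omega>. if norm (Z \<omega>) \<le> 2 * r then \<psi> (\<tau> (Suc k), bump T (\<tau> (Suc k)) (Z \<omega>) Y) - \<psi> (\<tau> k, Y) else 0)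
      - \<delta> * (a + (\<Sum>i\<in>UNIV. A i) / 2)\<bar>
    \<le> (1 + real CARD('d) / 2) * \<eta> * \<delta>
      + 3 * (real CARD('d))\<^sup>2 * (\<bar>a\<bar> / (2 * r) ^ 4 + (\<Sum>i\<in>UNIV. \<bar>A i\<bar>) / (2 * r)\<^sup>2 / 2) * \<delta>\<^sup>2"
proof -
  note step = t x \<tau>(1,2)
  define u where "u = \<tau> (Suc k)"
  have tk: "t \<le> \<tau> k" by (rule tau_ge[OF step])
  have u: "u \<in> {0..T}" "t \<le> u" "u < T" using tk \<delta> \<tau> t by (auto simp: u_def)
  have Y: "Y \<in> cadlag_paths T" unfolding Y_def by (rule step_path_cadlag[OF step])
  have uY: "(u, Y) \<in> cadlag_domain T" using u Y by (simp add: cadlag_domain_def)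
  have reg: "pm_continuous_on (d_inf T) (cadlag_domain T) \<psi>" "horizontally_differentiable T \<psi>"
    "vertically_differentiable T i \<psi>" "vertically_differentiable T j (vertical_deriv T i \<psi>)"
    "pm_continuous_on (d_inf T) (cadlag_domain T) (vertical_grad T \<psi>)" for i j
    using \<psi> by (auto simp: C12_cadlag_def)
  have grad: "pm_continuous_on (d_inf T) (cadlag_domain T) (vertical_deriv T i \<psi>)" for i
  proof (rule pm_continuous_on_component[OF reg(5)])
    show "dist (vertical_deriv T i \<psi> q) (vertical_deriv T i \<psi> p) \<le> dist (vertical_grad T \<psi> q) (vertical_grad T \<psi> p)" for p q
      using dist_vec_nth_le[of "vertical_grad T \<psi> q" i "vertical_grad T \<psi> p"] by (simp add: vertical_grad_def)
  qed
  define f where "f z = \<psi> (u, bump T u z Y)" for z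
  define h where "h = f 0 - \<psi> (\<tau> k, Y)"
  have f0: "f 0 = \<psi> (u, Y)" by (simp add: f_def bump_zero[OF Y])
  have "\<bar>\<psi> (\<tau> (Suc k), Y) - \<psi> (\<tau> k, Y) - a * (\<tau> (Suc k) - \<tau> k)\<bar> \<le> \<eta> * (\<tau> (Suc k) - \<tau> k)"
    unfolding Y_def
  proof (rule horizontal_increment[OF step reg(1,2) \<tau>(3)])
    fix s assume s: "s \<in> {\<tau> k..<\<tau> (Suc k)}"
    have sT: "s \<in> {0..T}" "t \<le> s" using s tk t u by (auto simp: u_def)
    have "d_inf T (t, x) (s, step_path T t x \<tau> p k) \<le> (s - t) + r"
      by (rule d_inf_step_path(1)[OF step p sT])
    also have "\<dots> < \<rho>" using s r by auto
    finally show "\<bar>horizontal_deriv T \<psi> (s, step_path T t x \<tau> p k) - a\<bar> \<le> \<eta>"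
      using sT step_path_cadlag[OF step] by (intro near(1)) (simp_all add: cadlag_domain_def)
  qed
  then have h: "\<bar>h - a * \<delta>\<bar> \<le> \<eta> * \<delta>" by (simp add: h_def f0 \<delta>(1) u_def)
  have near2: "\<bar>vertical_deriv T i (vertical_deriv T i \<psi>) (u, bump T u z Y) - A i\<bar> \<le> \<eta>" if z: "norm z \<le> 2 * r" for i z
  proof (rule near(2))
    show "(u, bump T u z Y) \<in> cadlag_domain T" using u Y by (simp add: cadlag_domain_def cadlag_bump)
    have "d_inf T (t, x) (u, bump T u z Y) \<le> (u - t) + (r + norm z)"
      unfolding Y_def by (rule d_inf_step_path(2)[OF step p u(1,2)])
    also have "\<dots> < \<rho>" using r z by (simp add: u_def)
    finally show "d_inf T (t, x) (u, bump T u z Y) < \<rho>" .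
  qed
  have r2: "2 * r > 0" using r by simp
  note jump = gaussian_local_expansion[OF \<delta>(2) Z r2, where f = f and ?f1.0 = "\<lambda>i z. vertical_deriv T i \<psi> (u, bump T u z Y)"
      and ?f2.0 = "\<lambda>i z. vertical_deriv T i (vertical_deriv T i \<psi>) (u, bump T u z Y)" and a = A and \<eta> = \<eta>,
      unfolded f_def, OF continuous_on_bump[OF reg(1) uY] continuous_on_bump[OF grad uY]
        vertical_deriv_bump[OF reg(3) uY] vertical_deriv_bump[OF reg(4) uY] near2, folded f_def]
  have Zm: "Z \<in> borel_measurable M" by (rule gaussian_measurable[OF \<delta>(2) Z])
  define E where "E = {\<omega> \<in> space M. norm (Z \<omega>) > 2 * r}"
  have E: "E \<in> events" unfolding E_def using Zm by measurable
  have PE: "prob E \<le> 3 * (real CARD('d))\<^sup>2 * \<delta>\<^sup>2 / (2 * r) ^ 4" unfolding E_def by (rule gaussian_tail[OF \<delta>(2) Z r2])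
  let ?J = "\<lambda>\<omega>. if norm (Z \<omega>) \<le> 2 * r then f (Z \<omega>) - f 0 else 0"
  have "expectation (\<lambda>\<omega>. if norm (Z \<omega>) \<le> 2 * r then f (Z \<omega>) - \<psi> (\<tau> k, Y) else 0) =
      expectation (\<lambda>\<omega>. ?J \<omega> + h * indicator (space M - E) \<omega>)"
    by (rule Bochner_Integration.integral_cong) (auto simp: h_def E_def indicator_def)
  also have "\<dots> = expectation ?J + h * prob (space M - E)"
    using jump(1) E by (subst Bochner_Integration.integral_add) (auto simp: emeasure_eq_measure)
  also have "prob (space M - E) = 1 - prob E" by (rule prob_compl[OF E])
  finally have eq: "expectation (\<lambda>\<omega>. if norm (Z \<omega>) \<le> 2 * r then f (Z \<omega>) - \<psi> (\<tau> k, Y) else 0)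
      = expectation ?J + h * (1 - prob E)" .
  have "\<bar>h * (1 - prob E) - a * \<delta>\<bar> = \<bar>(h - a * \<delta>) * (1 - prob E) - a * \<delta> * prob E\<bar>" by (simp add: algebra_simps)
  also have "\<dots> \<le> \<bar>h - a * \<delta>\<bar> * \<bar>1 - prob E\<bar> + \<bar>a * \<delta>\<bar> * prob E"
    by (rule order_trans[OF abs_triangle_ineq4]) (simp add: abs_mult)
  also have "\<dots> \<le> \<eta> * \<delta> * 1 + \<bar>a\<bar> * 1 * (3 * (real CARD('d))\<^sup>2 * \<delta>\<^sup>2 / (2 * r) ^ 4)"
    unfolding abs_mult using h PE \<delta>(2,3) order_trans[OF abs_ge_zero h] by (intro add_mono mult_mono) auto
  finally have 1: "\<bar>h * (1 - prob E) - a * \<delta>\<bar> \<le> \<eta> * \<delta> + \<bar>a\<bar> * (3 * (real CARD('d))\<^sup>2 * \<delta>\<^sup>2 / (2 * r) ^ 4)" by simp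
  have "\<bar>(expectation ?J + h * (1 - prob E)) - \<delta> * (a + (\<Sum>i\<in>UNIV. A i) / 2)\<bar>
      \<le> \<bar>expectation ?J - \<delta> / 2 * (\<Sum>i\<in>UNIV. A i)\<bar> + \<bar>h * (1 - prob E) - a * \<delta>\<bar>"
    by (rule order_trans[OF _ abs_triangle_ineq]) (simp add: algebra_simps)
  also have "\<dots> \<le> (\<eta> * real CARD('d) * \<delta> / 2 + 3 * (real CARD('d))\<^sup>2 * \<delta>\<^sup>2 / (2 * r)\<^sup>2 * (\<Sum>i\<in>UNIV. \<bar>A i\<bar>) / 2)
      + (\<eta> * \<delta> + \<bar>a\<bar> * (3 * (real CARD('d))\<^sup>2 * \<delta>\<^sup>2 / (2 * r) ^ 4))"
    by (rule add_mono[OF jump(2) 1])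
  also have "\<dots> = (1 + real CARD('d) / 2) * \<eta> * \<delta>
      + 3 * (real CARD('d))\<^sup>2 * (\<bar>a\<bar> / (2 * r) ^ 4 + (\<Sum>i\<in>UNIV. \<bar>A i\<bar>) / (2 * r)\<^sup>2 / 2) * \<delta>\<^sup>2"
    by (simp add: distrib_left distrib_right mult_ac)
  finally show ?thesis unfolding eq[symmetric] unfolding f_def u_def .
qed


text \<open>The terms \<open>H k\<close> telescope to the increment of \<open>\<psi>\<close> along the step path until the first exit from the
  ball of radius \<open>r\<close>, and are zero afterwards. A jump that stays in the ball is at most $2r$ long, so the
  truncation in \<open>H k\<close> does not affect paths on the good event. Every partial sum is the increment of \<open>\<psi>\<close> up to a point
  in the neighbourhood of $(t,x)$ where \<open>\<psi>\<close> varies by at most 1; with this uniform bound the bad event contributes no more than its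
  probability.\<close>

lemma grid_expectation:
  fixes \<psi> :: "real \<times> (real \<Rightarrow> real ^ 'd) \<Rightarrow> real" and A :: "'d \<Rightarrow> real"
  assumes tu: "0 \<le> t" "t < u" "u < T" "u - t \<le> 1" and x: "x \<in> cont_paths T" and n: "n > 0"
    and \<psi>: "\<psi> \<in> C12_cadlag T"
    and r: "r > 0" "(u - t) + 3 * r < \<rho>" and small: "96 * (real CARD('d))\<^sup>2 * (u - t)\<^sup>2 / r ^ 4 \<le> 1"
    and near: "\<And>q. q \<in> cadlag_domain T \<Longrightarrow> d_inf T (t, x) q < \<rho> \<Longrightarrow> \<bar>horizontal_deriv T \<psi> q - a\<bar> \<le> \<eta>"
      "\<And>q i. q \<in> cadlag_domain T \<Longrightarrow> d_inf T (t, x) q < \<rho> \<Longrightarrow> \<bar>vertical_deriv T i (vertical_deriv T i \<psi>) q - A i\<bar> \<le> \<eta>"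
      "\<And>q. q \<in> cadlag_domain T \<Longrightarrow> d_inf T (t, x) q < \<rho> \<Longrightarrow> \<bar>\<psi> q - \<psi> (t, x)\<bar> \<le> 1"
  defines "\<tau> \<equiv> grid t u n"
  defines "bad \<equiv> {\<omega> \<in> space M. \<exists>k\<le>n. norm (W (\<tau> k) \<omega> - W t \<omega>) > r}"
  defines "D \<omega> \<equiv> indicator (space M - bad) \<omega> * (\<psi> (u, step_path T t x \<tau> (increments t u n (path \<omega>)) n) - \<psi> (t, x))"
  defines "L \<equiv> a + (\<Sum>i\<in>UNIV. A i) / 2"
  defines "C2 \<equiv> 3 * (real CARD('d))\<^sup>2 * (\<bar>a\<bar> / (2 * r) ^ 4 + (\<Sum>i\<in>UNIV. \<bar>A i\<bar>) / (2 * r)\<^sup>2 / 2)"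
    and "C3 \<equiv> 96 * (real CARD('d))\<^sup>2 / r ^ 4"
  shows "D \<in> borel_measurable M" and "\<And>\<omega>. \<bar>D \<omega>\<bar> \<le> 1"
    and "\<bar>expectation D - (u - t) * L\<bar> \<le> (1 + real CARD('d) / 2) * \<eta> * (u - t) + (C2 + \<bar>L\<bar> * C3 + C3) * (u - t)\<^sup>2"
proof -
  define \<delta> where "\<delta> = (u - t) / real n"
  have t: "t \<in> {0..T}" using tu by auto
  have \<tau>0: "\<tau> 0 = t" and \<tau>n: "\<tau> n = u" using n by (auto simp: \<tau>_def)
  have mono: "mono \<tau>" unfolding \<tau>_def using tu by (intro monoI grid_mono) auto
  have \<tau>d: "\<tau> (Suc k) - \<tau> k = \<delta>" for k by (simp add: \<tau>_def \<delta>_def grid_Suc_diff)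
  have \<delta>: "0 < \<delta>" "\<delta> \<le> u - t" "\<delta> \<le> 1" "real n * \<delta> = u - t"
  proof -
    show "0 < \<delta>" "real n * \<delta> = u - t" using tu(2) n by (simp_all add: \<delta>_def)
    have "1 * \<delta> \<le> real n * \<delta>" using n \<open>0 < \<delta>\<close> by (intro mult_right_mono) auto
    then show "\<delta> \<le> u - t" using \<open>real n * \<delta> = u - t\<close> by simp
    then show "\<delta> \<le> 1" using tu(4) by simp
  qed
  have \<tau>_range: "\<tau> k \<in> {t..u}" if "k \<le> n" for k using grid_in_interval[of t u n k] that tu n by (simp add: \<tau>_def)
  have \<tau>T: "\<tau> k \<in> {0..T}" if "k \<le> n" for k using \<tau>_range[OF that] tu by auto
  note step = t x \<tau>0 mono
  define Z where "Z \<omega> j = W (\<tau> (Suc j)) \<omega> - W (\<tau> j) \<omega>" for \<omega> j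
  have Zinc: "increments t u n (path \<omega>) = Z \<omega>" for \<omega> by (simp add: increments_def Z_def \<tau>_def fun_eq_iff)
  define S where "S m p = (\<Sum>j<m. p j)" for m and p :: "nat \<Rightarrow> real ^ 'd"
  define X where "X k p = step_path T t x \<tau> p k" for k and p :: "nat \<Rightarrow> real ^ 'd"
  define ok where "ok k p \<longleftrightarrow> (\<forall>m\<le>k. norm (S m p) \<le> r)" for k p
  define H where "H k p = (if ok k p \<and> norm (p k) \<le> 2 * r then \<psi> (\<tau> (Suc k), X (Suc k) p) - \<psi> (\<tau> k, X k p) else 0)" for k p
  have SZ: "S k (Z \<omega>) = W (\<tau> k) \<omega> - W t \<omega>" for k \<omega>
    unfolding S_def Z_def \<tau>0[symmetric] by (rule sum_lessThan_telescope)
  have ok_bad: "ok n (Z \<omega>) \<longleftrightarrow> \<omega> \<notin> bad" if "\<omega> \<in> space M" for \<omega>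
    using that by (auto simp: ok_def bad_def SZ not_less)
  have bad: "bad \<in> events" "prob bad \<le> C3 * (u - t)\<^sup>2"
  proof -
    note max = grid_maximal_inequality[OF tu(1,2) less_imp_le[OF tu(3)] n r(1) small]
    show "bad \<in> events" unfolding bad_def \<tau>_def by (rule max(1))
    show "prob bad \<le> C3 * (u - t)\<^sup>2" using max(2) unfolding bad_def \<tau>_def C3_def times_divide_eq_left .
  qed
  have cont: "pm_continuous_on (d_inf T) (cadlag_domain T) \<psi>" using \<psi> by (simp add: C12_cadlag_def)
  have Xdom: "(s, X k p) \<in> cadlag_domain T" if "s \<in> {0..T}" for s k p
    using that step_path_cadlag[OF step] by (simp add: X_def cadlag_domain_def)
  have close0: "\<bar>\<psi> (\<tau> k, X k p) - \<psi> (t, x)\<bar> \<le> 1" if "ok k p" "k \<le> n" for k p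
  proof (rule near(3)[OF Xdom[OF \<tau>T[OF that(2)]]])
    have "d_inf T (t, x) (\<tau> k, X k p) \<le> (\<tau> k - t) + r"
      unfolding X_def by (rule d_inf_step_path(1)[OF step]) (use that \<tau>T[OF that(2)] \<tau>_range[OF that(2)] in \<open>auto simp: ok_def S_def\<close>)
    then show "d_inf T (t, x) (\<tau> k, X k p) < \<rho>" using \<tau>_range[OF that(2)] r by auto
  qed
  have close1: "\<bar>\<psi> (\<tau> (Suc k), X (Suc k) p) - \<psi> (t, x)\<bar> \<le> 1" if "ok k p" "norm (p k) \<le> 2 * r" "k < n" for k p
  proof (rule near(3)[OF Xdom])
    have k: "Suc k \<le> n" using that by simp
    show "\<tau> (Suc k) \<in> {0..T}" by (rule \<tau>T[OF k])
    have "d_inf T (t, x) (\<tau> (Suc k), X (Suc k) p) \<le> (\<tau> (Suc k) - t) + (r + norm (p k))"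
      unfolding X_def step_path.simps
      by (rule d_inf_step_path(2)[OF step]) (use that \<tau>T[OF k] \<tau>_range[OF k] in \<open>auto simp: ok_def S_def\<close>)
    then show "d_inf T (t, x) (\<tau> (Suc k), X (Suc k) p) < \<rho>" using \<tau>_range[OF k] r that by auto
  qed
  have H2: "\<bar>H k p\<bar> \<le> 2" if "k < n" for k p
    using close0[of k p] close1[of k p] that by (auto simp: H_def)
  \<comment> \<open>\<open>(t, x)\<close> and \<open>(t, X 0 p)\<close> are at distance zero, so continuity does not distinguish them\<close>
  have start: "\<psi> (t, X 0 p) = \<psi> (t, x)" for p
  proof (rule ccontr)
    assume "\<psi> (t, X 0 p) \<noteq> \<psi> (t, x)"
    then have pos: "dist (\<psi> (t, X 0 p)) (\<psi> (t, x)) > 0" by simp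
    have "(t, x) \<in> cadlag_domain T" using t x cont_paths_subset_cadlag_paths by (auto simp: cadlag_domain_def)
    then obtain e where e: "e > 0" "\<And>q. q \<in> cadlag_domain T \<Longrightarrow> d_inf T (t, x) q < e \<Longrightarrow> dist (\<psi> q) (\<psi> (t, x)) < dist (\<psi> (t, X 0 p)) (\<psi> (t, x))"
      using cont pos unfolding pm_continuous_on_def by blast
    have "d_inf T (t, x) (t, X 0 p) \<le> (t - t) + 0"
      unfolding X_def by (rule d_inf_step_path(1)[OF step]) (use t in auto)
    then have "d_inf T (t, x) (t, X 0 p) < e" using e(1) by simp
    from e(2)[OF Xdom[OF t] this] show False by simp
  qed
  have tele: "(ok m p \<longrightarrow> (\<Sum>k<m. H k p) = \<psi> (\<tau> m, X m p) - \<psi> (t, x)) \<and> \<bar>\<Sum>k<m. H k p\<bar> \<le> 1" if "m \<le> n" for m p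
    using that
  proof (induction m)
    case 0
    then show ?case by (simp add: start \<tau>0)
  next
    case (Suc m)
    show ?case
    proof (cases "ok m p \<and> norm (p m) \<le> 2 * r")
      case True
      then have "(\<Sum>k<Suc m. H k p) = \<psi> (\<tau> (Suc m), X (Suc m) p) - \<psi> (t, x)" using Suc by (simp add: H_def)
      then show ?thesis using close1[of m p] True Suc.prems by simp
    next
      case False
      have "\<not> ok (Suc m) p"
      proof
        assume o: "ok (Suc m) p"
        then have "norm (S (Suc m) p) \<le> r" "norm (S m p) \<le> r" by (auto simp: ok_def)
        moreover have "p m = S (Suc m) p - S m p" by (simp add: S_def)
        ultimately have "norm (p m) \<le> 2 * r" using norm_triangle_ineq4[of "S (Suc m) p" "S m p"] by simp
        with o False show False by (auto simp: ok_def)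
      qed
      moreover have "(\<Sum>k<Suc m. H k p) = (\<Sum>k<m. H k p)" using False by (auto simp: H_def)
      ultimately show ?thesis using Suc by simp
    qed
  qed
  have Xm: "(\<lambda>p. \<psi> (s, X k p)) \<in> borel_measurable borel" if "s \<in> {0..T}" for s k
    unfolding X_def by (rule borel_measurable_continuous_onI[OF continuous_on_step_path[OF step cont that]])
  have Hm: "H k \<in> borel_measurable borel" if k: "k < n" for k
  proof -
    have [measurable]: "S m \<in> borel_measurable borel" for m
      unfolding S_def by (intro borel_measurable_continuous_onI continuous_on_sum continuous_on_product_coordinates)
    have "Measurable.pred borel (ok k)" unfolding ok_def by measurable
    moreover have "Measurable.pred borel (\<lambda>p::nat \<Rightarrow> real ^ 'd. norm (p k) \<le> 2 * r)"
      unfolding pred_def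
      by (intro borel_measurable_le borel_measurable_continuous_onI continuous_on_norm continuous_on_product_coordinates continuous_on_const)
    ultimately have "Measurable.pred borel (\<lambda>p. ok k p \<and> norm (p k) \<le> 2 * r)" by (rule pred_intros_logic)
    moreover have "(\<lambda>p. \<psi> (\<tau> k, X k p)) \<in> borel_measurable borel" "(\<lambda>p. \<psi> (\<tau> (Suc k), X (Suc k) p)) \<in> borel_measurable borel"
      using k by (simp_all add: Xm \<tau>T del: atLeastAtMost_iff)
    ultimately show ?thesis unfolding H_def
      by (intro measurable_If borel_measurable_diff measurable_const) (simp_all add: pred_def)
  qed
  have okE: "{\<omega> \<in> space M. ok k (Z \<omega>)} \<in> events" if "k \<le> n" for k
  proof -
    have SZm: "(\<lambda>\<omega>. norm (S j (Z \<omega>))) \<in> borel_measurable M" if "j \<le> k" for j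
      unfolding SZ
      by (rule measurable_compose[OF borel_measurable_diff[OF W_measurable[OF \<tau>T[OF order_trans[OF that \<open>k \<le> n\<close>]]] W_measurable[OF t]] borel_measurable_norm])
    have "{\<omega> \<in> space M. norm (S j (Z \<omega>)) \<le> r} \<in> events" if "j \<in> {..k}" for j
      using that by (intro borel_measurable_le SZm) auto
    then have "{\<omega> \<in> space M. \<forall>j\<in>{..k}. norm (S j (Z \<omega>)) \<le> r} \<in> events"
      by (rule sets.sets_Collect_finite_All[OF _ finite_atMost])
    moreover have "{\<omega> \<in> space M. \<forall>j\<in>{..k}. norm (S j (Z \<omega>)) \<le> r} = {\<omega> \<in> space M. ok k (Z \<omega>)}"
      by (auto simp: ok_def)
    ultimately show ?thesis by simp
  qed
  let ?e = "(1 + real CARD('d) / 2) * \<eta> * \<delta> + C2 * \<delta>\<^sup>2"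
  have C3: "C3 \<ge> 0" using r by (simp add: C3_def)
  have one: "(\<lambda>\<omega>. H k (Z \<omega>)) \<in> borel_measurable M \<and> \<bar>expectation (\<lambda>\<omega>. H k (Z \<omega>)) - \<delta> * L\<bar> \<le> ?e + \<delta> * \<bar>L\<bar> * (C3 * (u - t)\<^sup>2)"
    if k: "k < n" for k
  proof -
    have kn: "k \<le> n" "Suc k \<le> n" using k by auto
    have dep: "H k p = H k q" if pq: "\<And>j. j < n \<Longrightarrow> p j = q j" for p q
    proof -
      have Seq: "S m p = S m q" if "m \<le> k" for m unfolding S_def using that k pq by (intro sum.cong) auto
      have Xeq: "X m p = X m q" if "m \<le> Suc k" for m unfolding X_def using that k pq by (intro step_path_cong) auto
      have "ok k p = ok k q" by (simp add: ok_def Seq)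
      then show ?thesis using pq[OF k] by (simp add: H_def Xeq)
    qed
    have less: "\<tau> j < \<tau> (Suc j)" for j using \<tau>d[of j] \<delta>(1) by simp
    note it = increments_iterated_expectation[of n \<tau> "H k" 2 k, OF \<tau>T less Hm[OF k] H2[OF k] dep kn(1), folded Z_def]
    define inner where "inner \<omega> = expectation (\<lambda>\<omega>'. H k (\<lambda>j. if j < k then Z \<omega> j else Z \<omega>' j))" for \<omega>
    have merge: "H k (\<lambda>j. if j < k then Z \<omega> j else Z \<omega>' j) = (if ok k (Z \<omega>) then
        (if norm (Z \<omega>' k) \<le> 2 * r then \<psi> (\<tau> (Suc k), bump T (\<tau> (Suc k)) (Z \<omega>' k) (X k (Z \<omega>))) - \<psi> (\<tau> k, X k (Z \<omega>)) else 0) else 0)" for \<omega> \<omega>'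
    proof -
      have "S m (\<lambda>j. if j < k then Z \<omega> j else Z \<omega>' j) = S m (Z \<omega>)" if "m \<le> k" for m
        unfolding S_def using that by (intro sum.cong) auto
      then have "ok k (\<lambda>j. if j < k then Z \<omega> j else Z \<omega>' j) = ok k (Z \<omega>)" by (simp add: ok_def)
      moreover have "step_path T t x \<tau> (\<lambda>j. if j < k then Z \<omega> j else Z \<omega>' j) k = step_path T t x \<tau> (Z \<omega>) k"
        by (rule step_path_cong) simp
      ultimately show ?thesis by (simp add: H_def X_def)
    qed
    have gauss: "distributed M lborel (\<lambda>\<omega>. Z \<omega> k) (\<lambda>y. ennreal (gaussian_density \<delta> y))"
      unfolding Z_def \<tau>d[of k, symmetric] by (rule increment_gaussian) (use less[of k] \<tau>T[OF kn(1)] \<tau>T[OF kn(2)] in auto)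
    have \<tau>lt: "\<tau> (Suc k) < T" using \<tau>_range[OF kn(2)] tu by auto
    have r': "(\<tau> (Suc k) - t) + 3 * r < \<rho>" using \<tau>_range[OF kn(2)] r by auto
    have e0: "0 \<le> ?e"
    proof -
      have "(t, x) \<in> cadlag_domain T" using t x cont_paths_subset_cadlag_paths by (auto simp: cadlag_domain_def)
      have "d_inf T (t, x) (t, X 0 (\<lambda>_. 0)) \<le> (t - t) + 0"
        unfolding X_def by (rule d_inf_step_path(1)[OF step]) (use t in auto)
      then have "\<bar>horizontal_deriv T \<psi> (t, X 0 (\<lambda>_. 0)) - a\<bar> \<le> \<eta>" using r tu by (intro near(1) Xdom t) auto
      then have "\<eta> \<ge> 0" by (rule order_trans[OF abs_ge_zero])
      moreover have "C2 \<ge> 0" using r by (auto simp: C2_def intro!: mult_nonneg_nonneg add_nonneg_nonneg divide_nonneg_nonneg sum_nonneg)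
      ultimately show ?thesis using \<delta>(1) by simp
    qed
    let ?I = "indicator {\<omega> \<in> space M. ok k (Z \<omega>)} :: 'a \<Rightarrow> real"
    have inner: "\<bar>inner \<omega> - ?I \<omega> * (\<delta> * L)\<bar> \<le> ?e" if "\<omega> \<in> space M" for \<omega>
    proof (cases "ok k (Z \<omega>)")
      case True
      have "\<bar>expectation (\<lambda>\<omega>'. if norm (Z \<omega>' k) \<le> 2 * r then \<psi> (\<tau> (Suc k), bump T (\<tau> (Suc k)) (Z \<omega>' k) (step_path T t x \<tau> (Z \<omega>) k))
          - \<psi> (\<tau> k, step_path T t x \<tau> (Z \<omega>) k) else 0) - \<delta> * L\<bar> \<le> ?e"
        unfolding L_def C2_def
        by (rule one_step_expectation[OF t x \<tau>0 mono \<tau>lt \<psi> \<tau>d \<delta>(1,3) gauss _ r(1) r' near(1,2)])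
          (use True in \<open>auto simp: ok_def S_def\<close>)
      then show ?thesis unfolding inner_def merge X_def using True that by simp
    next
      case False
      then show ?thesis using e0 unfolding inner_def merge by simp
    qed
    have innerm: "inner \<in> borel_measurable M" unfolding inner_def by (rule it(3))
    have Lint: "integrable M (\<lambda>\<omega>. ?I \<omega> * (\<delta> * L))"
      using okE[OF kn(1)] by (intro integrable_mult_left) (simp add: emeasure_eq_measure)
    have innerb: "\<bar>inner \<omega>\<bar> \<le> ?e + \<bar>\<delta> * L\<bar>" if "\<omega> \<in> space M" for \<omega>
      using inner[OF that] by (cases "ok k (Z \<omega>)") (use that in \<open>auto simp: indicator_def\<close>)
    have innerI: "integrable M inner"
      by (rule integrable_const_bound[of _ "?e + \<bar>\<delta> * L\<bar>", OF _ innerm]) (use innerb in auto)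
    have "expectation (\<lambda>\<omega>. H k (Z \<omega>)) - prob {\<omega> \<in> space M. ok k (Z \<omega>)} * (\<delta> * L) = expectation (\<lambda>\<omega>. inner \<omega> - ?I \<omega> * (\<delta> * L))"
    proof -
      have e1: "expectation (\<lambda>\<omega>. H k (Z \<omega>)) = expectation inner" unfolding inner_def[abs_def] by (rule it(1))
      have e2: "expectation (\<lambda>\<omega>. ?I \<omega> * (\<delta> * L)) = prob {\<omega> \<in> space M. ok k (Z \<omega>)} * (\<delta> * L)"
        using okE[OF kn(1)] by simp
      show ?thesis
        by (rule trans[OF _ sym[OF Bochner_Integration.integral_diff[OF innerI Lint]]]) (rule arg_cong2[OF e1 sym[OF e2], where f = "(-)"])
    qed
    also have "\<bar>\<dots>\<bar> \<le> expectation (\<lambda>\<omega>. \<bar>inner \<omega> - ?I \<omega> * (\<delta> * L)\<bar>)" by (rule integral_abs_bound)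
    also have "\<dots> \<le> expectation (\<lambda>_. ?e)"
      by (rule integral_mono[OF integrable_abs[OF Bochner_Integration.integrable_diff[OF innerI Lint]] integrable_const inner])
    also have "\<dots> = ?e" by (simp add: prob_space)
    finally have 1: "\<bar>expectation (\<lambda>\<omega>. H k (Z \<omega>)) - prob {\<omega> \<in> space M. ok k (Z \<omega>)} * (\<delta> * L)\<bar> \<le> ?e" .
    have "ok k p" if "ok n p" for p using that kn(1) by (simp add: ok_def)
    then have "space M - bad \<subseteq> {\<omega> \<in> space M. ok k (Z \<omega>)}" using ok_bad by blast
    then have "prob (space M - bad) \<le> prob {\<omega> \<in> space M. ok k (Z \<omega>)}"
      using okE[OF kn(1)] by (rule finite_measure_mono)
    then have P: "1 - prob {\<omega> \<in> space M. ok k (Z \<omega>)} \<le> C3 * (u - t)\<^sup>2"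
      using prob_compl[OF bad(1)] bad(2) by simp
    have "\<bar>prob {\<omega> \<in> space M. ok k (Z \<omega>)} * (\<delta> * L) - \<delta> * L\<bar> = (1 - prob {\<omega> \<in> space M. ok k (Z \<omega>)}) * (\<delta> * \<bar>L\<bar>)"
    proof -
      have "prob {\<omega> \<in> space M. ok k (Z \<omega>)} * (\<delta> * L) - \<delta> * L = - ((1 - prob {\<omega> \<in> space M. ok k (Z \<omega>)}) * (\<delta> * L))"
        by (simp add: algebra_simps)
      then show ?thesis using \<delta>(1) by (simp only: abs_minus abs_mult) simp
    qed
    also have "\<dots> \<le> (C3 * (u - t)\<^sup>2) * (\<delta> * \<bar>L\<bar>)" using P \<delta>(1) by (intro mult_right_mono) auto
    also have "\<dots> = \<delta> * \<bar>L\<bar> * (C3 * (u - t)\<^sup>2)" by (rule mult.commute)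
    finally have "\<bar>expectation (\<lambda>\<omega>. H k (Z \<omega>)) - \<delta> * L\<bar> \<le> ?e + \<delta> * \<bar>L\<bar> * (C3 * (u - t)\<^sup>2)" using 1 by linarith
    with it(2) show ?thesis by blast
  qed
  define R where "R \<omega> = (\<Sum>k<n. H k (Z \<omega>))" for \<omega>
  have Hint: "integrable M (\<lambda>\<omega>. H k (Z \<omega>))" if "k < n" for k
    by (rule integrable_const_bound[of _ 2]) (use H2[OF that] one[OF that] in auto)
  have Rint: "integrable M R" unfolding R_def using Hint by auto
  have R1: "\<bar>R \<omega>\<bar> \<le> 1" for \<omega> unfolding R_def using tele[of n "Z \<omega>"] by simp
  have DR: "D \<omega> = indicator (space M - bad) \<omega> * R \<omega>" for \<omega>
    using tele[of n "Z \<omega>"] ok_bad[of \<omega>] by (auto simp: D_def R_def Zinc X_def \<tau>n indicator_def)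
  have Reg: "D = (\<lambda>\<omega>. indicator (space M - bad) \<omega> * R \<omega>)" by (simp add: fun_eq_iff DR)
  show Dm: "D \<in> borel_measurable M" unfolding Reg using Rint bad(1) by auto
  show D1: "\<bar>D \<omega>\<bar> \<le> 1" for \<omega> unfolding DR using R1[of \<omega>] by (simp add: indicator_def)
  have Dint: "integrable M D" by (rule integrable_const_bound[of _ 1, OF _ Dm]) (use D1 in auto)
  have "\<bar>expectation R - (u - t) * L\<bar> = \<bar>\<Sum>k<n. (expectation (\<lambda>\<omega>. H k (Z \<omega>)) - \<delta> * L)\<bar>"
    unfolding R_def using Hint \<delta>(4) by (subst Bochner_Integration.integral_sum) (auto simp: sum_subtractf mult.assoc[symmetric])
  also have "\<dots> \<le> (\<Sum>k<n. ?e + \<delta> * \<bar>L\<bar> * (C3 * (u - t)\<^sup>2))"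
    by (rule order_trans[OF sum_abs sum_mono]) (use one in auto)
  also have "\<dots> = real n * \<delta> * ((1 + real CARD('d) / 2) * \<eta> + C2 * \<delta> + \<bar>L\<bar> * (C3 * (u - t)\<^sup>2))"
    by (simp add: algebra_simps power2_eq_square)
  also have "\<dots> = (1 + real CARD('d) / 2) * \<eta> * (u - t) + C2 * ((u - t) * \<delta>) + \<bar>L\<bar> * C3 * ((u - t) * (u - t)\<^sup>2)"
    unfolding \<delta>(4) by (simp add: algebra_simps)
  also have "\<dots> \<le> (1 + real CARD('d) / 2) * \<eta> * (u - t) + C2 * (u - t)\<^sup>2 + \<bar>L\<bar> * C3 * (1 * (u - t)\<^sup>2)"
  proof (intro add_mono order_refl mult_left_mono)
    show "(u - t) * \<delta> \<le> (u - t)\<^sup>2" using \<delta>(2) tu by (simp add: power2_eq_square mult_left_mono)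
    show "(u - t) * (u - t)\<^sup>2 \<le> 1 * (u - t)\<^sup>2" using tu by (intro mult_right_mono) auto
    show "0 \<le> C2" using r by (auto simp: C2_def intro!: mult_nonneg_nonneg add_nonneg_nonneg divide_nonneg_nonneg sum_nonneg)
    show "0 \<le> \<bar>L\<bar> * C3" using C3 by simp
  qed
  finally have 2: "\<bar>expectation R - (u - t) * L\<bar> \<le> (1 + real CARD('d) / 2) * \<eta> * (u - t) + C2 * (u - t)\<^sup>2 + \<bar>L\<bar> * C3 * (u - t)\<^sup>2" by simp
  have "\<bar>expectation D - expectation R\<bar> = \<bar>expectation (\<lambda>\<omega>. D \<omega> - R \<omega>)\<bar>" using Dint Rint by simp
  also have "\<dots> \<le> expectation (\<lambda>\<omega>. \<bar>D \<omega> - R \<omega>\<bar>)" by (rule integral_abs_bound)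
  also have "\<dots> \<le> expectation (indicator bad)"
  proof (rule integral_mono)
    fix \<omega> assume "\<omega> \<in> space M"
    then show "\<bar>D \<omega> - R \<omega>\<bar> \<le> indicator bad \<omega>" using R1[of \<omega>] by (simp add: DR indicator_def)
  qed (use Dint Rint bad in \<open>auto simp: emeasure_eq_measure\<close>)
  also have "\<dots> \<le> C3 * (u - t)\<^sup>2" using bad by simp
  finally have 3: "\<bar>expectation D - expectation R\<bar> \<le> C3 * (u - t)\<^sup>2" .
  have "(C2 + \<bar>L\<bar> * C3 + C3) * (u - t)\<^sup>2 = C2 * (u - t)\<^sup>2 + \<bar>L\<bar> * C3 * (u - t)\<^sup>2 + C3 * (u - t)\<^sup>2"
    by (simp add: distrib_right)
  then show "\<bar>expectation D - (u - t) * L\<bar> \<le> (1 + real CARD('d) / 2) * \<eta> * (u - t) + (C2 + \<bar>L\<bar> * C3 + C3) * (u - t)\<^sup>2"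
    using 2 3 by linarith
qed


text \<open>Refining by powers of two makes the grids nested, so the bad events increase and their union
  still has probability $O((u-t)^2)$; off the union the increments along step paths converge to the increment along
  the Brownian path, and the bound by 1 lets expectations pass to the limit.\<close>

lemma local_expectation:
  fixes \<psi> :: "real \<times> (real \<Rightarrow> real ^ 'd) \<Rightarrow> real" and A :: "'d \<Rightarrow> real"
  assumes tu: "0 \<le> t" "t < u" "u < T" "u - t \<le> 1" and x: "x \<in> cont_paths T"
    and \<psi>: "\<psi> \<in> C12_cadlag T"
    and r: "r > 0" "(u - t) + 3 * r < \<rho>" and small: "96 * (real CARD('d))\<^sup>2 * (u - t)\<^sup>2 / r ^ 4 \<le> 1"
    and near: "\<And>q. q \<in> cadlag_domain T \<Longrightarrow> d_inf T (t, x) q < \<rho> \<Longrightarrow> \<bar>horizontal_deriv T \<psi> q - a\<bar> \<le> \<eta>"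
      "\<And>q i. q \<in> cadlag_domain T \<Longrightarrow> d_inf T (t, x) q < \<rho> \<Longrightarrow> \<bar>vertical_deriv T i (vertical_deriv T i \<psi>) q - A i\<bar> \<le> \<eta>"
      "\<And>q. q \<in> cadlag_domain T \<Longrightarrow> d_inf T (t, x) q < \<rho> \<Longrightarrow> \<bar>\<psi> q - \<psi> (t, x)\<bar> \<le> 1"
  defines "L \<equiv> a + (\<Sum>i\<in>UNIV. A i) / 2"
  defines "C2 \<equiv> 3 * (real CARD('d))\<^sup>2 * (\<bar>a\<bar> / (2 * r) ^ 4 + (\<Sum>i\<in>UNIV. \<bar>A i\<bar>) / (2 * r)\<^sup>2 / 2)"
    and "C3 \<equiv> 96 * (real CARD('d))\<^sup>2 / r ^ 4"
  obtains G where "G \<in> events" "prob (space M - G) \<le> C3 * (u - t)\<^sup>2"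
    "integrable M (\<lambda>\<omega>. indicator G \<omega> * (\<psi> (u, concat_path T t x (path \<omega>)) - \<psi> (t, x)))"
    "\<bar>expectation (\<lambda>\<omega>. indicator G \<omega> * (\<psi> (u, concat_path T t x (path \<omega>)) - \<psi> (t, x))) - (u - t) * L\<bar>
      \<le> (1 + real CARD('d) / 2) * \<eta> * (u - t) + (C2 + \<bar>L\<bar> * C3 + C3) * (u - t)\<^sup>2"
proof -
  define bad where "bad n = {\<omega> \<in> space M. \<exists>k\<le>2 ^ n. norm (W (grid t u (2 ^ n) k) \<omega> - W t \<omega>) > r}" for n :: nat
  define D where "D n \<omega> = indicator (space M - bad n) \<omega> * (\<psi> (u, step_path T t x (grid t u (2 ^ n)) (increments t u (2 ^ n) (path \<omega>)) (2 ^ n)) - \<psi> (t, x))"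
    for n \<omega>
  have bad: "bad n \<in> events" "prob (bad n) \<le> C3 * (u - t)\<^sup>2" for n
  proof -
    have pos: "(0::nat) < 2 ^ n" by simp
    note max = grid_maximal_inequality[OF tu(1,2) less_imp_le[OF tu(3)] pos r(1) small]
    show "bad n \<in> events" unfolding bad_def by (rule max(1))
    show "prob (bad n) \<le> C3 * (u - t)\<^sup>2" using max(2) unfolding bad_def C3_def times_divide_eq_left .
  qed
  have D: "D n \<in> borel_measurable M" "\<bar>D n \<omega>\<bar> \<le> 1"
    "\<bar>expectation (D n) - (u - t) * L\<bar> \<le> (1 + real CARD('d) / 2) * \<eta> * (u - t) + (C2 + \<bar>L\<bar> * C3 + C3) * (u - t)\<^sup>2" for n \<omega>
  proof -
    have pos: "(0::nat) < 2 ^ n" by simp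
    note ge = grid_expectation[OF tu x pos \<psi> r small near, folded bad_def, folded L_def C2_def C3_def]
    show "D n \<in> borel_measurable M" unfolding D_def[abs_def] by (rule ge(1))
    show "\<bar>D n \<omega>\<bar> \<le> 1" unfolding D_def by (rule ge(2))
    show "\<bar>expectation (D n) - (u - t) * L\<bar> \<le> (1 + real CARD('d) / 2) * \<eta> * (u - t) + (C2 + \<bar>L\<bar> * C3 + C3) * (u - t)\<^sup>2"
      unfolding D_def[abs_def] by (rule ge(3))
  qed
  have inc: "incseq bad"
  proof (rule incseq_SucI, rule subsetI)
    fix n \<omega> assume "\<omega> \<in> bad n"
    then obtain k where k: "\<omega> \<in> space M" "k \<le> 2 ^ n" "norm (W (grid t u (2 ^ n) k) \<omega> - W t \<omega>) > r" by (auto simp: bad_def)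
    have "grid t u (2 ^ n) k = grid t u (2 ^ Suc n) (2 * k)" using grid_double[of t u "2 ^ n" k] by simp
    moreover have "2 * k \<le> 2 ^ Suc n" using k(2) by simp
    ultimately show "\<omega> \<in> bad (Suc n)" using k unfolding bad_def by (metis (mono_tags, lifting) mem_Collect_eq)
  qed
  define G where "G = space M - (\<Union>n. bad n)"
  have G: "G \<in> events" unfolding G_def using bad(1) by auto
  have compl: "space M - G = (\<Union>n. bad n)" by (auto simp: G_def bad_def)
  have "(\<lambda>n. prob (bad n)) \<longlonglongrightarrow> prob (\<Union>n. bad n)"
    by (rule finite_Lim_measure_incseq[OF _ inc]) (use bad(1) in auto)
  then have PG: "prob (space M - G) \<le> C3 * (u - t)\<^sup>2"
    unfolding compl by (rule LIMSEQ_le_const2) (use bad(2) in auto)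
  have cont: "pm_continuous_on (d_inf T) (cadlag_domain T) \<psi>" using \<psi> by (simp add: C12_cadlag_def)
  let ?g = "\<lambda>\<omega>. indicator G \<omega> * (\<psi> (u, concat_path T t x (path \<omega>)) - \<psi> (t, x))"
  have "AE \<omega> in M. (\<lambda>n. D n \<omega>) \<longlonglongrightarrow> ?g \<omega>"
    using AE_continuous AE_space
  proof eventually_elim
    case (elim \<omega>)
    show ?case
    proof (cases "\<omega> \<in> G")
      case True
      have "filterlim (\<lambda>n. 2 ^ n :: nat) at_top sequentially"
        by (rule filterlim_subseq) (simp add: strict_mono_def)
      from filterlim_compose[OF step_paths_converge[OF tu(1,2) less_imp_le[OF tu(3)] x elim(1) cont] this]
      have "(\<lambda>n. \<psi> (u, step_path T t x (grid t u (2 ^ n)) (increments t u (2 ^ n) (path \<omega>)) (2 ^ n)) - \<psi> (t, x))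
          \<longlonglongrightarrow> \<psi> (u, concat_path T t x (path \<omega>)) - \<psi> (t, x)"
        by (intro tendsto_diff tendsto_const)
      moreover have "\<omega> \<in> space M - bad n" for n using True by (auto simp: G_def)
      ultimately show ?thesis using True by (simp add: D_def)
    next
      case False
      then obtain m where m: "\<omega> \<in> bad m" using elim(2) by (auto simp: G_def)
      have "\<forall>\<^sub>F n in sequentially. D n \<omega> = 0"
        using eventually_ge_at_top[of m]
      proof eventually_elim
        case (elim n)
        then have "\<omega> \<in> bad n" using m incseqD[OF inc elim] by blast
        then show ?case by (simp add: D_def)
      qed
      then show ?thesis using False by (simp add: tendsto_eventually)
    qed
  qed
  note lim = bounded_convergence_AE[OF D(1) this AE_I2[OF D(2)]]
  have "(\<lambda>n. \<bar>expectation (D n) - (u - t) * L\<bar>) \<longlonglongrightarrow> \<bar>expectation ?g - (u - t) * L\<bar>"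
    by (intro tendsto_intros lim(3))
  then have "\<bar>expectation ?g - (u - t) * L\<bar> \<le> (1 + real CARD('d) / 2) * \<eta> * (u - t) + (C2 + \<bar>L\<bar> * C3 + C3) * (u - t)\<^sup>2"
    by (rule LIMSEQ_le_const2) (use D(3) in blast)
  with that G PG lim(2) show thesis by blast
qed

end

context brownian_payoff begin

text \<open>The sign \<open>\<sigma>\<close> is 1 for a maximum of the difference and $-1$ for a minimum. The expected increment of
  the expected payoff over $[t,t+h]$ is zero and its part outside \<open>G\<close> is $O(h^2)$, while on \<open>G\<close> it is dominated by the increment of \<open>\<psi>\<close>,
  whose expectation is $hL$ up to errors $O(\eta h)$ and $O(h^2)$. Divide by \<open>h\<close>, let \<open>h\<close> tend to 0 and then \<open>\<eta>\<close>.\<close>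

lemma expected_payoff_touching:
  fixes \<sigma> :: real
  assumes \<psi>: "\<psi> \<in> C12_cadlag T" and t: "t \<in> {0..<T}" and x: "x \<in> cont_paths T" and \<sigma>: "\<bar>\<sigma>\<bar> = 1"
    and touch: "\<And>u y. (u, y) \<in> cont_domain T \<Longrightarrow> \<sigma> * (expected_payoff u y - \<psi> (u, y)) \<le> \<sigma> * (expected_payoff t x - \<psi> (t, x))"
  shows "0 \<le> \<sigma> * (horizontal_deriv T \<psi> (t, x) + 1 / 2 * trace (vertical_hessian T \<psi> (t, x)))"
proof -
  define a where "a = horizontal_deriv T \<psi> (t, x)"
  define A where "A i = vertical_deriv T i (vertical_deriv T i \<psi>) (t, x)" for i
  define L where "L = a + (\<Sum>i\<in>UNIV. A i) / 2"
  have L: "horizontal_deriv T \<psi> (t, x) + 1 / 2 * trace (vertical_hessian T \<psi> (t, x)) = L"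
    by (simp add: L_def a_def A_def trace_def vertical_hessian_def)
  have dom: "(t, x) \<in> cont_domain T" "(t, x) \<in> cadlag_domain T"
    using t x cont_paths_subset_cadlag_paths by (auto simp: cont_domain_def cadlag_domain_def)
  let ?c = "1 + real CARD('d) / 2"
  have B: "B \<ge> 0" using expected_payoff_bounded[OF dom(1)] by (rule order_trans[OF abs_ge_zero])
  have main: "0 \<le> \<sigma> * L + ?c * \<eta>" if \<eta>: "\<eta> > 0" for \<eta>
  proof -
    have reg: "pm_continuous_on (d_inf T) (cadlag_domain T) \<psi>" "pm_continuous_on (d_inf T) (cadlag_domain T) (horizontal_deriv T \<psi>)"
      "pm_continuous_on (d_inf T) (cadlag_domain T) (vertical_hessian T \<psi>)"
      using \<psi> by (auto simp: C12_cadlag_def)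
    obtain \<rho>1 where \<rho>1: "\<rho>1 > 0" "\<And>q. q \<in> cadlag_domain T \<Longrightarrow> d_inf T (t, x) q < \<rho>1 \<Longrightarrow> dist (\<psi> q) (\<psi> (t, x)) < 1"
      using reg(1) dom(2) unfolding pm_continuous_on_def by (meson zero_less_one)
    obtain \<rho>2 where \<rho>2: "\<rho>2 > 0" "\<And>q. q \<in> cadlag_domain T \<Longrightarrow> d_inf T (t, x) q < \<rho>2 \<Longrightarrow> dist (horizontal_deriv T \<psi> q) a < \<eta>"
      using reg(2) dom(2) \<eta> unfolding pm_continuous_on_def a_def by meson
    obtain \<rho>3 where \<rho>3: "\<rho>3 > 0" "\<And>q. q \<in> cadlag_domain T \<Longrightarrow> d_inf T (t, x) q < \<rho>3 \<Longrightarrow> dist (vertical_hessian T \<psi> q) (vertical_hessian T \<psi> (t, x)) < \<eta>"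
      using reg(3) dom(2) \<eta> unfolding pm_continuous_on_def by meson
    define \<rho> where "\<rho> = min \<rho>1 (min \<rho>2 \<rho>3)"
    have \<rho>: "\<rho> > 0" using \<rho>1 \<rho>2 \<rho>3 by (simp add: \<rho>_def)
    have near1: "\<bar>horizontal_deriv T \<psi> q - a\<bar> \<le> \<eta>" if "q \<in> cadlag_domain T" "d_inf T (t, x) q < \<rho>" for q
      using \<rho>2(2)[OF that(1)] that(2) by (simp add: \<rho>_def dist_real_def)
    have near2: "\<bar>vertical_deriv T i (vertical_deriv T i \<psi>) q - A i\<bar> \<le> \<eta>" if "q \<in> cadlag_domain T" "d_inf T (t, x) q < \<rho>" for q i
    proof -
      have "dist (vertical_hessian T \<psi> q $ i $ i) (vertical_hessian T \<psi> (t, x) $ i $ i) \<le> dist (vertical_hessian T \<psi> q) (vertical_hessian T \<psi> (t, x))"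
        by (rule order_trans[OF dist_vec_nth_le dist_vec_nth_le])
      also have "\<dots> < \<eta>" using that by (intro \<rho>3(2)) (auto simp: \<rho>_def)
      finally show ?thesis by (simp add: vertical_hessian_def A_def dist_real_def)
    qed
    have near3: "\<bar>\<psi> q - \<psi> (t, x)\<bar> \<le> 1" if "q \<in> cadlag_domain T" "d_inf T (t, x) q < \<rho>" for q
      using \<rho>1(2)[OF that(1)] that(2) by (simp add: \<rho>_def dist_real_def)
    \<comment> \<open>step paths stay within \<open>3 * r\<close> of \<open>x\<close> and times within \<open>h0\<close> of \<open>t\<close>; together less than \<open>\<rho>\<close>\<close>
    define r where "r = \<rho> / 6"
    have r: "r > 0" using \<rho> by (simp add: r_def)
    define C3 where "C3 = 96 * (real CARD('d))\<^sup>2 / r ^ 4"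
    define C2 where "C2 = 3 * (real CARD('d))\<^sup>2 * (\<bar>a\<bar> / (2 * r) ^ 4 + (\<Sum>i\<in>UNIV. \<bar>A i\<bar>) / (2 * r)\<^sup>2 / 2)"
    define K where "K = (C2 + \<bar>L\<bar> * C3 + C3) + 2 * B * C3"
    have C3: "C3 \<ge> 0" using r by (simp add: C3_def)
    have "C2 \<ge> 0" using r by (auto simp: C2_def intro!: mult_nonneg_nonneg add_nonneg_nonneg divide_nonneg_nonneg sum_nonneg)
    then have K: "K \<ge> 0" using C3 B by (simp add: K_def)
    \<comment> \<open>the last bound makes \<open>C3 * h\<^sup>2 \<le> 1\<close>, as required by the maximal inequality\<close>
    define h0 where "h0 = min (min (T - t) (\<rho> / 2)) (1 / (C3 + 1))"
    have h0: "h0 > 0" using t \<rho> C3 by (simp add: h0_def)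
    have step: "0 \<le> \<sigma> * L + ?c * \<eta> + K * h" if h: "0 < h" "h < h0" for h
    proof -
      define u where "u = t + h"
      have h1: "h < T - t" "h < \<rho> / 2" "h < 1 / (C3 + 1)" using h by (auto simp: h0_def)
      have "1 / (C3 + 1) \<le> 1" using C3 by simp
      then have h1': "h \<le> 1" using h1 by simp
      have tu: "0 \<le> t" "t < u" "u < T" "u - t \<le> 1" using t h h1 h1' by (auto simp: u_def)
      have ut: "u - t = h" by (simp add: u_def)
      have "C3 * h\<^sup>2 \<le> C3 * h" using C3 h h1' by (intro mult_left_mono) (auto simp: power2_eq_square mult_left_le)
      also have "\<dots> \<le> (C3 + 1) * h" using h by simp
      also have "\<dots> \<le> 1" using h1(3) C3 by (simp add: field_simps)
      finally have small: "96 * (real CARD('d))\<^sup>2 * (u - t)\<^sup>2 / r ^ 4 \<le> 1" by (simp add: C3_def ut)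
      have r\<rho>: "(u - t) + 3 * r < \<rho>" using h1(2) by (simp add: ut r_def)
      let ?Y = "\<lambda>\<omega>. concat_path T t x (path \<omega>)"
      obtain G where G: "G \<in> events" "prob (space M - G) \<le> C3 * h\<^sup>2"
        "integrable M (\<lambda>\<omega>. indicator G \<omega> * (\<psi> (u, ?Y \<omega>) - \<psi> (t, x)))"
        "\<bar>expectation (\<lambda>\<omega>. indicator G \<omega> * (\<psi> (u, ?Y \<omega>) - \<psi> (t, x))) - h * L\<bar> \<le> ?c * \<eta> * h + (C2 + \<bar>L\<bar> * C3 + C3) * h\<^sup>2"
        using local_expectation[OF tu x \<psi> r r\<rho> small near1 near2 near3] unfolding ut L_def C2_def C3_def by blast
      let ?g = "\<lambda>\<omega>. indicator G \<omega> * (\<psi> (u, ?Y \<omega>) - \<psi> (t, x))"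
      let ?q = "\<lambda>\<omega>. expected_payoff u (?Y \<omega>) - expected_payoff t x"
      have Ydom: "(u, ?Y \<omega>) \<in> cont_domain T" if "continuous_on {0..T} (path \<omega>)" for \<omega>
        using concat_path_continuous[OF dom(1) that] tu by (simp add: cont_domain_def)
      have qint: "integrable M ?q" and q0: "expectation ?q = 0"
        using payoff_tower(2,3)[OF tu(1,2,3) x] by (auto simp: prob_space)
      have qb: "AE \<omega> in M. \<bar>?q \<omega>\<bar> \<le> 2 * B"
        using AE_continuous
      proof eventually_elim
        case (elim \<omega>)
        show ?case using expected_payoff_bounded[OF Ydom[OF elim]] expected_payoff_bounded[OF dom(1)] by linarith
      qed
      have Gq: "integrable M (\<lambda>\<omega>. indicator G \<omega> * ?q \<omega>)" "integrable M (\<lambda>\<omega>. indicator (space M - G) \<omega> * ?q \<omega>)"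
        using integrable_mult_indicator[OF G(1) qint] integrable_mult_indicator[OF sets.compl_sets[OF G(1)] qint] by simp_all
      have "expectation ?q = expectation (\<lambda>\<omega>. indicator G \<omega> * ?q \<omega> + indicator (space M - G) \<omega> * ?q \<omega>)"
        by (rule Bochner_Integration.integral_cong) (auto simp: indicator_def)
      then have split: "expectation (\<lambda>\<omega>. indicator G \<omega> * ?q \<omega>) = - expectation (\<lambda>\<omega>. indicator (space M - G) \<omega> * ?q \<omega>)"
        using q0 Bochner_Integration.integral_add[OF Gq] by simp
      have "\<bar>expectation (\<lambda>\<omega>. indicator (space M - G) \<omega> * ?q \<omega>)\<bar> \<le> expectation (\<lambda>\<omega>. \<bar>indicator (space M - G) \<omega> * ?q \<omega>\<bar>)"
        by (rule integral_abs_bound)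
      also have "\<dots> \<le> expectation (\<lambda>\<omega>. indicator (space M - G) \<omega> * (2 * B))"
      proof (rule integral_mono_AE)
        show "integrable M (\<lambda>\<omega>. indicator (space M - G) \<omega> * (2 * B))"
          using G(1) by (intro integrable_mult_left) (simp add: emeasure_eq_measure)
        show "AE \<omega> in M. \<bar>indicator (space M - G) \<omega> * ?q \<omega>\<bar> \<le> indicator (space M - G) \<omega> * (2 * B)"
          using qb by eventually_elim (simp add: indicator_def)
      qed (rule integrable_abs[OF Gq(2)])
      also have "\<dots> = prob (space M - G) * (2 * B)" using G(1) by simp
      also have "\<dots> \<le> C3 * h\<^sup>2 * (2 * B)" using G(2) B by (intro mult_right_mono) auto
      finally have Gq_bound: "\<bar>expectation (\<lambda>\<omega>. indicator G \<omega> * ?q \<omega>)\<bar> \<le> 2 * B * C3 * h\<^sup>2" unfolding split by (simp add: mult_ac)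
      have "expectation (\<lambda>\<omega>. \<sigma> * (indicator G \<omega> * ?q \<omega>)) \<le> expectation (\<lambda>\<omega>. \<sigma> * ?g \<omega>)"
      proof (rule integral_mono_AE)
        show "AE \<omega> in M. \<sigma> * (indicator G \<omega> * ?q \<omega>) \<le> \<sigma> * ?g \<omega>"
          using AE_continuous
        proof eventually_elim
          case (elim \<omega>)
          show ?case using touch[OF Ydom[OF elim]] by (simp add: indicator_def algebra_simps)
        qed
      qed (use Gq(1) G(3) in \<open>auto intro: integrable_mult_right\<close>)
      then have "\<sigma> * expectation (\<lambda>\<omega>. indicator G \<omega> * ?q \<omega>) \<le> \<sigma> * expectation ?g" by simp
      moreover have "\<bar>\<sigma> * expectation (\<lambda>\<omega>. indicator G \<omega> * ?q \<omega>)\<bar> \<le> 2 * B * C3 * h\<^sup>2"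
        using Gq_bound by (simp add: abs_mult \<sigma>)
      moreover have "\<bar>\<sigma> * expectation ?g - \<sigma> * (h * L)\<bar> \<le> ?c * \<eta> * h + (C2 + \<bar>L\<bar> * C3 + C3) * h\<^sup>2"
        using G(4) unfolding right_diff_distrib[symmetric] abs_mult \<sigma> by simp
      ultimately have "0 \<le> \<sigma> * (h * L) + (?c * \<eta> * h + (C2 + \<bar>L\<bar> * C3 + C3) * h\<^sup>2) + 2 * B * C3 * h\<^sup>2" by linarith
      also have "\<dots> = h * (\<sigma> * L + ?c * \<eta> + K * h)" by (simp add: K_def algebra_simps power2_eq_square)
      finally show ?thesis using h by (simp add: zero_le_mult_iff)
    qed
    show ?thesis
    proof (rule field_le_epsilon)
      fix e :: real assume e: "e > 0"
      define h where "h = min (h0 / 2) (e / (K + 1))"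
      have "h \<le> h0 / 2" unfolding h_def by (rule min.cobounded1)
      moreover have "0 < h" using h0 e K by (simp add: h_def)
      ultimately have h: "0 < h" "h < h0" using h0 by linarith+
      have "K * h \<le> (K + 1) * (e / (K + 1))" using K e h by (intro mult_mono) (auto simp: h_def)
      also have "\<dots> = e" using K by simp
      finally show "0 \<le> \<sigma> * L + ?c * \<eta> + e" using step[OF h] by linarith
    qed
  qed
  have "0 \<le> \<sigma> * L"
  proof (rule field_le_epsilon)
    fix e :: real assume e: "e > 0"
    have "?c > 0" by (simp add: add_pos_nonneg)
    then show "0 \<le> \<sigma> * L + e" using main[of "e / ?c"] e by simp
  qed
  then show ?thesis unfolding L .
qed

end

theorem theorem4p1:
  fixes T :: real
    and M :: "'a measure"
    and W :: "real \<Rightarrow> 'a \<Rightarrow> real ^ 'd"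
    and \<xi> :: "(real \<Rightarrow> real ^ 'd) \<Rightarrow> real"
    and v :: "real \<times> (real \<Rightarrow> real ^ 'd) \<Rightarrow> real"
  assumes "T > 0"
    and "prob_space M" and "complete_measure M"
    and "brownian_motion_on T M W"
    and "pm_continuous_on (sup_dist T) (cont_paths T) \<xi>"
    and "bounded (\<xi> ` cont_paths T)"
    and "\<And>t x. (t, x) \<in> cont_domain T \<Longrightarrow>
           v (t, x) = prob_space.expectation M (\<lambda>\<omega>. \<xi> (brownian_from T W t x \<omega>))"
  shows "pm_continuous_on (d_inf T) (cont_domain T) v \<and>
         bounded (v ` cont_domain T) \<and>
         viscosity_solution T \<xi> v"
proof -
  obtain B where B: "\<And>x. x \<in> cont_paths T \<Longrightarrow> \<bar>\<xi> x\<bar> \<le> B"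
    using assms(6) by (auto simp: bounded_iff)
  interpret complete_prob_space M
    using assms(2,3) by (simp add: complete_prob_space_def)
  interpret brownian_payoff M T W \<xi> B
    using assms(1,4,5) B by unfold_locales
  have v: "v (t, x) = expected_payoff t x" if "(t, x) \<in> cont_domain T" for t x
    using assms(7)[OF that] by (simp add: expected_payoff_def brownian_from_eq_concat_path)
  have cont: "pm_continuous_on (d_inf T) (cont_domain T) v"
    unfolding pm_continuous_on_def
  proof (intro ballI allI impI)
    fix p :: "real \<times> (real \<Rightarrow> real ^ 'd)" and \<epsilon> :: real assume p: "p \<in> cont_domain T" "0 < \<epsilon>"
    have vp: "v q = (\<lambda>(t, x). expected_payoff t x) q" if "q \<in> cont_domain T" for q :: "real \<times> (real \<Rightarrow> real ^ 'd)"
      using v that by (cases q) simp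
    obtain \<delta> where \<delta>: "\<delta> > 0" "\<forall>q\<in>cont_domain T. d_inf T p q < \<delta> \<longrightarrow>
        dist ((\<lambda>(t, x). expected_payoff t x) q) ((\<lambda>(t, x). expected_payoff t x) p) < \<epsilon>"
      using expected_payoff_continuous p unfolding pm_continuous_on_def by blast
    have "dist (v q) (v p) < \<epsilon>" if "q \<in> cont_domain T" "d_inf T p q < \<delta>" for q
      unfolding vp[OF that(1)] vp[OF p(1)] using \<delta>(2) that by blast
    then show "\<exists>\<delta>>0. \<forall>q\<in>cont_domain T. d_inf T p q < \<delta> \<longrightarrow> dist (v q) (v p) < \<epsilon>"
      using \<delta>(1) by blast
  qed
  have bdd: "bounded (v ` cont_domain T)"
    unfolding bounded_iff using expected_payoff_bounded v by (intro exI[of _ B]) auto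
  have touching: "0 \<le> \<sigma> * (horizontal_deriv T \<psi> (t, x) + 1 / 2 * trace (vertical_hessian T \<psi> (t, x)))"
    if t: "t \<in> {0..<T}" and x: "x \<in> cont_paths T" and \<phi>: "C12_pol_via T \<phi> \<psi>" and \<sigma>: "\<bar>\<sigma>\<bar> = 1"
      and ext: "\<And>p. p \<in> cont_domain T \<Longrightarrow> \<sigma> * (v p - \<phi> p) \<le> \<sigma> * (v (t, x) - \<phi> (t, x))" for t x \<phi> \<psi> and \<sigma> :: real
  proof (rule expected_payoff_touching[OF _ t x \<sigma>])
    show "\<psi> \<in> C12_cadlag T" using \<phi> by (simp add: C12_pol_via_def)
    have eq: "\<psi> p = \<phi> p" if "p \<in> cont_domain T" for p using \<phi> that by (simp add: C12_pol_via_def)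
    have tx: "(t, x) \<in> cont_domain T" using t x by (simp add: cont_domain_def)
    show "\<sigma> * (expected_payoff u y - \<psi> (u, y)) \<le> \<sigma> * (expected_payoff t x - \<psi> (t, x))" if "(u, y) \<in> cont_domain T" for u y
      using ext[OF that] by (simp add: v[OF that] v[OF tx] eq[OF that] eq[OF tx])
  qed
  have "viscosity_subsolution T \<xi> v"
    unfolding viscosity_subsolution_def
  proof (intro conjI ballI allI impI)
    show "pm_usc_on (d_inf T) (cont_domain T) v"
      using cont unfolding pm_continuous_on_def pm_usc_on_def dist_real_def by (meson abs_diff_less_iff)
    show "v (T, x) \<le> \<xi> x" if "x \<in> cont_paths T" for x
      using v[of T x] expected_payoff_end[OF that] that T_pos by (simp add: cont_domain_def)
    fix t x \<phi> \<psi>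
    assume *: "t \<in> {0..<T}" "x \<in> cont_paths T" "C12_pol_via T \<phi> \<psi>"
      and sup: "ereal (v (t, x) - \<phi> (t, x)) = (SUP p\<in>cont_domain T. ereal (v p - \<phi> p))"
    have "v p - \<phi> p \<le> v (t, x) - \<phi> (t, x)" if "p \<in> cont_domain T" for p
      using SUP_upper[OF that, of "\<lambda>p. ereal (v p - \<phi> p)"] unfolding sup[symmetric] by simp
    then show "- horizontal_deriv T \<psi> (t, x) - 1 / 2 * trace (vertical_hessian T \<psi> (t, x)) \<le> 0"
      using touching[OF *, of 1] by simp
  qed
  moreover have "viscosity_supersolution T \<xi> v"
    unfolding viscosity_supersolution_def
  proof (intro conjI ballI allI impI)
    show "pm_lsc_on (d_inf T) (cont_domain T) v"
      using cont unfolding pm_continuous_on_def pm_lsc_on_def dist_real_def by (meson abs_diff_less_iff)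
    show "v (T, x) \<ge> \<xi> x" if "x \<in> cont_paths T" for x
      using v[of T x] expected_payoff_end[OF that] that T_pos by (simp add: cont_domain_def)
    fix t x \<phi> \<psi>
    assume *: "t \<in> {0..<T}" "x \<in> cont_paths T" "C12_pol_via T \<phi> \<psi>"
      and inf: "ereal (v (t, x) - \<phi> (t, x)) = (INF p\<in>cont_domain T. ereal (v p - \<phi> p))"
    have "v (t, x) - \<phi> (t, x) \<le> v p - \<phi> p" if "p \<in> cont_domain T" for p
      using INF_lower[OF that, of "\<lambda>p. ereal (v p - \<phi> p)"] unfolding inf[symmetric] by simp
    then have "- 1 * (v p - \<phi> p) \<le> - 1 * (v (t, x) - \<phi> (t, x))" if "p \<in> cont_domain T" for p
      using that by fastforce
    from touching[OF * _ this]
    show "- horizontal_deriv T \<psi> (t, x) - 1 / 2 * trace (vertical_hessian T \<psi> (t, x)) \<ge> 0" by simp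
  qed
  ultimately show ?thesis using cont bdd by (simp add: viscosity_solution_def)
qed

end
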